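(* Let $\mathbb{F}_\theta^+$ be an aperiodic single vertex $k$-graph. Suppose that either $\mathbb{F}_\theta^+$ has the little pull-back property, or the intrinsic group $G$ of $\mathbb{F}_\theta^+$ has rank $0$. Then the fixed point algebra $\mathcal{O}_\theta^\sigma$ has a unique tracial state.
   Context: A single vertex $k$-graph $\Lambda=\mathbb{F}_\theta^+$ is a monoid (a small category with one object) with a degree homomorphism $d:\Lambda\to\mathbb{N}^k$ satisfying the factorization property: whenever $d(\lambda)=p+q$ with $p,q\in\mathbb{N}^k$, there are unique $\mu,\nu\in\Lambda$ with $\lambda=\mu\nu$, $d(\mu)=p$, $d(\nu)=q$. Let $\epsilon_1,\ldots,\epsilon_k$ be the standard generators of $\mathbb{Z}^k$. The elements of degree $\epsilon_i$ are the edges $e^i_1,\ldots,e^i_{m_i}$, finitely many; for $i<j$ the relations $e^i_{s}e^j_{t}=e^j_{t'}e^i_{s'}$ define permutations $\theta_{ij}(s,t)=(s',t')$. Put $m=(m_1,\ldots,m_k)$ and $m^p=\prod_i m_i^{p_i}$ for $p\in\mathbb{Z}^k$. The intrinsic group is $G=\{g\in\mathbb{Z}^k:m^g=1\}$. Little pull-back property: for edges $e,f$ of distinct degrees, $|\Lambda^{\min}(e,f)|\le 1$, where $\Lambda^{\min}(\mu,\nu)=\{(\xi,\eta)\in\Lambda\times\Lambda:\mu\xi=\nu\eta,\ d(\mu\xi)=d(\mu)\vee d(\nu)\}$ and $\vee$ is the coordinatewise maximum. A tuple $(V_1,\ldots,V_n)$ in a unital C*-algebra is of Cuntz-type if $V_i^*V_j=\delta_{i,j}I$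 and $\sum_iV_iV_i^*=I$. A Cuntz-type representation of $\mathbb{F}_\theta^+$ consists of Cuntz-type tuples $E^i=(E^i_1,\ldots,E^i_{m_i})$ ($1\le i\le k$) satisfying $E^i_sE^j_t=E^j_{t'}E^i_{s'}$ whenever $i<j$ and $\theta_{ij}(s,t)=(s',t')$. $\mathcal{O}_\theta$ is the universal C*-algebra for Cuntz-type representations, with generators $s_{e^i_t}$, and $s_w$ denotes the product of generators along a word $w$. $\mathbb{F}_\theta^+$ is aperiodic if and only if $\mathcal{O}_\theta$ is simple (this may be taken as the definition). The action $\sigma$ of $\mathbb{R}$ on $\mathcal{O}_\theta$ is given by $\sigma_t(s_us_v^* )=m^{it(d(v)-d(u))}s_us_v^*$ for $u,v\in\mathbb{F}_\theta^+$, $t\in\mathbb{R}$ (it is the modular action of the distinguished state of $\mathcal{O}_\theta$), and $\mathcal{O}_\theta^\sigma=\{A\in\mathcal{O}_\theta:\sigma_t(A)=A\ \forall t\in\mathbb{R}\}$. *)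

theory Defs
  imports "HOL-Analysis.Analysis" "HOL-Algebra.Ideal" "HOL-Algebra.Module"
begin

section \<open>Unital C*-algebras\<close>

text \<open>
  C*-algebras are carrier-based, so that one can quantify over them inside a formula. The zero
  algebra is allowed as a unital C*-algebra.
\<close>

definition complex_field :: "complex ring" where
  "complex_field = \<lparr>carrier = UNIV, mult = (*), one = 1, zero = 0, add = (+)\<rparr>"

record 'a cstar = "(complex, 'a) module" +
  adj :: "'a \<Rightarrow> 'a"
  cnrm :: "'a \<Rightarrow> real"

text \<open>The library's \<^locale>\<open>Metric_space\<close> requires the distance to be nonnegative and
  symmetric outside the carrier as well, hence the default value.\<close>

definition cstar_dist :: "'a cstar \<Rightarrow> 'a \<Rightarrow> 'a \<Rightarrow> real" where
  "cstar_dist A x y =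
     (if x \<in> carrier A \<and> y \<in> carrier A then cnrm A (x \<ominus>\<^bsub>A\<^esub> y) else 0)"

locale cstar_algebra = ring A + Module.module complex_field A for A :: "'a cstar" (structure) +
  assumes smult_mult_left: "\<And>c x y. x \<in> carrier A \<Longrightarrow> y \<in> carrier A \<Longrightarrow>
            (c \<odot> x) \<otimes> y = c \<odot> (x \<otimes> y)"
    and smult_mult_right: "\<And>c x y. x \<in> carrier A \<Longrightarrow> y \<in> carrier A \<Longrightarrow>
            x \<otimes> (c \<odot> y) = c \<odot> (x \<otimes> y)"
    and adj_closed: "\<And>x. x \<in> carrier A \<Longrightarrow> adj A x \<in> carrier A"
    and adj_adj: "\<And>x. x \<in> carrier A \<Longrightarrow> adj A (adj A x) = x"
    and adj_add: "\<And>x y. x \<in> carrier A \<Longrightarrow> y \<in> carrier A \<Longrightarrow>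
            adj A (x \<oplus> y) = adj A x \<oplus> adj A y"
    and adj_smult: "\<And>c x. x \<in> carrier A \<Longrightarrow> adj A (c \<odot> x) = cnj c \<odot> adj A x"
    and adj_mult: "\<And>x y. x \<in> carrier A \<Longrightarrow> y \<in> carrier A \<Longrightarrow>
            adj A (x \<otimes> y) = adj A y \<otimes> adj A x"
    and cnrm_nonneg: "\<And>x. x \<in> carrier A \<Longrightarrow> 0 \<le> cnrm A x"
    and cnrm_eq_0: "\<And>x. x \<in> carrier A \<Longrightarrow> cnrm A x = 0 \<longleftrightarrow> x = \<zero>"
    and cnrm_smult: "\<And>c x. x \<in> carrier A \<Longrightarrow> cnrm A (c \<odot> x) = cmod c * cnrm A x"
    and cnrm_triangle: "\<And>x y. x \<in> carrier A \<Longrightarrow> y \<in> carrier A \<Longrightarrow>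
            cnrm A (x \<oplus> y) \<le> cnrm A x + cnrm A y"
    and cnrm_mult: "\<And>x y. x \<in> carrier A \<Longrightarrow> y \<in> carrier A \<Longrightarrow>
            cnrm A (x \<otimes> y) \<le> cnrm A x * cnrm A y"
    and cstar_identity: "\<And>x. x \<in> carrier A \<Longrightarrow> cnrm A (adj A x \<otimes> x) = (cnrm A x)\<^sup>2"
    and complete: "Metric_space.mcomplete (carrier A) (cstar_dist A)"

definition star_hom :: "'a cstar \<Rightarrow> 'b cstar \<Rightarrow> ('a \<Rightarrow> 'b) \<Rightarrow> bool" where
  "star_hom A B h \<longleftrightarrow> h \<in> ring_hom A B \<and>
     (\<forall>c. \<forall>x\<in>carrier A. h (c \<odot>\<^bsub>A\<^esub> x) = c \<odot>\<^bsub>B\<^esub> h x) \<and>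
     (\<forall>x\<in>carrier A. h (adj A x) = adj B (h x))"

definition star_automorphism :: "'a cstar \<Rightarrow> ('a \<Rightarrow> 'a) \<Rightarrow> bool" where
  "star_automorphism A h \<longleftrightarrow> star_hom A A h \<and> bij_betw h (carrier A) (carrier A)"

text \<open>Aperiodicity of a single vertex k-graph is, by definition, simplicity of its algebra \<open>O\<^sub>\<theta>\<close>.\<close>

definition simple_cstar :: "'a cstar \<Rightarrow> bool" where
  "simple_cstar A \<longleftrightarrow> \<one>\<^bsub>A\<^esub> \<noteq> \<zero>\<^bsub>A\<^esub> \<and>
     (\<forall>I. ideal I A \<and> closedin (Metric_space.mtopology (carrier A) (cstar_dist A)) I \<longrightarrow>
        I = {\<zero>\<^bsub>A\<^esub>} \<or> I = carrier A)"

definition tracial_state :: "'a cstar \<Rightarrow> ('a \<Rightarrow> complex) \<Rightarrow> bool" where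
  "tracial_state A \<tau> \<longleftrightarrow>
     (\<forall>x\<in>carrier A. \<forall>y\<in>carrier A. \<tau> (x \<oplus>\<^bsub>A\<^esub> y) = \<tau> x + \<tau> y) \<and>
     (\<forall>c. \<forall>x\<in>carrier A. \<tau> (c \<odot>\<^bsub>A\<^esub> x) = c * \<tau> x) \<and>
     (\<forall>x\<in>carrier A. \<tau> (adj A x \<otimes>\<^bsub>A\<^esub> x) \<in> \<real>\<^sub>\<ge>\<^sub>0) \<and>
     \<tau> \<one>\<^bsub>A\<^esub> = 1 \<and>
     (\<forall>x\<in>carrier A. \<forall>y\<in>carrier A. \<tau> (x \<otimes>\<^bsub>A\<^esub> y) = \<tau> (y \<otimes>\<^bsub>A\<^esub> x))"


section \<open>Single vertex k-graphs\<close>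

text \<open>Degrees live in \<open>nat ^ 'k\<close>, where the finite index type \<open>'k\<close> stands for \<open>{1, \<dots>, k}\<close>.
  That every degree \<open>\<epsilon>\<^sub>i\<close> has an edge is not imposed: otherwise the Cuntz relations give \<open>1 = 0\<close>,
  so \<open>O\<^sub>\<theta>\<close> is zero and not simple.\<close>

definition edges :: "('l, 'm) monoid_scheme \<Rightarrow> ('l \<Rightarrow> nat ^ 'k) \<Rightarrow> 'k::finite \<Rightarrow> 'l set" where
  "edges \<Lambda> d i = {e \<in> carrier \<Lambda>. d e = axis i 1}"

locale single_vertex_kgraph = monoid \<Lambda> for \<Lambda> :: "('l, 'm) monoid_scheme" (structure) +
  fixes d :: "'l \<Rightarrow> nat ^ 'k::finite"
  assumes d_one: "d \<one> = 0"
    and d_mult: "\<And>x y. x \<in> carrier \<Lambda> \<Longrightarrow> y \<in> carrier \<Lambda> \<Longrightarrow> d (x \<otimes> y) = d x + d y"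
    and factorization: "\<And>x p q. x \<in> carrier \<Lambda> \<Longrightarrow> d x = p + q \<Longrightarrow>
          \<exists>!(\<mu>, \<nu>). \<mu> \<in> carrier \<Lambda> \<and> \<nu> \<in> carrier \<Lambda> \<and> x = \<mu> \<otimes> \<nu> \<and> d \<mu> = p \<and> d \<nu> = q"
    and finite_edges: "\<And>i. finite (edges \<Lambda> d i)"

definition minimal_extensions ::
  "('l, 'm) monoid_scheme \<Rightarrow> ('l \<Rightarrow> nat ^ 'k::finite) \<Rightarrow> 'l \<Rightarrow> 'l \<Rightarrow> ('l \<times> 'l) set" where
  "minimal_extensions \<Lambda> d \<mu> \<nu> =
     {(\<xi>, \<eta>). \<xi> \<in> carrier \<Lambda> \<and> \<eta> \<in> carrier \<Lambda> \<and> \<mu> \<otimes>\<^bsub>\<Lambda>\<^esub> \<xi> = \<nu> \<otimes>\<^bsub>\<Lambda>\<^esub> \<eta> \<and>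
        d (\<mu> \<otimes>\<^bsub>\<Lambda>\<^esub> \<xi>) = (\<chi> i. max (d \<mu> $ i) (d \<nu> $ i))}"

definition little_pullback :: "('l, 'm) monoid_scheme \<Rightarrow> ('l \<Rightarrow> nat ^ 'k::finite) \<Rightarrow> bool" where
  "little_pullback \<Lambda> d \<longleftrightarrow>
     (\<forall>i j. i \<noteq> j \<longrightarrow> (\<forall>e\<in>edges \<Lambda> d i. \<forall>f\<in>edges \<Lambda> d j.
        finite (minimal_extensions \<Lambda> d e f) \<and> card (minimal_extensions \<Lambda> d e f) \<le> 1))"

definition edge_pow :: "('l, 'm) monoid_scheme \<Rightarrow> ('l \<Rightarrow> nat ^ 'k) \<Rightarrow> int ^ 'k::finite \<Rightarrow> real" where
  "edge_pow \<Lambda> d p = (\<Prod>i\<in>UNIV. real (card (edges \<Lambda> d i)) powi (p $ i))"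

definition intrinsic_group :: "('l, 'm) monoid_scheme \<Rightarrow> ('l \<Rightarrow> nat ^ 'k) \<Rightarrow> (int ^ 'k::finite) set"
  where "intrinsic_group \<Lambda> d = {g. edge_pow \<Lambda> d g = 1}"

text \<open>The rank of a subgroup of \<open>\<int>\<^sup>k\<close>; independence is over \<open>\<int>\<close>, so the cardinalities are bounded
  by \<open>k\<close>.\<close>

definition int_rank :: "(int ^ 'k::finite) set \<Rightarrow> nat" where
  "int_rank G = Max {card S | S. S \<subseteq> G \<and> \<not> Modules.module.dependent vector_scalar_mult S}"


section \<open>The universal C*-algebra\<close>

definition cuntz_tuple :: "'a cstar \<Rightarrow> 'i set \<Rightarrow> ('i \<Rightarrow> 'a) \<Rightarrow> bool" where
  "cuntz_tuple A I V \<longleftrightarrow> V \<in> I \<rightarrow> carrier A \<and>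
     (\<forall>i\<in>I. \<forall>j\<in>I. adj A (V i) \<otimes>\<^bsub>A\<^esub> V j = (if i = j then \<one>\<^bsub>A\<^esub> else \<zero>\<^bsub>A\<^esub>)) \<and>
     (\<Oplus>\<^bsub>A\<^esub>i\<in>I. V i \<otimes>\<^bsub>A\<^esub> adj A (V i)) = \<one>\<^bsub>A\<^esub>"

text \<open>
  Edges index themselves. The equation \<open>e f = f' e'\<close> in \<open>\<Lambda>\<close>, with \<open>e, e'\<close> of degree \<open>\<epsilon>\<^sub>i\<close> and
  \<open>f, f'\<close> of degree \<open>\<epsilon>\<^sub>j\<close>, says \<open>\<theta>\<^sub>i\<^sub>j (e, f) = (e', f')\<close>. The condition for \<open>(j, i)\<close> is that for
  \<open>(i, j)\<close> with both sides exchanged, so \<open>i \<noteq> j\<close> replaces \<open>i < j\<close> and no order on \<open>'k\<close> is needed.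
\<close>

definition cuntz_rep ::
  "('l, 'm) monoid_scheme \<Rightarrow> ('l \<Rightarrow> nat ^ 'k::finite) \<Rightarrow> 'a cstar \<Rightarrow> ('l \<Rightarrow> 'a) \<Rightarrow> bool" where
  "cuntz_rep \<Lambda> d A E \<longleftrightarrow>
     (\<forall>i. cuntz_tuple A (edges \<Lambda> d i) E) \<and>
     (\<forall>i j. i \<noteq> j \<longrightarrow>
        (\<forall>e\<in>edges \<Lambda> d i. \<forall>e'\<in>edges \<Lambda> d i. \<forall>f\<in>edges \<Lambda> d j. \<forall>f'\<in>edges \<Lambda> d j.
           e \<otimes>\<^bsub>\<Lambda>\<^esub> f = f' \<otimes>\<^bsub>\<Lambda>\<^esub> e' \<longrightarrow> E e \<otimes>\<^bsub>A\<^esub> E f = E f' \<otimes>\<^bsub>A\<^esub> E e'))"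

text \<open>
  \<open>universal_cuntz_algebra \<Lambda> d A s\<close>: the algebra \<open>A\<close> with generators \<open>s\<close> is (a copy of) \<open>O\<^sub>\<theta>\<close>.
  The competing algebras \<open>B\<close> live on the type of \<open>A\<close>. If \<open>A\<close> is nonzero this is no restriction: the
  type then has at least the cardinality of the continuum, and the C*-algebra generated by the range
  of any representation, being separable, is isomorphic to one with carrier in this type. So \<open>A\<close> is
  universal among representations in C*-algebras on all types. Uniqueness of \<open>h\<close> forces \<open>s\<close> to
  generate \<open>A\<close>.
\<close>

definition universal_cuntz_algebra ::
  "('l, 'm) monoid_scheme \<Rightarrow> ('l \<Rightarrow> nat ^ 'k::finite) \<Rightarrow> 'a cstar \<Rightarrow> ('l \<Rightarrow> 'a) \<Rightarrow> bool" where
  "universal_cuntz_algebra \<Lambda> d A s \<longleftrightarrow>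
     cstar_algebra A \<and> cuntz_rep \<Lambda> d A s \<and>
     (\<forall>(B :: 'a cstar) E. cstar_algebra B \<and> cuntz_rep \<Lambda> d B E \<longrightarrow>
        (\<exists>!h. h \<in> extensional (carrier A) \<and> star_hom A B h \<and>
           (\<forall>i. \<forall>e\<in>edges \<Lambda> d i. h (s e) = E e)))"


section \<open>The action \<open>\<sigma>\<close> and its fixed point algebra\<close>

definition word_prod :: "('x, 'm) monoid_scheme \<Rightarrow> 'x list \<Rightarrow> 'x" where
  "word_prod M w = foldr (mult M) w \<one>\<^bsub>M\<^esub>"

definition edge_words :: "('l, 'm) monoid_scheme \<Rightarrow> ('l \<Rightarrow> nat ^ 'k::finite) \<Rightarrow> 'l list set" where
  "edge_words \<Lambda> d = lists (\<Union>i. edges \<Lambda> d i)"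

definition word_degree ::
  "('l, 'm) monoid_scheme \<Rightarrow> ('l \<Rightarrow> nat ^ 'k::finite) \<Rightarrow> 'l list \<Rightarrow> int ^ 'k" where
  "word_degree \<Lambda> d w = (\<chi> i. int (d (word_prod \<Lambda> w) $ i))"

text \<open>\<open>s\<^sub>u\<close> is the product of generators along any word of edges representing \<open>u \<in> \<Lambda>\<close>. The
  universal property makes the automorphism below exist and be unique.\<close>

definition sigma ::
  "('l, 'm) monoid_scheme \<Rightarrow> ('l \<Rightarrow> nat ^ 'k::finite) \<Rightarrow> 'a cstar \<Rightarrow> ('l \<Rightarrow> 'a) \<Rightarrow> real \<Rightarrow> 'a \<Rightarrow> 'a"
  where
  "sigma \<Lambda> d A s t = (THE \<phi>. \<phi> \<in> extensional (carrier A) \<and> star_automorphism A \<phi> \<and>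
     (\<forall>u\<in>edge_words \<Lambda> d. \<forall>v\<in>edge_words \<Lambda> d.
        let x = word_prod A (map s u) \<otimes>\<^bsub>A\<^esub> adj A (word_prod A (map s v))
        in \<phi> x = (complex_of_real (edge_pow \<Lambda> d (word_degree \<Lambda> d v - word_degree \<Lambda> d u))
                    powr (\<i> * complex_of_real t)) \<odot>\<^bsub>A\<^esub> x))"

definition fixed_point_algebra ::
  "('l, 'm) monoid_scheme \<Rightarrow> ('l \<Rightarrow> nat ^ 'k::finite) \<Rightarrow> 'a cstar \<Rightarrow> ('l \<Rightarrow> 'a) \<Rightarrow> 'a cstar" where
  "fixed_point_algebra \<Lambda> d A s = A\<lparr>carrier := {a \<in> carrier A. \<forall>t. sigma \<Lambda> d A s t a = a}\<rparr>"

end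

theory Submission
  imports Defs
begin

text \<open>
  Write \<open>\<Psi>\<^sub>i(a)\<close> for the average of \<open>s\<^sub>e\<^sup>* a s\<^sub>e\<close> over the edges \<open>e\<close> of degree \<open>\<epsilon>\<^sub>i\<close>. These maps are
  unital, contractive and commute. On the fixed point algebra, compositions of them bring every
  element close to a scalar, its mean: a monomial \<open>s\<^sub>u s\<^sub>v\<^sup>*\<close> with \<open>d(u) = d(v)\<close> becomes scalar after
  finitely many steps, and if \<open>d(u) \<noteq> d(v)\<close>, the little pull-back property turns \<open>s\<^sub>u s\<^sub>v\<^sup>*\<close>, once the
  common part of the degrees is cancelled, into \<open>1/m\<^sub>i\<close> times a monomial of the same degrees, so its
  mean is \<open>0\<close> because \<open>m\<^sub>i \<ge> 2\<close>. For \<open>G\<close> of rank \<open>0\<close> the second kind of monomial does not occur.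
  Simplicity enters only through \<open>1 \<noteq> 0\<close> and \<open>m\<^sub>i \<ge> 2\<close>. Every tracial state \<open>\<tau>\<close> has the form
  \<open>\<tau>' \<circ> \<Psi>\<^sub>i\<close> for another tracial state \<open>\<tau>'\<close>, so it equals the mean, and conversely the mean is
  tracial. Positivity and contractivity of homomorphisms come from square roots of \<open>1 - a\<close> and from
  two isometries with orthogonal ranges, in place of the theory of positive elements.
\<close>

section \<open>Convergence in C*-algebras\<close>

text \<open>The mean stands in for the distinguished state of \<open>O_\<theta>\<close>, which is
  never constructed. Its existence has to be proved for each element before a value can be assigned,
  so it is a relation, and additivity needs one list of averages that serves two elements at once.
  This is why the maps \<open>\<Psi>\<^sub>i\<close> have to commute; unique factorization of
  products of two edges provides it. Little pull-back enters through \<open>s_f^* s_e\<close> for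
  edges of different colors. In general this is a sum of \<open>s_\<xi> s_\<eta>^*\<close> over all
  pairs with \<open>e \<eta> = f \<xi>\<close>, and sums that grow under repeated averaging could
  outweigh the factors \<open>1/m\<^sub>i\<close>; little pull-back leaves a single term. The mean
  is tracial because averages carry \<open>s_u\<close> from the front of a product to its end at the
  price of a factor m^(-d(u)). For \<open>s_u s_v^*\<close> in the fixed point algebra, m^d(u) =
  m^d(v), so the factors met in comparing xy with yx agree. Uniqueness of the trace compares a trace
  with another one after averaging; it works because the norm bound for tracial states does not
  depend on the state.\<close>

text \<open>In \<^locale>\<open>cstar_algebra\<close> the unqualified ring facts are those of the scalar field; here they
  are those of \<open>A\<close>.\<close>

locale unital_cstar = C: cring complex_field + cstar_algebra A for A :: "'a cstar" (structure)

lemma cstar_algebra_imp_unital_cstar: "cstar_algebra A \<Longrightarrow> unital_cstar A"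
  by (simp add: unital_cstar_def cstar_algebra_def Module.module_def)

context unital_cstar
begin

section \<open>Scalars, adjoints and the norm\<close>

lemma scalar_mult_closed [simp, intro]: "x \<in> carrier A \<Longrightarrow> c \<odot> x \<in> carrier A"
  using smult_closed[of c x] by (simp add: complex_field_def)

lemma scalar_add: "x \<in> carrier A \<Longrightarrow> (b + c) \<odot> x = b \<odot> x \<oplus> c \<odot> x"
  using smult_l_distr[of b c x] by (simp add: complex_field_def)

lemma scalar_mult: "x \<in> carrier A \<Longrightarrow> b \<odot> (c \<odot> x) = (b * c) \<odot> x"
  using smult_assoc1[of b c x] by (simp add: complex_field_def)

lemma scalar_distrib: "x \<in> carrier A \<Longrightarrow> y \<in> carrier A \<Longrightarrow> c \<odot> (x \<oplus> y) = c \<odot> x \<oplus> c \<odot> y"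
  using smult_r_distr[of c x y] by (simp add: complex_field_def)

lemma scalar_one [simp]: "x \<in> carrier A \<Longrightarrow> 1 \<odot> x = x"
  using smult_one[of x] by (simp add: complex_field_def)

lemma scalar_zero [simp]: "x \<in> carrier A \<Longrightarrow> 0 \<odot> x = \<zero>"
  using smult_l_null[of x] by (simp add: complex_field_def)

lemma scalar_zero_right [simp]: "c \<odot> \<zero> = \<zero>"
  using smult_r_null[of c] by (simp add: complex_field_def)

lemma scalar_minus: "x \<in> carrier A \<Longrightarrow> (- c) \<odot> x = \<ominus> (c \<odot> x)"
  using scalar_add[of x "- c" c] by (auto intro: minus_equality[symmetric])

lemma minus_eq_scalar: "x \<in> carrier A \<Longrightarrow> \<ominus> x = (- 1) \<odot> x"
  by (simp add: scalar_minus)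

lemma scalar_minus_right: "x \<in> carrier A \<Longrightarrow> c \<odot> (\<ominus> x) = \<ominus> (c \<odot> x)"
  by (simp add: minus_eq_scalar scalar_mult mult.commute)

lemma scalar_diff: "x \<in> carrier A \<Longrightarrow> y \<in> carrier A \<Longrightarrow> c \<odot> (x \<ominus> y) = c \<odot> x \<ominus> c \<odot> y"
  by (simp add: minus_eq scalar_distrib scalar_minus_right)

lemma scalar_left_diff: "x \<in> carrier A \<Longrightarrow> (b - c) \<odot> x = b \<odot> x \<ominus> c \<odot> x"
  using scalar_add[of x b "- c"] by (simp add: minus_eq scalar_minus)

declare adj_closed [simp, intro] adj_adj [simp]

lemma adj_zero [simp]: "adj A \<zero> = \<zero>"
  using adj_smult[of \<zero> 0] by simp

lemma adj_one [simp]: "adj A \<one> = \<one>"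
  using adj_mult[of "adj A \<one>" \<one>] by simp

lemma adj_minus: "x \<in> carrier A \<Longrightarrow> adj A (\<ominus> x) = \<ominus> adj A x"
  by (simp add: minus_eq_scalar adj_smult)

lemma adj_diff: "x \<in> carrier A \<Longrightarrow> y \<in> carrier A \<Longrightarrow> adj A (x \<ominus> y) = adj A x \<ominus> adj A y"
  by (simp add: minus_eq adj_add adj_minus)

lemma diff_eq_zero_iff:
  assumes "x \<in> carrier A" "y \<in> carrier A"
  shows "x \<ominus> y = \<zero> \<longleftrightarrow> x = y"
proof
  assume "x \<ominus> y = \<zero>"
  then have "x \<oplus> (\<ominus> y \<oplus> y) = y"
    using assms by (simp flip: a_assoc add: minus_eq)
  then show "x = y" using assms by (simp add: l_neg)
qed (use assms in \<open>simp add: minus_eq r_neg\<close>)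

lemma cnrm_zero [simp]: "cnrm A \<zero> = 0"
  by (simp add: cnrm_eq_0)

lemma cnrm_minus [simp]: "x \<in> carrier A \<Longrightarrow> cnrm A (\<ominus> x) = cnrm A x"
  by (simp add: minus_eq_scalar cnrm_smult)

lemma cnrm_diff_commute: "x \<in> carrier A \<Longrightarrow> y \<in> carrier A \<Longrightarrow> cnrm A (x \<ominus> y) = cnrm A (y \<ominus> x)"
  using cnrm_minus[of "x \<ominus> y"] by (simp add: minus_eq minus_add a_comm)

lemma cnrm_diff_triangle:
  assumes "x \<in> carrier A" "y \<in> carrier A" "z \<in> carrier A"
  shows "cnrm A (x \<ominus> z) \<le> cnrm A (x \<ominus> y) + cnrm A (y \<ominus> z)"
proof -
  have "x \<ominus> z = (x \<ominus> y) \<oplus> (y \<ominus> z)"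
    using assms by (simp add: minus_eq a_assoc r_neg1 r_neg2)
  then show ?thesis using assms by (simp add: cnrm_triangle)
qed

lemma cnrm_diff_le:
  "x \<in> carrier A \<Longrightarrow> y \<in> carrier A \<Longrightarrow> cnrm A (x \<ominus> y) \<le> cnrm A x + cnrm A y"
  using cnrm_triangle[of x "\<ominus> y"] by (simp add: minus_eq)

lemma cnrm_le_add_diff:
  assumes "x \<in> carrier A" "y \<in> carrier A"
  shows "cnrm A x \<le> cnrm A y + cnrm A (x \<ominus> y)"
  using cnrm_diff_triangle[of x y \<zero>] assms by (simp add: minus_eq)

lemma cnrm_adj [simp]:
  assumes "x \<in> carrier A"
  shows "cnrm A (adj A x) = cnrm A x"
proof -
  have le: "cnrm A y \<le> cnrm A (adj A y)" if y: "y \<in> carrier A" for y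
  proof (cases "cnrm A y = 0")
    case False
    have "cnrm A y * cnrm A y \<le> cnrm A (adj A y) * cnrm A y"
      using cnrm_mult[of "adj A y" y] cstar_identity[OF y] y by (simp add: power2_eq_square)
    with False show ?thesis
      using cnrm_nonneg[OF y] by simp
  qed (simp add: cnrm_nonneg y)
  show ?thesis
    using le[OF assms] le[of "adj A x"] assms by simp
qed

lemma cnrm_one:
  assumes "\<one> \<noteq> \<zero>"
  shows "cnrm A \<one> = 1"
  using cstar_identity[of \<one>] assms cnrm_eq_0[of \<one>] by (simp add: power2_eq_square)

lemma cnrm_one_le: "cnrm A \<one> \<le> 1"
  by (cases "\<one> = \<zero>") (simp_all add: cnrm_one)

lemma cnrm_isometry_le:
  assumes "v \<in> carrier A" "adj A v \<otimes> v = \<one>"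
  shows "cnrm A v \<le> 1"
  using cstar_identity[OF assms(1)] assms(2) cnrm_one_le
  by (simp add: assms(1) cnrm_nonneg power_le_one_iff)

lemma cnrm_square_selfadjoint:
  "x \<in> carrier A \<Longrightarrow> adj A x = x \<Longrightarrow> cnrm A (x \<otimes> x) = (cnrm A x)\<^sup>2"
  using cstar_identity[of x] by simp

lemma cnrm_finsum:
  assumes "finite I" "f \<in> I \<rightarrow> carrier A"
  shows "cnrm A (finsum A f I) \<le> (\<Sum>i\<in>I. cnrm A (f i))"
  using assms
proof (induction I rule: finite_induct)
  case (insert x F)
  then have "f x \<in> carrier A" "f \<in> F \<rightarrow> carrier A" by auto
  with insert show ?case
    using cnrm_triangle[of "f x" "finsum A f F"] by (simp add: finsum_closed)
qed simp

lemma adj_finsum: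
  assumes "finite I" "f \<in> I \<rightarrow> carrier A"
  shows "adj A (finsum A f I) = (\<Oplus>i\<in>I. adj A (f i))"
  using assms
proof (induction I rule: finite_induct)
  case (insert x F)
  then have "f x \<in> carrier A" "f \<in> F \<rightarrow> carrier A" by auto
  moreover from this have "(\<lambda>i. adj A (f i)) \<in> F \<rightarrow> carrier A" by auto
  ultimately show ?case
    using insert by (simp add: adj_add finsum_closed)
qed simp

lemma scalar_finsum:
  assumes "finite I" "f \<in> I \<rightarrow> carrier A"
  shows "c \<odot> finsum A f I = (\<Oplus>i\<in>I. c \<odot> f i)"
  using assms
proof (induction I rule: finite_induct)
  case (insert x F)
  then have "f x \<in> carrier A" "f \<in> F \<rightarrow> carrier A" by auto
  moreover from this have "(\<lambda>i. c \<odot> f i) \<in> F \<rightarrow> carrier A" by auto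
  ultimately show ?case
    using insert by (simp add: scalar_distrib finsum_closed)
qed simp

lemma finsum_constant:
  assumes "finite I" "x \<in> carrier A"
  shows "(\<Oplus>i\<in>I. x) = of_nat (card I) \<odot> x"
  using assms
proof (induction I rule: finite_induct)
  case (insert y F)
  then show ?case
    by (simp add: scalar_add Pi_def)
qed simp

section \<open>Norm convergence, completeness and closed sets\<close>

definition converges :: "(nat \<Rightarrow> 'a) \<Rightarrow> 'a \<Rightarrow> bool" where
  "converges f x \<longleftrightarrow> x \<in> carrier A \<and> range f \<subseteq> carrier A \<and> (\<lambda>n. cnrm A (f n \<ominus> x)) \<longlonglongrightarrow> 0"

lemma converges_carrier: "converges f x \<Longrightarrow> x \<in> carrier A" "converges f x \<Longrightarrow> f n \<in> carrier A"
  by (auto simp: converges_def)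

lemma convergesI:
  assumes "x \<in> carrier A" "\<And>n. f n \<in> carrier A" "\<And>n. cnrm A (f n \<ominus> x) \<le> g n" "g \<longlonglongrightarrow> 0"
  shows "converges f x"
  using assms unfolding converges_def
  by (auto intro!: Lim_null_comparison[where g = g] always_eventually simp: cnrm_nonneg)

lemma converges_const: "x \<in> carrier A \<Longrightarrow> converges (\<lambda>_. x) x"
  by (rule convergesI[where g = "\<lambda>_. 0"]) (auto simp: minus_eq r_neg)

lemma converges_unique:
  assumes "converges f x" "converges f y"
  shows "x = y"
proof -
  note c = converges_carrier[OF assms(1)] converges_carrier[OF assms(2)]
  have "(\<lambda>n. cnrm A (f n \<ominus> x) + cnrm A (f n \<ominus> y)) \<longlonglongrightarrow> 0 + 0"
    using assms by (intro tendsto_add) (auto simp: converges_def)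
  moreover have "cnrm A (x \<ominus> y) \<le> cnrm A (f n \<ominus> x) + cnrm A (f n \<ominus> y)" for n
    using cnrm_diff_triangle[of x "f n" y] cnrm_diff_commute[of x "f n"] c by simp
  ultimately have "cnrm A (x \<ominus> y) \<le> 0"
    by (intro Lim_bounded2[where N = 0]) auto
  then have "x \<ominus> y = \<zero>"
    using cnrm_nonneg[of "x \<ominus> y"] cnrm_eq_0[of "x \<ominus> y"] c by auto
  then show ?thesis using c by (simp add: diff_eq_zero_iff)
qed

lemma converges_add:
  assumes "converges f x" "converges g y"
  shows "converges (\<lambda>n. f n \<oplus> g n) (x \<oplus> y)"
proof (rule convergesI)
  note c = converges_carrier[OF assms(1)] converges_carrier[OF assms(2)]
  show "x \<oplus> y \<in> carrier A" "f n \<oplus> g n \<in> carrier A" for n using c by auto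
  show "cnrm A (f n \<oplus> g n \<ominus> (x \<oplus> y)) \<le> cnrm A (f n \<ominus> x) + cnrm A (g n \<ominus> y)" for n
  proof -
    have "f n \<oplus> g n \<ominus> (x \<oplus> y) = (f n \<ominus> x) \<oplus> (g n \<ominus> y)"
      using c by (simp add: minus_eq minus_add a_ac)
    then show ?thesis using c by (simp add: cnrm_triangle)
  qed
  have "(\<lambda>n. cnrm A (f n \<ominus> x) + cnrm A (g n \<ominus> y)) \<longlonglongrightarrow> 0 + 0"
    using assms by (intro tendsto_add) (auto simp: converges_def)
  then show "(\<lambda>n. cnrm A (f n \<ominus> x) + cnrm A (g n \<ominus> y)) \<longlonglongrightarrow> 0" by simp
qed

lemma converges_scalar:
  assumes "converges f x"
  shows "converges (\<lambda>n. c \<odot> f n) (c \<odot> x)"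
proof (rule convergesI)
  note c = converges_carrier[OF assms(1)]
  show "c \<odot> x \<in> carrier A" "c \<odot> f n \<in> carrier A" for n using c by auto
  show "cnrm A (c \<odot> f n \<ominus> c \<odot> x) \<le> cmod c * cnrm A (f n \<ominus> x)" for n
    using c by (simp flip: scalar_diff add: cnrm_smult)
  show "(\<lambda>n. cmod c * cnrm A (f n \<ominus> x)) \<longlonglongrightarrow> 0"
    using assms by (intro tendsto_mult_right_zero) (auto simp: converges_def)
qed

lemma converges_adj:
  assumes "converges f x"
  shows "converges (\<lambda>n. adj A (f n)) (adj A x)"
proof (rule convergesI)
  note c = converges_carrier[OF assms(1)]
  show "adj A x \<in> carrier A" "adj A (f n) \<in> carrier A" for n using c by auto
  show "cnrm A (adj A (f n) \<ominus> adj A x) \<le> cnrm A (f n \<ominus> x)" for n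
    using c by (simp flip: adj_diff)
  show "(\<lambda>n. cnrm A (f n \<ominus> x)) \<longlonglongrightarrow> 0"
    using assms by (auto simp: converges_def)
qed

lemma mult_diff_split:
  assumes "a \<in> carrier A" "b \<in> carrier A" "x \<in> carrier A" "y \<in> carrier A"
  shows "a \<otimes> b \<ominus> x \<otimes> y = a \<otimes> (b \<ominus> y) \<oplus> (a \<ominus> x) \<otimes> y"
proof -
  have "a \<otimes> (b \<ominus> y) \<oplus> (a \<ominus> x) \<otimes> y = a \<otimes> b \<oplus> (\<ominus> (a \<otimes> y) \<oplus> (a \<otimes> y \<oplus> \<ominus> (x \<otimes> y)))"
    using assms by (simp add: minus_eq r_distr l_distr r_minus l_minus a_assoc)
  also have "\<dots> = a \<otimes> b \<ominus> x \<otimes> y"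
    using assms by (simp add: r_neg1 r_neg2 minus_eq)
  finally show ?thesis by simp
qed

lemma cnrm_mult_diff:
  assumes "a \<in> carrier A" "b \<in> carrier A" "x \<in> carrier A" "y \<in> carrier A"
  shows "cnrm A (a \<otimes> b \<ominus> x \<otimes> y) \<le> cnrm A a * cnrm A (b \<ominus> y) + cnrm A (a \<ominus> x) * cnrm A y"
proof -
  have "cnrm A (a \<otimes> b \<ominus> x \<otimes> y) \<le> cnrm A (a \<otimes> (b \<ominus> y)) + cnrm A ((a \<ominus> x) \<otimes> y)"
    using assms by (simp add: mult_diff_split cnrm_triangle)
  also have "\<dots> \<le> cnrm A a * cnrm A (b \<ominus> y) + cnrm A (a \<ominus> x) * cnrm A y"
    using assms by (intro add_mono cnrm_mult) auto
  finally show ?thesis .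
qed

lemma converges_mult:
  assumes "converges f x" "converges g y"
  shows "converges (\<lambda>n. f n \<otimes> g n) (x \<otimes> y)"
proof (rule convergesI)
  note c = converges_carrier[OF assms(1)] converges_carrier[OF assms(2)]
  let ?b = "\<lambda>n. (cnrm A x + cnrm A (f n \<ominus> x)) * cnrm A (g n \<ominus> y) + cnrm A (f n \<ominus> x) * cnrm A y"
  show "x \<otimes> y \<in> carrier A" "f n \<otimes> g n \<in> carrier A" for n using c by auto
  show "cnrm A (f n \<otimes> g n \<ominus> x \<otimes> y) \<le> ?b n" for n
  proof -
    have "cnrm A (f n) * cnrm A (g n \<ominus> y) \<le> (cnrm A x + cnrm A (f n \<ominus> x)) * cnrm A (g n \<ominus> y)"
      using c by (intro mult_right_mono cnrm_le_add_diff cnrm_nonneg) auto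
    then show ?thesis using cnrm_mult_diff[of "f n" "g n" x y] c by auto
  qed
  have "?b \<longlonglongrightarrow> (cnrm A x + 0) * 0 + 0 * cnrm A y"
    using assms by (intro tendsto_intros) (auto simp: converges_def)
  then show "?b \<longlonglongrightarrow> 0" by simp
qed

lemma Metric_space_cstar_dist: "Metric_space (carrier A) (cstar_dist A)"
proof
  fix x y z
  show "0 \<le> cstar_dist A x y" "cstar_dist A x y = cstar_dist A y x"
    by (auto simp: cstar_dist_def cnrm_nonneg cnrm_diff_commute)
  assume "x \<in> carrier A" "y \<in> carrier A"
  then show "(cstar_dist A x y = 0) = (x = y)"
    by (simp add: cstar_dist_def cnrm_eq_0 diff_eq_zero_iff)
  assume "z \<in> carrier A"
  with \<open>x \<in> carrier A\<close> \<open>y \<in> carrier A\<close>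
  show "cstar_dist A x z \<le> cstar_dist A x y + cstar_dist A y z"
    by (simp add: cstar_dist_def cnrm_diff_triangle)
qed

text \<open>Completeness and closed ideals are defined through the metric topology of the carrier;
  this lemma and \<open>closedin_iff_seq_closed\<close> translate them into
  \<open>converges\<close>, in which the later arguments are phrased.\<close>

lemma limitin_iff_converges:
  assumes "range f \<subseteq> carrier A"
  shows "limitin (Metric_space.mtopology (carrier A) (cstar_dist A)) f x sequentially \<longleftrightarrow> converges f x"
proof -
  interpret Metric_space "carrier A" "cstar_dist A" by (rule Metric_space_cstar_dist)
  have "f n \<in> carrier A" for n using assms by auto
  then show ?thesis
    using assms by (auto simp: limit_metric_sequentially converges_def LIMSEQ_def cstar_dist_def cnrm_nonneg)
qed

lemma Cauchy_converges:
  assumes "range f \<subseteq> carrier A"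
    and "\<And>e. e > 0 \<Longrightarrow> \<exists>N. \<forall>m\<ge>N. \<forall>n\<ge>N. cnrm A (f m \<ominus> f n) < e"
  obtains x where "converges f x"
proof -
  interpret Metric_space "carrier A" "cstar_dist A" by (rule Metric_space_cstar_dist)
  have "f n \<in> carrier A" for n using assms by auto
  then have "MCauchy f"
    unfolding MCauchy_def cstar_dist_def using assms by auto
  then show ?thesis
    using complete that limitin_iff_converges[OF assms(1)] unfolding mcomplete_def by blast
qed

definition seq_closed :: "'a set \<Rightarrow> bool" where
  "seq_closed S \<longleftrightarrow> (\<forall>f x. range f \<subseteq> S \<and> converges f x \<longrightarrow> x \<in> S)"

lemma seq_closedD: "seq_closed S \<Longrightarrow> (\<And>n. f n \<in> S) \<Longrightarrow> converges f x \<Longrightarrow> x \<in> S"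
  unfolding seq_closed_def by blast

lemma closedin_iff_seq_closed:
  assumes "S \<subseteq> carrier A"
  shows "closedin (Metric_space.mtopology (carrier A) (cstar_dist A)) S \<longleftrightarrow> seq_closed S"
proof -
  interpret Metric_space "carrier A" "cstar_dist A" by (rule Metric_space_cstar_dist)
  show ?thesis
    using assms limitin_iff_converges
    unfolding metric_closedin_iff_sequentially_closed seq_closed_def
    by (metis subset_trans)
qed

definition norm_closure :: "'a set \<Rightarrow> 'a set" where
  "norm_closure S = {x \<in> carrier A. \<forall>e>0. \<exists>y\<in>S. cnrm A (x \<ominus> y) < e}"

lemma seq_closed_norm_closure:
  assumes "S \<subseteq> carrier A"
  shows "seq_closed (norm_closure S)"
  unfolding seq_closed_def
proof (intro allI impI, elim conjE)
  fix f x
  assume f: "range f \<subseteq> norm_closure S" and x: "converges f x"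
  note c = converges_carrier[OF x]
  have "\<exists>y\<in>S. cnrm A (x \<ominus> y) < e" if "e > 0" for e
  proof -
    obtain n where "cnrm A (f n \<ominus> x) < e/2"
      using x \<open>e > 0\<close> order_tendstoD(2)[of "\<lambda>n. cnrm A (f n \<ominus> x)" 0 sequentially "e/2"]
      unfolding converges_def eventually_sequentially by auto
    moreover obtain y where y: "y \<in> S" "cnrm A (f n \<ominus> y) < e/2"
      using f \<open>e > 0\<close> unfolding norm_closure_def by (force dest!: spec[of _ "e/2"])
    ultimately have "cnrm A (x \<ominus> y) < e"
      using cnrm_diff_triangle[of x "f n" y] cnrm_diff_commute[of x "f n"] c assms by auto
    with y show ?thesis by auto
  qed
  then show "x \<in> norm_closure S"
    using c by (simp add: norm_closure_def)
qed

lemma norm_closure_seq: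
  assumes "S \<subseteq> carrier A" "x \<in> norm_closure S"
  obtains f where "\<And>n. f n \<in> S" "converges f x"
proof -
  have "\<forall>n. \<exists>y\<in>S. cnrm A (x \<ominus> y) < inverse (real (Suc n))"
    using assms(2) unfolding norm_closure_def by simp
  then obtain f where f: "\<And>n. f n \<in> S" "\<And>n. cnrm A (x \<ominus> f n) < inverse (real (Suc n))"
    by metis
  have c: "x \<in> carrier A" "f n \<in> carrier A" for n
    using assms f by (auto simp: norm_closure_def)
  have "converges f x"
    by (rule convergesI[where g = "\<lambda>n. inverse (real (Suc n))"])
      (use c f(2) LIMSEQ_inverse_real_of_nat in \<open>auto simp: less_imp_le cnrm_diff_commute\<close>)
  with f(1) show ?thesis by (rule that)
qed

lemma norm_closure_subset: "norm_closure S \<subseteq> carrier A"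
  by (auto simp: norm_closure_def)

lemma norm_closure_superset: "S \<subseteq> carrier A \<Longrightarrow> S \<subseteq> norm_closure S"
proof
  fix x assume "S \<subseteq> carrier A" "x \<in> S"
  then show "x \<in> norm_closure S"
    unfolding norm_closure_def by (auto intro!: bexI[of _ x] simp: minus_eq r_neg subsetD)
qed

lemma converges_in_norm_closure:
  assumes "converges f x" "\<And>n. f n \<in> S" "S \<subseteq> carrier A"
  shows "x \<in> norm_closure S"
  using seq_closedD[OF seq_closed_norm_closure[OF assms(3)] _ assms(1)] assms(2)
    norm_closure_superset[OF assms(3)] by auto

section \<open>Square roots without spectral theory\<close>

lemma add_diff_add_left:
  "a \<in> carrier A \<Longrightarrow> x \<in> carrier A \<Longrightarrow> y \<in> carrier A \<Longrightarrow> (a \<oplus> x) \<ominus> (a \<oplus> y) = x \<ominus> y"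
  by (simp add: minus_eq minus_add a_comm[of a x] a_assoc r_neg2)

text \<open>Banach's fixed point theorem on a sequentially closed part of the carrier: the iterates
  of \<open>x0\<close> form a Cauchy sequence and their limit is fixed. It serves both the Neumann
  series and the square root.\<close>

lemma contraction_fixpoint:
  assumes S: "S \<subseteq> carrier A" "seq_closed S" "x0 \<in> S" and F: "\<And>x. x \<in> S \<Longrightarrow> F x \<in> S"
    and r: "r < 1"
    and contr: "\<And>x y. x \<in> S \<Longrightarrow> y \<in> S \<Longrightarrow> cnrm A (F x \<ominus> F y) \<le> r * cnrm A (x \<ominus> y)"
  obtains x where "x \<in> S" "F x = x"
proof -
  define f where "f n = (F ^^ n) x0" for n
  \<comment> \<open>The ratio \<open>r\<close> may be negative; since its powers serve as bounds, it
    is replaced by a nonnegative one.\<close>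
  define q where "q = max r 0"
  have q: "0 \<le> q" "q < 1" using r by (auto simp: q_def)
  have fS: "f n \<in> S" for n
    by (induction n) (auto simp: f_def S F)
  then have fc: "f n \<in> carrier A" for n using S by auto
  have contr': "cnrm A (F x \<ominus> F y) \<le> q * cnrm A (x \<ominus> y)" if "x \<in> S" "y \<in> S" for x y
  proof -
    have "r * cnrm A (x \<ominus> y) \<le> q * cnrm A (x \<ominus> y)"
      using that S by (intro mult_right_mono cnrm_nonneg) (auto simp: q_def)
    with contr[OF that] show ?thesis by linarith
  qed
  define C where "C = cnrm A (f 1 \<ominus> f 0)"
  have "C \<ge> 0" using fc by (simp add: C_def cnrm_nonneg)
  have step: "cnrm A (f (Suc n) \<ominus> f n) \<le> q ^ n * C" for n
  proof (induction n)
    case (Suc n)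
    have "cnrm A (f (Suc (Suc n)) \<ominus> f (Suc n)) \<le> q * cnrm A (f (Suc n) \<ominus> f n)"
      using contr'[OF fS fS, of "Suc n" n] by (simp add: f_def)
    also have "\<dots> \<le> q * (q ^ n * C)" using Suc q by (intro mult_left_mono) auto
    finally show ?case by (simp add: mult_ac)
  qed (simp add: C_def)
  \<comment> \<open>The quotient is the geometric sum q^n + ... + q^(n+k-1) in closed form, so the
    induction step adds exactly one term.\<close>
  have tail: "cnrm A (f (n + k) \<ominus> f n) \<le> (q ^ n - q ^ (n + k)) / (1 - q) * C" for n k
  proof (induction k)
    case 0
    then show ?case using fc by (simp add: minus_eq r_neg)
  next
    case (Suc k)
    have "cnrm A (f (n + Suc k) \<ominus> f n) \<le> q ^ (n + k) * C + (q ^ n - q ^ (n + k)) / (1 - q) * C"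
      using cnrm_diff_triangle[OF fc[of "n + Suc k"] fc[of "n + k"] fc[of n]] Suc step[of "n + k"] by simp
    also have "\<dots> = (q ^ n - q ^ (n + Suc k)) / (1 - q) * C"
      using q by (simp add: field_simps)
    finally show ?case .
  qed
  have bound: "cnrm A (f m \<ominus> f n) \<le> q ^ N / (1 - q) * C" if "N \<le> n" "n \<le> m" for m n N
  proof -
    have "q ^ n - q ^ m \<le> q ^ N" using that q power_decreasing[of N n q] zero_le_power[of q m] by linarith
    then have "(q ^ n - q ^ m) / (1 - q) * C \<le> q ^ N / (1 - q) * C"
      using q \<open>C \<ge> 0\<close> by (intro mult_right_mono divide_right_mono) auto
    with tail[of n "m - n"] that show ?thesis by simp
  qed
  have "\<exists>N. \<forall>m\<ge>N. \<forall>n\<ge>N. cnrm A (f m \<ominus> f n) < e" if "e > 0" for e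
  proof -
    have "(\<lambda>N. q ^ N / (1 - q) * C) \<longlonglongrightarrow> 0 / (1 - q) * C"
      using q by (intro tendsto_intros LIMSEQ_power_zero) auto
    then obtain N where N: "q ^ N / (1 - q) * C < e"
      using \<open>e > 0\<close> order_tendstoD(2)[of _ 0 sequentially e]
      by (metis (no_types, lifting) div_0 eventually_sequentially le_refl mult_zero_left)
    have "cnrm A (f m \<ominus> f n) < e" if "N \<le> m" "N \<le> n" for m n
      using bound[of N n m] bound[of N m n] N that cnrm_diff_commute[OF fc fc, of m n]
      by (cases "n \<le> m") auto
    then show ?thesis by auto
  qed
  then obtain x where x: "converges f x"
    using Cauchy_converges[of f] fc by (metis image_subsetI)
  have xS: "x \<in> S" using S(2) fS x by (rule seq_closedD)
  have xc: "x \<in> carrier A" "F x \<in> carrier A" using xS F S by auto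
  have "converges (\<lambda>n. f (Suc n)) (F x)"
  proof (rule convergesI[OF xc(2)])
    show "cnrm A (f (Suc n) \<ominus> F x) \<le> q * cnrm A (f n \<ominus> x)" for n
      using contr'[OF fS xS, of n] by (simp add: f_def)
    show "(\<lambda>n. q * cnrm A (f n \<ominus> x)) \<longlonglongrightarrow> 0"
      using x by (intro tendsto_mult_right_zero) (simp add: converges_def)
  qed (rule fc)
  moreover have "converges (\<lambda>n. f (Suc n)) x"
    using x LIMSEQ_Suc by (fastforce simp: converges_def)
  ultimately have "F x = x" by (rule converges_unique)
  with xS show ?thesis by (rule that)
qed

text \<open>The inverse is the fixed point of t -> 1 + (1 - u) t, that is, the limit of the Neumann
  series.\<close>

lemma Neumann_inverse:
  assumes "u \<in> carrier A" "cnrm A (\<one> \<ominus> u) < 1"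
  obtains t where "t \<in> carrier A" "u \<otimes> t = \<one>"
proof -
  define x where "x = \<one> \<ominus> u"
  have x: "x \<in> carrier A" "cnrm A x < 1" using assms by (auto simp: x_def)
  obtain t where t: "t \<in> carrier A" "\<one> \<oplus> x \<otimes> t = t"
  proof (rule contraction_fixpoint[of "carrier A" \<zero> "\<lambda>t. \<one> \<oplus> x \<otimes> t" "cnrm A x"])
    show "seq_closed (carrier A)"
      by (auto simp: seq_closed_def converges_def)
    fix s t assume st: "s \<in> carrier A" "t \<in> carrier A"
    have "\<one> \<oplus> x \<otimes> s \<ominus> (\<one> \<oplus> x \<otimes> t) = x \<otimes> (s \<ominus> t)"
      using st x by (simp add: add_diff_add_left) (simp add: minus_eq r_distr r_minus)
    then show "cnrm A (\<one> \<oplus> x \<otimes> s \<ominus> (\<one> \<oplus> x \<otimes> t)) \<le> cnrm A x * cnrm A (s \<ominus> t)"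
      using st x by (simp add: cnrm_mult)
  qed (use x in auto)
  have "u = \<one> \<ominus> x"
    using assms by (simp add: x_def minus_eq minus_add r_neg2)
  then have "u \<otimes> t = t \<ominus> x \<otimes> t"
    using t x by (simp add: minus_eq l_distr l_minus)
  also have "\<dots> = (\<one> \<oplus> x \<otimes> t) \<ominus> x \<otimes> t" using t by simp
  also have "\<dots> = \<one>" using t(1) x by (simp add: minus_eq a_assoc r_neg)
  finally show ?thesis using t that by blast
qed

text \<open>Writing \<open>y = 1 - z\<close>, the equation \<open>y\<^sup>2 = 1 - a\<close> becomes \<open>z = (a + z\<^sup>2) / 2\<close>, whose right-hand
  side contracts the ball of radius \<open>\<parallel>a\<parallel>\<close>.\<close>

lemma square_root_one_minus:
  assumes a: "a \<in> carrier A" "adj A a = a" "cnrm A a < 1"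
  obtains y where "y \<in> carrier A" "adj A y = y" "y \<otimes> y = \<one> \<ominus> a"
proof -
  define r where "r = cnrm A a"
  have r: "0 \<le> r" "r < 1" using a by (auto simp: r_def cnrm_nonneg)
  \<comment> \<open>Self-adjointness is built into the set, so the fixed point inherits it.\<close>
  define S where "S = {z \<in> carrier A. adj A z = z \<and> cnrm A z \<le> r}"
  define F where "F z = (1 / 2) \<odot> (a \<oplus> z \<otimes> z)" for z
  have "seq_closed S"
    unfolding seq_closed_def
  proof (intro allI impI, elim conjE)
    fix f x assume f: "range f \<subseteq> S" and x: "converges f x"
    note c = converges_carrier[OF x]
    have fS: "adj A (f n) = f n" "cnrm A (f n) \<le> r" for n using f by (auto simp: S_def)
    have "adj A x = x"
      using converges_unique[OF converges_adj[OF x]] x fS by simp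
    moreover have "cnrm A x \<le> r + cnrm A (f n \<ominus> x)" for n
      using cnrm_le_add_diff[of x "f n"] fS(2)[of n] cnrm_diff_commute[of x "f n"] c by simp
    moreover have "(\<lambda>n. r + cnrm A (f n \<ominus> x)) \<longlonglongrightarrow> r + 0"
      using x by (intro tendsto_intros) (simp add: converges_def)
    ultimately show "x \<in> S"
      using c Lim_bounded2[of "\<lambda>n. r + cnrm A (f n \<ominus> x)" "r + 0" 0 "cnrm A x"] by (simp add: S_def)
  qed
  then obtain z where z: "z \<in> S" "F z = z"
  proof (rule contraction_fixpoint[of S \<zero> F r, rotated])
    fix z assume z: "z \<in> S"
    then have zc: "z \<in> carrier A" "adj A z = z" "cnrm A z \<le> r" by (auto simp: S_def)
    \<comment> \<open>The ball is invariant because (r + r^2) / 2 \<le> r for r \<le> 1.\<close>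
    have "cnrm A (a \<oplus> z \<otimes> z) \<le> r + r * r"
      using cnrm_triangle[of a "z \<otimes> z"] cnrm_mult[of z z] mult_mono[of "cnrm A z" r "cnrm A z" r] zc a r
      by (simp add: r_def cnrm_nonneg)
    also have "\<dots> \<le> 2 * r" using r mult_left_mono[of r 1 r] by simp
    finally show "F z \<in> S"
      using zc a by (simp add: S_def F_def adj_smult adj_add adj_mult cnrm_smult)
  next
    fix z w assume "z \<in> S" "w \<in> S"
    then have c: "z \<in> carrier A" "w \<in> carrier A" "cnrm A z \<le> r" "cnrm A w \<le> r" by (auto simp: S_def)
    have "F z \<ominus> F w = (1 / 2) \<odot> (z \<otimes> z \<ominus> w \<otimes> w)"
      using c a by (simp add: F_def flip: scalar_diff) (simp add: add_diff_add_left)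
    moreover have "cnrm A (z \<otimes> z \<ominus> w \<otimes> w) \<le> r * cnrm A (z \<ominus> w) + cnrm A (z \<ominus> w) * r"
    proof -
      have "cnrm A z * cnrm A (z \<ominus> w) \<le> r * cnrm A (z \<ominus> w)"
        "cnrm A (z \<ominus> w) * cnrm A w \<le> cnrm A (z \<ominus> w) * r"
        using c by (auto intro!: mult_right_mono mult_left_mono simp: cnrm_nonneg)
      with cnrm_mult_diff[of z z w w] c show ?thesis by linarith
    qed
    ultimately show "cnrm A (F z \<ominus> F w) \<le> r * cnrm A (z \<ominus> w)"
      using c by (simp add: cnrm_smult)
  qed (use r in \<open>auto simp: S_def\<close>)
  have zc: "z \<in> carrier A" "adj A z = z" using z by (auto simp: S_def)
  have zz: "z \<oplus> z = a \<oplus> z \<otimes> z"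
  proof -
    have "z \<oplus> z = 2 \<odot> z" using scalar_add[of z 1 1] zc by simp
    also have "\<dots> = 2 \<odot> F z" using z by simp
    also have "\<dots> = a \<oplus> z \<otimes> z" using zc a by (simp add: F_def scalar_mult)
    finally show ?thesis .
  qed
  show ?thesis
  proof
    show "\<one> \<ominus> z \<in> carrier A" using zc by auto
    show "adj A (\<one> \<ominus> z) = \<one> \<ominus> z" using zc by (simp add: adj_diff)
    have "(\<one> \<ominus> z) \<otimes> (\<one> \<ominus> z) = \<one> \<oplus> (\<ominus> (z \<oplus> z) \<oplus> z \<otimes> z)"
      using zc by (simp add: minus_eq l_distr r_distr l_minus r_minus minus_add a_ac)
    also have "\<dots> = \<one> \<ominus> a"
      using zc a unfolding zz by (simp add: minus_eq minus_add a_assoc l_neg)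
    finally show "(\<one> \<ominus> z) \<otimes> (\<one> \<ominus> z) = \<one> \<ominus> a" .
  qed
qed

text \<open>For x = q + i p, commutation gives
  \<open>adj A x \<otimes> x = p \<otimes> p \<oplus> q \<otimes> q\<close>, and 2 i p is the
  difference of x and its adjoint, so the norm of \<open>p\<close> is at most that of x.\<close>

lemma cnrm_le_sum_commuting_squares:
  assumes p: "p \<in> carrier A" "adj A p = p" and q: "q \<in> carrier A" "adj A q = q"
    and comm: "p \<otimes> q = q \<otimes> p"
  shows "(cnrm A p)\<^sup>2 \<le> cnrm A (p \<otimes> p \<oplus> q \<otimes> q)"
proof -
  define x where "x = q \<oplus> \<i> \<odot> p"
  have xc: "x \<in> carrier A" using p q by (simp add: x_def)
  have ax: "adj A x = q \<oplus> (- \<i>) \<odot> p"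
    using p q by (simp add: x_def adj_add adj_smult)
  have "adj A x \<otimes> x = q \<otimes> q \<oplus> (\<i> \<odot> (q \<otimes> p) \<oplus> ((- \<i>) \<odot> (q \<otimes> p) \<oplus> p \<otimes> p))"
    using p q comm unfolding ax
    by (simp add: x_def l_distr r_distr smult_mult_left smult_mult_right scalar_mult a_assoc scalar_distrib)
      (simp add: scalar_minus r_neg1 r_neg2)
  also have "\<dots> = p \<otimes> p \<oplus> q \<otimes> q"
    using p q by (simp add: scalar_minus r_neg2 a_comm[of "q \<otimes> q" "p \<otimes> p"])
  finally have 1: "adj A x \<otimes> x = p \<otimes> p \<oplus> q \<otimes> q" .
  have "x \<ominus> adj A x = (2 * \<i>) \<odot> p"
  proof -
    have "x \<ominus> adj A x = \<i> \<odot> p \<ominus> (- \<i>) \<odot> p"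
      unfolding ax using p q by (simp add: x_def add_diff_add_left)
    also have "\<dots> = (2 * \<i>) \<odot> p" using scalar_left_diff[of p \<i> "- \<i>"] p by simp
    finally show ?thesis .
  qed
  then have "2 * cnrm A p \<le> 2 * cnrm A x"
    using cnrm_diff_le[of x "adj A x"] xc p by (simp add: cnrm_smult norm_mult)
  then have "(cnrm A p)\<^sup>2 \<le> (cnrm A x)\<^sup>2"
    using p by (intro power_mono) (auto simp: cnrm_nonneg)
  also have "\<dots> = cnrm A (p \<otimes> p \<oplus> q \<otimes> q)"
    using cstar_identity[OF xc] 1 by simp
  finally show ?thesis .
qed

text \<open>Two isometries with orthogonal ranges realize \<open>x\<^sup>*x + y\<^sup>*y\<close> as \<open>W\<^sup>*W\<close>, which replaces the
  general theory of positive elements.\<close>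

lemma cnrm_le_one_of_sum_one:
  assumes v: "v \<in> carrier A" "adj A v \<otimes> v = \<one>" and w: "w \<in> carrier A" "adj A w \<otimes> w = \<one>"
    and vw: "adj A v \<otimes> w = \<zero>"
    and x: "x \<in> carrier A" and y: "y \<in> carrier A" and sum: "adj A x \<otimes> x \<oplus> adj A y \<otimes> y = \<one>"
  shows "cnrm A x \<le> 1"
proof -
  define W where "W = v \<otimes> x \<oplus> w \<otimes> y"
  have Wc: "W \<in> carrier A" using assms by (simp add: W_def)
  have wv: "adj A w \<otimes> v = \<zero>"
    using adj_mult[of "adj A v" w] v w vw by simp
  have vW: "adj A v \<otimes> W = x"
    using assms by (simp add: W_def r_distr flip: m_assoc)
  have wW: "adj A w \<otimes> W = y"
    using assms wv by (simp add: W_def r_distr flip: m_assoc)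
  have "adj A W \<otimes> W = adj A x \<otimes> (adj A v \<otimes> W) \<oplus> adj A y \<otimes> (adj A w \<otimes> W)"
    using assms Wc by (subst W_def) (simp add: adj_add adj_mult l_distr m_assoc)
  then have "adj A W \<otimes> W = \<one>" using sum vW wW by simp
  then have W1: "cnrm A W \<le> 1" using Wc by (intro cnrm_isometry_le)
  have "cnrm A x \<le> cnrm A (adj A v) * cnrm A W"
    using cnrm_mult[of "adj A v" W] vW v Wc by simp
  also have "\<dots> \<le> 1 * 1"
    using W1 cnrm_isometry_le[OF v] v Wc by (intro mult_mono) (auto simp: cnrm_nonneg)
  finally show ?thesis by simp
qed

text \<open>The element is the square of a self-adjoint y, and
  \<open>adj A y \<otimes> y \<oplus> adj A x \<otimes> x = \<one>\<close> bounds the norm of y by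
  1. Positivity of the mean rests on this estimate.\<close>

lemma cnrm_one_minus_adj_mult_le:
  assumes v: "v \<in> carrier A" "adj A v \<otimes> v = \<one>" and w: "w \<in> carrier A" "adj A w \<otimes> w = \<one>"
    and vw: "adj A v \<otimes> w = \<zero>"
    and x: "x \<in> carrier A" "cnrm A x < 1"
  shows "cnrm A (\<one> \<ominus> adj A x \<otimes> x) \<le> 1"
proof -
  have "cnrm A (adj A x \<otimes> x) < 1"
    using x by (simp add: cstar_identity power_less_one_iff cnrm_nonneg)
  moreover have "adj A (adj A x \<otimes> x) = adj A x \<otimes> x" using x by (simp add: adj_mult)
  ultimately obtain y where y: "y \<in> carrier A" "adj A y = y" "y \<otimes> y = \<one> \<ominus> adj A x \<otimes> x"
    using x square_root_one_minus[of "adj A x \<otimes> x"] by auto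
  have "adj A y \<otimes> y \<oplus> adj A x \<otimes> x = \<one>"
    using y x by (simp add: minus_eq a_assoc l_neg)
  then have "cnrm A y \<le> 1"
    using y x by (intro cnrm_le_one_of_sum_one[OF v w vw, of y x]) auto
  then have "cnrm A (y \<otimes> y) \<le> 1"
    using cstar_identity[of y] y by (simp add: power_le_one cnrm_nonneg)
  then show ?thesis using y by simp
qed

section \<open>Unital C*-subalgebras as restrictions of the carrier\<close>

definition star_subalgebra :: "'a set \<Rightarrow> bool" where
  "star_subalgebra S \<longleftrightarrow> S \<subseteq> carrier A \<and> \<one> \<in> S \<and>
     (\<forall>x\<in>S. \<forall>y\<in>S. x \<oplus> y \<in> S \<and> x \<otimes> y \<in> S) \<and> (\<forall>c. \<forall>x\<in>S. c \<odot> x \<in> S) \<and> (\<forall>x\<in>S. adj A x \<in> S)"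

lemma star_subalgebraD:
  assumes "star_subalgebra S"
  shows "S \<subseteq> carrier A" "\<one> \<in> S" "\<zero> \<in> S"
    and "\<And>x y. x \<in> S \<Longrightarrow> y \<in> S \<Longrightarrow> x \<oplus> y \<in> S" "\<And>x y. x \<in> S \<Longrightarrow> y \<in> S \<Longrightarrow> x \<otimes> y \<in> S"
    and "\<And>c x. x \<in> S \<Longrightarrow> c \<odot> x \<in> S" "\<And>x. x \<in> S \<Longrightarrow> adj A x \<in> S"
    and "\<And>x. x \<in> S \<Longrightarrow> \<ominus> x \<in> S" "\<And>x y. x \<in> S \<Longrightarrow> y \<in> S \<Longrightarrow> x \<ominus> y \<in> S"
proof -
  show sub: "S \<subseteq> carrier A" and one: "\<one> \<in> S"
    and add: "\<And>x y. x \<in> S \<Longrightarrow> y \<in> S \<Longrightarrow> x \<oplus> y \<in> S" and "\<And>x y. x \<in> S \<Longrightarrow> y \<in> S \<Longrightarrow> x \<otimes> y \<in> S"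
    and sc: "\<And>c x. x \<in> S \<Longrightarrow> c \<odot> x \<in> S" and "\<And>x. x \<in> S \<Longrightarrow> adj A x \<in> S"
    using assms by (auto simp: star_subalgebra_def)
  show "\<zero> \<in> S" using sc[OF one, of 0] by simp
  show neg: "\<ominus> x \<in> S" if "x \<in> S" for x
    using sc[OF that, of "- 1"] sub that by (simp add: minus_eq_scalar subsetD)
  show "x \<ominus> y \<in> S" if "x \<in> S" "y \<in> S" for x y
    using that add neg by (simp add: minus_eq)
qed

text \<open>Sum, product and zero are shared record fields, but additive inverses are defined
  through the carrier, so subtraction in the restricted record has to be compared with that of
  \<open>A\<close>.\<close>

lemma diff_restrict_carrier:
  assumes "ring (A\<lparr>carrier := S\<rparr>)" "S \<subseteq> carrier A" "x \<in> S" "y \<in> S" "\<ominus> y \<in> S"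
  shows "x \<ominus>\<^bsub>A\<lparr>carrier := S\<rparr>\<^esub> y = x \<ominus> y"
proof -
  interpret S: ring "A\<lparr>carrier := S\<rparr>" by fact
  have "\<ominus>\<^bsub>A\<lparr>carrier := S\<rparr>\<^esub> y = \<ominus> y"
    using assms by (intro S.minus_equality) (auto simp: l_neg)
  then show ?thesis by (simp add: S.minus_eq minus_eq)
qed

lemma ring_star_subalgebra:
  assumes "star_subalgebra S"
  shows "ring (A\<lparr>carrier := S\<rparr>)"
proof -
  note D = star_subalgebraD[OF assms]
  have c: "x \<in> carrier A" if "x \<in> S" for x using that D(1) by auto
  show ?thesis
  proof (intro ringI abelian_groupI monoidI)
    fix x assume "x \<in> carrier (A\<lparr>carrier := S\<rparr>)"
    then show "\<exists>y\<in>carrier (A\<lparr>carrier := S\<rparr>). y \<oplus>\<^bsub>A\<lparr>carrier := S\<rparr>\<^esub> x = \<zero>\<^bsub>A\<lparr>carrier := S\<rparr>\<^esub>"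
      using D(8) by (auto intro!: bexI[of _ "\<ominus> x"] simp: c l_neg)
  qed (simp_all add: D c a_ac m_assoc l_distr r_distr)
qed

text \<open>Operations and norm are inherited, which leaves completeness: a Cauchy sequence in
  \<open>S\<close> converges in \<open>A\<close>, and its limit lies in \<open>S\<close>. Applied to
  the center, to the closed span of the monomials and to the fixed point algebra.\<close>

lemma cstar_algebra_star_subalgebra:
  assumes S: "star_subalgebra S" and closed: "seq_closed S"
  shows "cstar_algebra (A\<lparr>carrier := S\<rparr>)"
proof -
  let ?B = "A\<lparr>carrier := S\<rparr>"
  note D = star_subalgebraD[OF S]
  have c: "x \<in> carrier A" if "x \<in> S" for x using that D(1) by auto
  interpret B: ring ?B using S by (rule ring_star_subalgebra)
  have mod: "Module.module complex_field ?B"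
    by (rule moduleI[OF C.is_cring B.abelian_group_axioms])
      (simp_all add: complex_field_def D c scalar_add scalar_distrib scalar_mult)
  have diff: "x \<ominus>\<^bsub>?B\<^esub> y = x \<ominus> y" if "x \<in> S" "y \<in> S" for x y
    using that by (intro diff_restrict_carrier B.ring_axioms D)
  have dist: "cstar_dist ?B x y = cnrm A (x \<ominus> y)" if "x \<in> S" "y \<in> S" for x y
    using that diff by (simp add: cstar_dist_def)
  have MS: "Metric_space S (cstar_dist ?B)"
  proof
    fix x y z
    show "0 \<le> cstar_dist ?B x y" "cstar_dist ?B x y = cstar_dist ?B y x"
      by (auto simp: cstar_dist_def c cnrm_nonneg diff intro!: cnrm_diff_commute)
    assume "x \<in> S" "y \<in> S"
    then show "(cstar_dist ?B x y = 0) = (x = y)"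
      by (simp add: dist c cnrm_eq_0 diff_eq_zero_iff)
    assume "z \<in> S"
    with \<open>x \<in> S\<close> \<open>y \<in> S\<close> show "cstar_dist ?B x z \<le> cstar_dist ?B x y + cstar_dist ?B y z"
      by (simp add: dist c cnrm_diff_triangle)
  qed
  interpret M: Metric_space S "cstar_dist ?B" by (rule MS)
  have "M.mcomplete"
    unfolding M.mcomplete_def
  proof (intro allI impI)
    fix f assume f: "M.MCauchy f"
    then have fS: "f n \<in> S" for n by (auto simp: M.MCauchy_def)
    have "\<exists>N. \<forall>m\<ge>N. \<forall>n\<ge>N. cnrm A (f m \<ominus> f n) < e" if "e > 0" for e
      using f that fS by (simp add: M.MCauchy_def dist)
    then obtain x where x: "converges f x"
      using Cauchy_converges[of f] fS c by (metis image_subsetI)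
    have xS: "x \<in> S" using closed fS x by (rule seq_closedD)
    have "limitin M.mtopology f x sequentially"
      unfolding M.limit_metric_sequentially
      using x xS fS by (auto simp: dist converges_def LIMSEQ_def c cnrm_nonneg)
    then show "\<exists>x. limitin M.mtopology f x sequentially" by blast
  qed
  then have "cstar_algebra_axioms ?B"
    by (simp add: cstar_algebra_axioms_def D c smult_mult_left smult_mult_right adj_add adj_smult
        adj_mult cnrm_nonneg cnrm_eq_0 cnrm_smult cnrm_triangle cnrm_mult cstar_identity)
  then show ?thesis
    using mod B.ring_axioms by (simp add: cstar_algebra_def)
qed

text \<open>If \<open>w\<close> inverts \<open>1 - c\<^sup>2\<close>, then \<open>(1 - r c\<^sup>2) (1 - w / K)\<close> is a square for \<open>r < 1\<close> and
  \<open>K > \<parallel>w\<parallel>\<close>. Adding \<open>r c\<^sup>2\<close> to it yields an element of norm less than \<open>r\<close> once \<open>r\<close> is close to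
  \<open>1\<close>, although the sum of commuting squares dominates \<open>r c\<^sup>2\<close>.\<close>

lemma not_invertible_one_minus_square:
  assumes comm: "\<And>x y. x \<in> carrier A \<Longrightarrow> y \<in> carrier A \<Longrightarrow> x \<otimes> y = y \<otimes> x"
    and c: "c \<in> carrier A" "adj A c = c" "cnrm A c = 1"
    and w: "w \<in> carrier A" "w \<otimes> (\<one> \<ominus> c \<otimes> c) = \<one>"
  shows False
proof -
  \<comment> \<open>Brings \<open>w / K\<close> below norm 1, so that 1 - w / K has a square
    root.\<close>
  define K where "K = cnrm A w + 1"
  have K: "K \<ge> 1" "cnrm A w < K" using w by (auto simp: K_def cnrm_nonneg)
  \<comment> \<open>With this value the final estimate r / K \<le> 2 (1 - r) reads r / K \<le> 1 /
    (2 K), that is r \<le> 1/2, whereas K \<ge> 1 gives r \<ge> 3/4.\<close>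
  define r where "r = 1 - 1 / (4 * K)"
  have r: "0 < r" "r < 1" using K by (auto simp: r_def field_simps)
  define e where "e = \<one> \<ominus> c \<otimes> c"
  have e: "e \<in> carrier A" "adj A e = e" using c by (auto simp: e_def adj_diff adj_mult)
  have aw: "adj A w = w"
  proof -
    have "adj A w \<otimes> e = \<one>"
      using w e adj_mult[of w e] comm[of "adj A w" e] by (simp add: e_def)
    then have "adj A w = adj A w \<otimes> (e \<otimes> w)"
      using w e comm[of w e] by (simp add: e_def)
    also have "\<dots> = w"
      using w e \<open>adj A w \<otimes> e = \<one>\<close> by (simp flip: m_assoc)
    finally show ?thesis .
  qed
  \<comment> \<open>This identity removes \<open>c\<close> from the sum of squares below, leaving a
    combination of \<open>\<one>\<close> and \<open>w\<close>.\<close>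
  have ccw: "c \<otimes> c \<otimes> w = w \<ominus> \<one>"
  proof -
    have "w \<ominus> w \<otimes> (c \<otimes> c) = \<one>" using w c by (simp add: minus_eq r_distr r_minus)
    then have "w \<ominus> \<one> = w \<ominus> (w \<ominus> w \<otimes> (c \<otimes> c))" by simp
    also have "\<dots> = w \<otimes> (c \<otimes> c)" using w c by (simp add: minus_eq minus_add r_neg2)
    finally show ?thesis using w c comm[of w "c \<otimes> c"] by simp
  qed
  obtain y where y: "y \<in> carrier A" "adj A y = y" "y \<otimes> y = \<one> \<ominus> complex_of_real r \<odot> (c \<otimes> c)"
    using c r square_root_one_minus[of "complex_of_real r \<odot> (c \<otimes> c)"]
    by (auto simp: adj_smult adj_mult cnrm_smult cnrm_square_selfadjoint)
  obtain v where v: "v \<in> carrier A" "adj A v = v" "v \<otimes> v = \<one> \<ominus> complex_of_real (1 / K) \<odot> w"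
    using w K aw square_root_one_minus[of "complex_of_real (1 / K) \<odot> w"]
    by (auto simp: adj_smult cnrm_smult norm_divide)
  define p where "p = y \<otimes> v"
  have p: "p \<in> carrier A" "adj A p = p"
    using y v comm[of y v] by (auto simp: p_def adj_mult)
  define q where "q = complex_of_real (sqrt r) \<odot> c"
  have q: "q \<in> carrier A" "adj A q = q" "cnrm A q = sqrt r" "q \<otimes> q = complex_of_real r \<odot> (c \<otimes> c)"
    using c r by (auto simp: q_def adj_smult cnrm_smult smult_mult_left smult_mult_right scalar_mult
        simp flip: of_real_mult)
  have "p \<otimes> p = y \<otimes> (v \<otimes> y) \<otimes> v"
    using y(1) v(1) by (simp add: p_def m_assoc)
  also have "\<dots> = (y \<otimes> y) \<otimes> (v \<otimes> v)"
    using y(1) v(1) by (simp add: comm[of v y] m_assoc)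
  also have "\<dots> = (\<one> \<ominus> complex_of_real (1 / K) \<odot> w) \<ominus>
      complex_of_real r \<odot> (c \<otimes> c \<ominus> complex_of_real (1 / K) \<odot> (c \<otimes> c \<otimes> w))"
    using c w unfolding y(3) v(3)
    by (simp add: minus_eq l_distr r_distr l_minus r_minus smult_mult_left smult_mult_right
        scalar_distrib scalar_minus_right minus_add a_assoc)
      (simp add: scalar_mult mult.commute a_lcomm)
  finally have pp: "p \<otimes> p = (\<one> \<ominus> complex_of_real (1 / K) \<odot> w) \<ominus>
      complex_of_real r \<odot> (c \<otimes> c \<ominus> complex_of_real (1 / K) \<odot> (c \<otimes> c \<otimes> w))" .
  have "p \<otimes> p \<oplus> q \<otimes> q = (\<one> \<ominus> complex_of_real (1 / K) \<odot> w) \<oplus>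
      complex_of_real r \<odot> (complex_of_real (1 / K) \<odot> (w \<ominus> \<one>))"
  proof -
    have "X \<ominus> (Y \<ominus> Z) \<oplus> Y = X \<oplus> Z" if "X \<in> carrier A" "Y \<in> carrier A" "Z \<in> carrier A" for X Y Z
      using that by (simp add: minus_eq minus_add a_assoc a_comm[of Z Y] r_neg1)
    then show ?thesis
      using c w unfolding q(4) pp ccw by (simp add: scalar_diff)
  qed
  also have "\<dots> = complex_of_real (1 - r / K) \<odot> \<one> \<ominus> complex_of_real ((1 - r) / K) \<odot> w"
  proof -
    have "complex_of_real (1 - r / K) \<odot> \<one> = \<one> \<oplus> complex_of_real (- r / K) \<odot> \<one>"
      using scalar_add[of \<one> 1 "complex_of_real (- r / K)"] by simp
    moreover have "complex_of_real ((1 - r) / K) \<odot> w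
        = complex_of_real (1 / K) \<odot> w \<oplus> complex_of_real (- r / K) \<odot> w"
      using scalar_add[of w "complex_of_real (1 / K)" "complex_of_real (- r / K)"] w
      by (simp add: diff_divide_distrib)
    ultimately show ?thesis
      using w by (simp add: minus_eq scalar_distrib scalar_minus_right scalar_mult scalar_minus minus_add a_ac)
  qed
  finally have sum: "p \<otimes> p \<oplus> q \<otimes> q
      = complex_of_real (1 - r / K) \<odot> \<one> \<ominus> complex_of_real ((1 - r) / K) \<odot> w" .
  have "r = (cnrm A q)\<^sup>2" using q r by simp
  also have "\<dots> \<le> cnrm A (p \<otimes> p \<oplus> q \<otimes> q)"
    using cnrm_le_sum_commuting_squares[OF q(1,2) p comm[OF q(1) p(1)]] a_comm[of "p \<otimes> p" "q \<otimes> q"] p q(1)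
    by simp
  also have "\<dots> \<le> \<bar>1 - r / K\<bar> * cnrm A \<one> + (1 - r) / K * cnrm A w"
    unfolding sum using w r K
      cnrm_diff_le[of "complex_of_real (1 - r / K) \<odot> \<one>" "complex_of_real ((1 - r) / K) \<odot> w"]
    by (simp add: cnrm_smult del: of_real_diff of_real_divide)
  also have "\<dots> \<le> (1 - r / K) * 1 + (1 - r) * 1"
  proof (intro add_mono)
    have "r / K \<le> 1" using r K by simp
    then show "\<bar>1 - r / K\<bar> * cnrm A \<one> \<le> (1 - r / K) * 1"
      using cnrm_one_le by (simp add: mult_left_le)
    have "(1 - r) * (cnrm A w / K) \<le> (1 - r) * 1"
      using r K by (intro mult_left_mono) auto
    then show "(1 - r) / K * cnrm A w \<le> (1 - r) * 1" by simp
  qed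
  finally have "r / K \<le> 2 * (1 - r)" by (simp add: algebra_simps)
  then have "r / K \<le> 1 / (2 * K)" by (simp add: r_def)
  then have "r \<le> 1 / 2" using K by (simp add: field_simps)
  moreover have "r \<ge> 3 / 4" using K by (simp add: r_def field_simps)
  ultimately show False by simp
qed

section \<open>The center of a simple C*-algebra\<close>

definition center :: "'a set" where
  "center = {z \<in> carrier A. \<forall>x\<in>carrier A. z \<otimes> x = x \<otimes> z}"

lemma centerD:
  assumes "z \<in> center"
  shows "z \<in> carrier A" "x \<in> carrier A \<Longrightarrow> z \<otimes> x = x \<otimes> z"
  using assms by (auto simp: center_def)

lemma star_subalgebra_center: "star_subalgebra center"
  unfolding star_subalgebra_def
proof (intro conjI ballI allI)
  fix x assume x: "x \<in> center"
  show "adj A x \<in> center"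
    unfolding center_def
  proof (intro CollectI conjI ballI)
    fix y assume y: "y \<in> carrier A"
    have xc: "x \<in> carrier A" using x by (simp add: center_def)
    have "adj A x \<otimes> y = adj A (adj A y \<otimes> x)" using xc y by (simp add: adj_mult)
    also have "adj A y \<otimes> x = x \<otimes> adj A y" using x y by (simp add: center_def)
    also have "adj A (x \<otimes> adj A y) = y \<otimes> adj A x" using xc y by (simp add: adj_mult)
    finally show "adj A x \<otimes> y = y \<otimes> adj A x" .
  qed (use x in \<open>simp add: center_def\<close>)
  fix y assume y: "y \<in> center"
  have xc: "x \<in> carrier A" and yc: "y \<in> carrier A" using x y by (auto simp: center_def)
  show "x \<otimes> y \<in> center"
    unfolding center_def
  proof (intro CollectI conjI ballI)
    fix z assume z: "z \<in> carrier A"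
    have "x \<otimes> y \<otimes> z = x \<otimes> (y \<otimes> z)" using xc yc z by (simp add: m_assoc)
    also have "y \<otimes> z = z \<otimes> y" using y z by (rule centerD)
    also have "x \<otimes> (z \<otimes> y) = x \<otimes> z \<otimes> y" using xc yc z by (simp add: m_assoc)
    also have "x \<otimes> z = z \<otimes> x" using x z by (rule centerD)
    finally show "x \<otimes> y \<otimes> z = z \<otimes> (x \<otimes> y)" using xc yc z by (simp add: m_assoc)
  qed (use xc yc in simp)
qed (auto simp: center_def l_distr r_distr smult_mult_left smult_mult_right)

lemma seq_closed_center: "seq_closed center"
  unfolding seq_closed_def
proof (intro allI impI, elim conjE)
  fix f x assume f: "range f \<subseteq> center" and x: "converges f x"
  have fz: "f n \<in> center" for n using f by auto
  have "x \<otimes> y = y \<otimes> x" if y: "y \<in> carrier A" for y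
  proof -
    have "f n \<otimes> y = y \<otimes> f n" for n
      using fz[of n] y by (simp add: center_def)
    then show ?thesis
      using converges_unique[OF converges_mult[OF x converges_const[OF y]]]
        converges_mult[OF converges_const[OF y] x] by simp
  qed
  then show "x \<in> center" using converges_carrier[OF x] by (simp add: center_def)
qed

text \<open>After scaling \<open>c\<close> to norm 1, e = 1 - c^2 is central and the closure of eA
  is a closed ideal. Were it all of \<open>A\<close>, then e would be invertible with central
  inverse, which \<open>not_invertible_one_minus_square\<close> excludes in the commutative
  C*-algebra \<open>center\<close>. So the ideal is zero, and e with it.\<close>

lemma simple_center_square_scalar:
  assumes simple: "simple_cstar A" and c: "c \<in> center" "adj A c = c"
  shows "c \<otimes> c = complex_of_real ((cnrm A c)\<^sup>2) \<odot> \<one>"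
proof (cases "c = \<zero>")
  case False
  have cc: "c \<in> carrier A" using c by (simp add: center_def)
  define b where "b = cnrm A c"
  have b: "b > 0" using False cc cnrm_nonneg[of c] cnrm_eq_0[of c] by (auto simp: b_def)
  note Z = star_subalgebraD[OF star_subalgebra_center]
  define c1 where "c1 = complex_of_real (1 / b) \<odot> c"
  have c1: "c1 \<in> center" "adj A c1 = c1" "cnrm A c1 = 1" "c1 \<in> carrier A"
    using c cc b Z by (auto simp: c1_def adj_smult cnrm_smult norm_divide b_def)
  define e where "e = \<one> \<ominus> c1 \<otimes> c1"
  have e: "e \<in> center" using c1 Z by (simp add: e_def)
  then have ec: "e \<in> carrier A" and ez: "\<And>x. x \<in> carrier A \<Longrightarrow> e \<otimes> x = x \<otimes> e"
    by (auto simp: center_def)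
  define J where "J = {e \<otimes> x | x. x \<in> carrier A}"
  have J: "J \<subseteq> carrier A" using ec by (auto simp: J_def)
  have Jadd: "x \<oplus> y \<in> J" if xy: "x \<in> J" "y \<in> J" for x y
  proof -
    obtain a b where "x = e \<otimes> a" "y = e \<otimes> b" "a \<in> carrier A" "b \<in> carrier A"
      using xy unfolding J_def by blast
    with ec show ?thesis unfolding J_def by (auto intro!: exI[of _ "a \<oplus> b"] simp: r_distr)
  qed
  have Jl: "a \<otimes> x \<in> J" if x: "x \<in> J" and a: "a \<in> carrier A" for x a
  proof -
    obtain y where "x = e \<otimes> y" "y \<in> carrier A" using x by (auto simp: J_def)
    moreover from this have "a \<otimes> (e \<otimes> y) = e \<otimes> (a \<otimes> y)"
      using ez[of a] ec a by (simp flip: m_assoc)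
    ultimately show ?thesis using a by (auto simp: J_def)
  qed
  have Jr: "x \<otimes> a \<in> J" if "x \<in> J" "a \<in> carrier A" for x a
    using that ec by (auto simp: J_def m_assoc)
  define I where "I = norm_closure J"
  have I: "ideal I A"
  proof (rule idealI)
    show "ring A" by (rule ring_axioms)
    show "subgroup I (add_monoid A)"
    proof (rule add.subgroupI)
      show "I \<subseteq> carrier A" by (simp add: I_def norm_closure_subset)
      have "\<zero> \<in> J" using ec by (auto simp: J_def intro!: exI[of _ \<zero>])
      then show "I \<noteq> {}" using norm_closure_superset[OF J] by (auto simp: I_def)
    next
      fix x assume "x \<in> I"
      then obtain f where f: "\<And>n. f n \<in> J" "converges f x"
        unfolding I_def using norm_closure_seq[OF J] by metis
      \<comment> \<open>Negation is written as a product, because \<open>J\<close> is known to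
        absorb left factors.\<close>
      have "converges (\<lambda>n. (\<ominus> \<one>) \<otimes> f n) ((\<ominus> \<one>) \<otimes> x)"
        by (intro converges_mult converges_const f) simp
      then show "\<ominus> x \<in> I"
        using converges_in_norm_closure[OF _ Jl J, of "\<lambda>_. \<ominus> \<one>" f] f
          converges_carrier[OF f(2)]
        by (auto simp: I_def l_minus intro: converges_in_norm_closure[OF _ Jl J])
    next
      fix x y assume "x \<in> I" "y \<in> I"
      then obtain f g where f: "\<And>n. f n \<in> J" "converges f x" and g: "\<And>n. g n \<in> J" "converges g y"
        unfolding I_def using norm_closure_seq[OF J] by metis
      show "x \<oplus> y \<in> I"
        unfolding I_def by (rule converges_in_norm_closure[OF converges_add[OF f(2) g(2)] _ J]) (intro Jadd f g)
    qed
  next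
    fix a x assume a: "a \<in> I" and x: "x \<in> carrier A"
    then obtain f where f: "\<And>n. f n \<in> J" "converges f a"
      unfolding I_def using norm_closure_seq[OF J] by metis
    show "x \<otimes> a \<in> I"
      unfolding I_def
      by (rule converges_in_norm_closure[OF converges_mult[OF converges_const[OF x] f(2)] _ J]) (intro Jl f x)
    show "a \<otimes> x \<in> I"
      unfolding I_def
      by (rule converges_in_norm_closure[OF converges_mult[OF f(2) converges_const[OF x]] _ J]) (intro Jr f x)
  qed
  moreover have "closedin (Metric_space.mtopology (carrier A) (cstar_dist A)) I"
    by (simp add: I_def closedin_iff_seq_closed norm_closure_subset seq_closed_norm_closure J)
  ultimately have "I = {\<zero>} \<or> I = carrier A"
    using simple by (auto simp: simple_cstar_def)
  moreover have "I \<noteq> carrier A"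
  proof
    assume "I = carrier A"
    then have "\<one> \<in> norm_closure J" by (simp add: I_def)
    then obtain x where x: "x \<in> carrier A" "cnrm A (\<one> \<ominus> e \<otimes> x) < 1"
      unfolding norm_closure_def J_def by (auto dest!: spec[of _ 1])
    then obtain t where t: "t \<in> carrier A" "e \<otimes> x \<otimes> t = \<one>"
      using Neumann_inverse[of "e \<otimes> x"] ec by auto
    define w where "w = x \<otimes> t"
    have w: "w \<in> carrier A" "e \<otimes> w = \<one>" "w \<otimes> e = \<one>"
      using x t ec ez[of w] by (auto simp: w_def m_assoc)
    \<comment> \<open>The inverse of a central element is central, so the contradiction can be
      reached inside \<open>center\<close>.\<close>
    have "w \<otimes> z = z \<otimes> w" if z: "z \<in> carrier A" for z
    proof -
      have "w \<otimes> z = w \<otimes> z \<otimes> (e \<otimes> w)" using w z by simp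
      also have "\<dots> = w \<otimes> (e \<otimes> z) \<otimes> w" using w(1) z ec ez[OF z] by (simp add: m_assoc)
      also have "\<dots> = (w \<otimes> e) \<otimes> (z \<otimes> w)" using w(1) z ec by (simp add: m_assoc)
      also have "\<dots> = z \<otimes> w" using w z by simp
      finally show ?thesis .
    qed
    then have wz: "w \<in> center" using w by (simp add: center_def)
    let ?Z = "A\<lparr>carrier := center\<rparr>"
    interpret Z: unital_cstar ?Z
      using star_subalgebra_center seq_closed_center
      by (intro cstar_algebra_imp_unital_cstar cstar_algebra_star_subalgebra)
    have eZ: "\<one> \<ominus>\<^bsub>?Z\<^esub> c1 \<otimes> c1 = e"
      unfolding e_def by (intro diff_restrict_carrier Z.ring_axioms Z c1(1))
    have "x \<otimes>\<^bsub>?Z\<^esub> y = y \<otimes>\<^bsub>?Z\<^esub> x" if "x \<in> carrier ?Z" "y \<in> carrier ?Z" for x y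
      using that centerD(2)[of x y] centerD(1)[of y] by simp
    moreover have "c1 \<in> carrier ?Z" "adj ?Z c1 = c1" "cnrm ?Z c1 = 1" "w \<in> carrier ?Z"
      using c1 wz by simp_all
    moreover have "w \<otimes>\<^bsub>?Z\<^esub> (\<one>\<^bsub>?Z\<^esub> \<ominus>\<^bsub>?Z\<^esub> c1 \<otimes>\<^bsub>?Z\<^esub> c1) = \<one>\<^bsub>?Z\<^esub>"
      using eZ w by simp
    ultimately show False by (rule Z.not_invertible_one_minus_square)
  qed
  ultimately have "I = {\<zero>}" by blast
  moreover have "e \<in> I"
  proof -
    have "e \<in> J" unfolding J_def using ec by (auto intro!: exI[of _ \<one>])
    then show ?thesis using norm_closure_superset[OF J] by (auto simp: I_def)
  qed
  ultimately have "\<one> = c1 \<otimes> c1" using c1 by (simp add: e_def diff_eq_zero_iff)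
  also have "\<dots> = complex_of_real (1 / b\<^sup>2) \<odot> (c \<otimes> c)"
    using cc by (simp add: c1_def smult_mult_left smult_mult_right scalar_mult power2_eq_square)
  finally have "complex_of_real (b\<^sup>2) \<odot> \<one> = complex_of_real (b\<^sup>2) \<odot> (complex_of_real (1 / b\<^sup>2) \<odot> (c \<otimes> c))"
    by simp
  also have "\<dots> = c \<otimes> c"
    using cc b by (simp add: scalar_mult)
  finally show ?thesis by (simp add: b_def)
qed (simp add: center_def)

end

text \<open>If the norm of \<open>x\<close> is below 1, some \<open>y\<close> completes
  \<open>adj A x \<otimes> x\<close> to the unit as
  \<open>adj A x \<otimes> x \<oplus> adj A y \<otimes> y\<close>. The homomorphism preserves this
  equation, and the two isometries in \<open>B\<close> turn it into the bound 1 for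
  \<open>h x\<close>; scaling does the rest.\<close>

lemma star_hom_contractive:
  assumes A: "cstar_algebra A" and B: "cstar_algebra B" and h: "star_hom A B h"
    and v: "v \<in> carrier B" "adj B v \<otimes>\<^bsub>B\<^esub> v = \<one>\<^bsub>B\<^esub>"
    and w: "w \<in> carrier B" "adj B w \<otimes>\<^bsub>B\<^esub> w = \<one>\<^bsub>B\<^esub>" "adj B v \<otimes>\<^bsub>B\<^esub> w = \<zero>\<^bsub>B\<^esub>"
    and x: "x \<in> carrier A"
  shows "cnrm B (h x) \<le> cnrm A x"
proof -
  interpret A: unital_cstar A using A by (rule cstar_algebra_imp_unital_cstar)
  interpret B: unital_cstar B using B by (rule cstar_algebra_imp_unital_cstar)
  have hom: "h \<in> ring_hom A B" and hsc: "\<And>c x. x \<in> carrier A \<Longrightarrow> h (c \<odot>\<^bsub>A\<^esub> x) = c \<odot>\<^bsub>B\<^esub> h x"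
    and hadj: "\<And>x. x \<in> carrier A \<Longrightarrow> h (adj A x) = adj B (h x)"
    using h by (auto simp: star_hom_def)
  note hc = ring_hom_closed[OF hom]
  have small: "cnrm B (h x) \<le> 1" if x: "x \<in> carrier A" "cnrm A x < 1" for x
  proof -
    have "cnrm A (adj A x \<otimes>\<^bsub>A\<^esub> x) < 1"
      using x by (simp add: A.cstar_identity power_less_one_iff A.cnrm_nonneg)
    moreover have "adj A (adj A x \<otimes>\<^bsub>A\<^esub> x) = adj A x \<otimes>\<^bsub>A\<^esub> x" using x by (simp add: A.adj_mult)
    ultimately obtain y where y: "y \<in> carrier A" "adj A y = y" "y \<otimes>\<^bsub>A\<^esub> y = \<one>\<^bsub>A\<^esub> \<ominus>\<^bsub>A\<^esub> adj A x \<otimes>\<^bsub>A\<^esub> x"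
      using x A.square_root_one_minus[of "adj A x \<otimes>\<^bsub>A\<^esub> x"] by auto
    have "adj A x \<otimes>\<^bsub>A\<^esub> x \<oplus>\<^bsub>A\<^esub> adj A y \<otimes>\<^bsub>A\<^esub> y = \<one>\<^bsub>A\<^esub>"
      using y x by (simp add: A.minus_eq A.a_ac A.r_neg)
    then have "h (adj A x \<otimes>\<^bsub>A\<^esub> x \<oplus>\<^bsub>A\<^esub> adj A y \<otimes>\<^bsub>A\<^esub> y) = \<one>\<^bsub>B\<^esub>"
      using ring_hom_one[OF hom] by simp
    then have "adj B (h x) \<otimes>\<^bsub>B\<^esub> h x \<oplus>\<^bsub>B\<^esub> adj B (h y) \<otimes>\<^bsub>B\<^esub> h y = \<one>\<^bsub>B\<^esub>"
      using x y(1) hadj by (simp add: ring_hom_add[OF hom] ring_hom_mult[OF hom])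
    then show ?thesis
      using x y hc by (intro B.cnrm_le_one_of_sum_one[OF v w]) auto
  qed
  show ?thesis
  proof (rule dense_ge)
    fix t assume t: "cnrm A x < t"
    then have "t > 0" using A.cnrm_nonneg[OF x] by simp
    have "cnrm B (h (complex_of_real (1 / t) \<odot>\<^bsub>A\<^esub> x)) \<le> 1"
      using x t \<open>t > 0\<close> by (intro small) (auto simp: A.cnrm_smult norm_divide divide_less_eq)
    then show "cnrm B (h x) \<le> t"
      using x \<open>t > 0\<close> hc[OF x] by (simp add: hsc B.cnrm_smult norm_divide divide_le_eq)
  qed
qed

section \<open>Traces and linear spans\<close>

context unital_cstar
begin

text \<open>For self-adjoint \<open>a\<close> of norm below 1, 1 - a is the square of a self-adjoint
  element, so \<tau> is nonnegative on it; the same for -a bounds \<tau> on \<open>a\<close>. The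
  factor 2 comes from splitting \<open>x\<close> into real and imaginary part. That it is the same
  for all \<tau> matters in \<open>trace_eq_mean\<close>.\<close>

lemma tracial_state_bounded:
  assumes \<tau>: "tracial_state A \<tau>" and x: "x \<in> carrier A"
  shows "cmod (\<tau> x) \<le> 2 * cnrm A x"
proof -
  have add: "\<And>x y. x \<in> carrier A \<Longrightarrow> y \<in> carrier A \<Longrightarrow> \<tau> (x \<oplus> y) = \<tau> x + \<tau> y"
    and sc: "\<And>c x. x \<in> carrier A \<Longrightarrow> \<tau> (c \<odot> x) = c * \<tau> x"
    and pos: "\<And>x. x \<in> carrier A \<Longrightarrow> \<tau> (adj A x \<otimes> x) \<in> \<real>\<^sub>\<ge>\<^sub>0" and one: "\<tau> \<one> = 1"
    using \<tau> by (auto simp: tracial_state_def)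
  have half: "Im (\<tau> a) = 0 \<and> Re (\<tau> a) \<le> 1" if a: "a \<in> carrier A" "adj A a = a" "cnrm A a < 1" for a
  proof -
    obtain y where y: "y \<in> carrier A" "adj A y = y" "y \<otimes> y = \<one> \<ominus> a"
      using square_root_one_minus[OF a] .
    then have "\<tau> (\<one> \<ominus> a) \<in> \<real>\<^sub>\<ge>\<^sub>0" using pos[of y] by simp
    moreover have "\<tau> (\<one> \<ominus> a) = 1 - \<tau> a"
      using a add[of \<one> "(-1) \<odot> a"] sc[of a "-1"] one by (simp add: minus_eq minus_eq_scalar[of a])
    ultimately show ?thesis by (auto simp: complex_nonneg_Reals_iff)
  qed
  have small: "cmod (\<tau> a) \<le> 1" if a: "a \<in> carrier A" "adj A a = a" "cnrm A a < 1" for a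
  proof -
    have "\<tau> (\<ominus> a) = - \<tau> a" using a sc[of a "-1"] by (simp add: minus_eq_scalar)
    then show ?thesis
      using half[OF a] half[of "\<ominus> a"] a by (auto simp: adj_minus cmod_def)
  qed
  have sa: "cmod (\<tau> a) \<le> cnrm A a" if a: "a \<in> carrier A" "adj A a = a" for a
  proof (rule dense_ge)
    fix t assume t: "cnrm A a < t"
    then have "t > 0" using cnrm_nonneg[OF a(1)] by simp
    have "cmod (\<tau> (complex_of_real (1 / t) \<odot> a)) \<le> 1"
      using a t \<open>t > 0\<close> by (intro small) (auto simp: adj_smult cnrm_smult norm_divide divide_less_eq)
    then show "cmod (\<tau> a) \<le> t"
      using a \<open>t > 0\<close> by (simp add: sc norm_divide norm_mult divide_le_eq)
  qed
  define a where "a = (1 / 2) \<odot> (x \<oplus> adj A x)"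
  define b where "b = (- \<i> / 2) \<odot> (x \<ominus> adj A x)"
  have a: "a \<in> carrier A" "adj A a = a" using x by (auto simp: a_def adj_smult adj_add a_comm)
  have b: "b \<in> carrier A" "adj A b = b"
  proof -
    have "adj A b = (\<i> / 2) \<odot> (adj A x \<ominus> x)" using x by (simp add: b_def adj_smult adj_diff)
    also have "adj A x \<ominus> x = (- 1) \<odot> (x \<ominus> adj A x)"
      using x by (simp add: scalar_minus minus_eq minus_add a_comm)
    finally show "adj A b = b" using x by (simp add: scalar_mult b_def)
  qed (use x in \<open>simp add: b_def\<close>)
  have "a \<oplus> \<i> \<odot> b = (1 / 2) \<odot> ((x \<oplus> adj A x) \<oplus> (x \<ominus> adj A x))"
    using x by (simp add: a_def b_def scalar_mult scalar_distrib)
  also have "(x \<oplus> adj A x) \<oplus> (x \<ominus> adj A x) = x \<oplus> x"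
    using x by (simp add: minus_eq a_ac r_neg r_neg2 r_neg1)
  also have "(1 / 2) \<odot> (x \<oplus> x) = x"
    using x by (simp add: scalar_distrib flip: scalar_add)
  finally have "\<tau> x = \<tau> a + \<i> * \<tau> b" using a b add[of a "\<i> \<odot> b"] sc[of b \<i>] by simp
  then have "cmod (\<tau> x) \<le> cmod (\<tau> a) + cmod (\<tau> b)"
    using norm_triangle_ineq[of "\<tau> a" "\<i> * \<tau> b"] by (simp add: norm_mult)
  also have "\<dots> \<le> cnrm A a + cnrm A b" using sa a b by (intro add_mono) auto
  also have "\<dots> \<le> cnrm A x + cnrm A x"
    using cnrm_triangle[of x "adj A x"] cnrm_diff_le[of x "adj A x"] x
    by (intro add_mono) (auto simp: a_def b_def cnrm_smult norm_divide)
  finally show ?thesis by simp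
qed

section \<open>Linear spans and double sums\<close>

inductive_set linear_span :: "'a set \<Rightarrow> 'a set" for S where
  zero: "\<zero> \<in> linear_span S"
| step: "x \<in> S \<Longrightarrow> y \<in> linear_span S \<Longrightarrow> c \<odot> x \<oplus> y \<in> linear_span S"

lemma linear_span_carrier:
  assumes "S \<subseteq> carrier A"
  shows "linear_span S \<subseteq> carrier A"
proof
  fix x assume "x \<in> linear_span S"
  then show "x \<in> carrier A" by induction (use assms in auto)
qed

lemma linear_span_superset: "S \<subseteq> carrier A \<Longrightarrow> S \<subseteq> linear_span S"
  using linear_span.step[OF _ linear_span.zero, of _ S 1] by (auto simp: subset_iff)

lemma linear_span_add:
  assumes S: "S \<subseteq> carrier A" and x: "x \<in> linear_span S" and y: "y \<in> linear_span S"
  shows "x \<oplus> y \<in> linear_span S"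
  using x
proof induction
  case zero
  then show ?case using y linear_span_carrier[OF S] by auto
next
  case (step x z c)
  have "x \<in> carrier A" "z \<in> carrier A" "y \<in> carrier A"
    using step S y linear_span_carrier[OF S] by auto
  then have "c \<odot> x \<oplus> z \<oplus> y = c \<odot> x \<oplus> (z \<oplus> y)" by (simp add: a_assoc)
  then show ?case using linear_span.step[OF step(1) step(3)] by simp
qed

lemma linear_span_scalar:
  assumes S: "S \<subseteq> carrier A" and x: "x \<in> linear_span S"
  shows "c \<odot> x \<in> linear_span S"
  using x
proof induction
  case zero
  then show ?case by (simp add: linear_span.zero)
next
  case (step x y b)
  have "x \<in> carrier A" "y \<in> carrier A"
    using step S linear_span_carrier[OF S] by auto
  then show ?case
    using linear_span.step[OF step(1) step(3), of "c * b"] by (simp add: scalar_distrib scalar_mult)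
qed

text \<open>The parameter \<open>g\<close> is the identity for linear maps and \<open>cnj\<close>
  for the adjoint, so that one induction covers both.\<close>

lemma linear_span_image:
  assumes S: "S \<subseteq> carrier A" and T: "T \<subseteq> carrier A"
    and F0: "F \<zero> = \<zero>"
    and F: "\<And>x y c. x \<in> carrier A \<Longrightarrow> y \<in> carrier A \<Longrightarrow> F (c \<odot> x \<oplus> y) = g c \<odot> F x \<oplus> F y"
    and ST: "\<And>x. x \<in> S \<Longrightarrow> F x \<in> linear_span T" and x: "x \<in> linear_span S"
  shows "F x \<in> linear_span T"
  using x
proof induction
  case zero
  then show ?case by (simp add: F0 linear_span.zero)
next
  case (step x y c)
  have "x \<in> carrier A" "y \<in> carrier A"
    using step S linear_span_carrier[OF S] by auto
  then show ?case
    using F linear_span_add[OF T linear_span_scalar[OF T ST[OF step(1)]] step(3)] by simp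
qed

lemma linear_span_finsum:
  assumes "S \<subseteq> carrier A" "finite I" "\<And>i. i \<in> I \<Longrightarrow> f i \<in> linear_span S"
  shows "finsum A f I \<in> linear_span S"
  using assms(2,3)
proof (induction I rule: finite_induct)
  case (insert i I)
  have "f \<in> I \<rightarrow> carrier A" "f i \<in> carrier A"
    using insert linear_span_carrier[OF assms(1)] by auto
  then show ?case using insert linear_span_add[OF assms(1)] by simp
qed (simp add: linear_span.zero)

lemma finsum_Times:
  assumes "finite I" "finite J" "\<And>i j. i \<in> I \<Longrightarrow> j \<in> J \<Longrightarrow> f i j \<in> carrier A"
  shows "(\<Oplus>i\<in>I. \<Oplus>j\<in>J. f i j) = (\<Oplus>p\<in>I \<times> J. f (fst p) (snd p))"
  using assms(1,3)
proof (induction I rule: finite_induct)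
  case (insert i I)
  have c: "(\<lambda>p. f (fst p) (snd p)) \<in> Pair i ` J \<rightarrow> carrier A"
    "(\<lambda>p. f (fst p) (snd p)) \<in> I \<times> J \<rightarrow> carrier A" "(\<lambda>i. \<Oplus>j\<in>J. f i j) \<in> I \<rightarrow> carrier A"
    "f i \<in> J \<rightarrow> carrier A"
    using insert by (auto intro!: finsum_closed)
  have "insert i I \<times> J = Pair i ` J \<union> I \<times> J" by auto
  moreover have "Pair i ` J \<inter> I \<times> J = {}" using insert by auto
  ultimately have "(\<Oplus>p\<in>insert i I \<times> J. f (fst p) (snd p))
      = (\<Oplus>p\<in>Pair i ` J. f (fst p) (snd p)) \<oplus> (\<Oplus>p\<in>I \<times> J. f (fst p) (snd p))"
    using insert assms(2) c finsum_Un_disjoint[of "Pair i ` J" "I \<times> J" "\<lambda>p. f (fst p) (snd p)"] by simp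
  also have "(\<Oplus>p\<in>Pair i ` J. f (fst p) (snd p)) = (\<Oplus>j\<in>J. f i j)"
    using finsum_reindex[OF c(1)] by (simp add: inj_on_def)
  finally show ?case using insert c by (simp add: finsum_closed)
qed simp

text \<open>Both sides are sums over pairs, and \<open>g\<close> carries one index set to the other.
  In \<open>Psi_commute\<close> the bijection is the one that unique factorization gives on pairs of
  edges.\<close>

lemma finsum_swap_bij:
  assumes fin: "finite I" "finite J" and g: "bij_betw g (I \<times> J) (J \<times> I)"
    and f: "\<And>i j. i \<in> I \<Longrightarrow> j \<in> J \<Longrightarrow> f i j \<in> carrier A"
    and h: "\<And>i j. i \<in> I \<Longrightarrow> j \<in> J \<Longrightarrow> h j i \<in> carrier A"
    and eq: "\<And>i j. i \<in> I \<Longrightarrow> j \<in> J \<Longrightarrow> f i j = h (fst (g (i, j))) (snd (g (i, j)))"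
  shows "(\<Oplus>i\<in>I. \<Oplus>j\<in>J. f i j) = (\<Oplus>j\<in>J. \<Oplus>i\<in>I. h j i)"
proof -
  have img: "g ` (I \<times> J) = J \<times> I" and inj: "inj_on g (I \<times> J)"
    using g by (auto simp: bij_betw_def)
  have hc: "(\<lambda>p. h (fst p) (snd p)) \<in> g ` (I \<times> J) \<rightarrow> carrier A" unfolding img using h by auto
  have "(\<Oplus>j\<in>J. \<Oplus>i\<in>I. h j i) = (\<Oplus>p\<in>J \<times> I. h (fst p) (snd p))"
    using fin h by (intro finsum_Times) auto
  also have "\<dots> = (\<Oplus>p\<in>I \<times> J. h (fst (g p)) (snd (g p)))"
    using finsum_reindex[OF hc inj] unfolding img by simp
  also have "\<dots> = (\<Oplus>p\<in>I \<times> J. f (fst p) (snd p))"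
    using f eq by (intro finsum_cong') auto
  also have "\<dots> = (\<Oplus>i\<in>I. \<Oplus>j\<in>J. f i j)"
    using fin f by (intro finsum_Times[symmetric]) auto
  finally show ?thesis by simp
qed

section \<open>Representations of the graph\<close>

lemma star_subalgebra_norm_closure:
  assumes S: "star_subalgebra S"
  shows "star_subalgebra (norm_closure S)"
proof -
  note D = star_subalgebraD[OF S]
  note seq = norm_closure_seq[OF D(1)] and cl = converges_in_norm_closure[OF _ _ D(1)]
  show ?thesis
    unfolding star_subalgebra_def
  proof (intro conjI ballI allI)
    show "norm_closure S \<subseteq> carrier A" by (rule norm_closure_subset)
    show "\<one> \<in> norm_closure S" using norm_closure_superset[OF D(1)] D(2) by auto
    fix x assume "x \<in> norm_closure S"
    then obtain f where f: "\<And>n. f n \<in> S" "converges f x" using seq by metis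
    show "c \<odot> x \<in> norm_closure S" for c by (rule cl[OF converges_scalar[OF f(2)]]) (intro D f)
    show "adj A x \<in> norm_closure S" by (rule cl[OF converges_adj[OF f(2)]]) (intro D f)
    fix y assume "y \<in> norm_closure S"
    then obtain g where g: "\<And>n. g n \<in> S" "converges g y" using seq by metis
    show "x \<oplus> y \<in> norm_closure S" by (rule cl[OF converges_add[OF f(2) g(2)]]) (intro D f g)
    show "x \<otimes> y \<in> norm_closure S" by (rule cl[OF converges_mult[OF f(2) g(2)]]) (intro D f g)
  qed
qed

text \<open>\<open>finsum\<close> depends on the carrier and not only on the addition, so the Cuntz
  sum in a subalgebra has to be compared with that in \<open>A\<close>.\<close>

lemma finsum_restrict_carrier:
  assumes S: "star_subalgebra S" and "finite I" and f: "\<And>i. i \<in> I \<Longrightarrow> f i \<in> S"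
  shows "finsum (A\<lparr>carrier := S\<rparr>) f I = finsum A f I"
proof -
  interpret S: ring "A\<lparr>carrier := S\<rparr>" using S by (rule ring_star_subalgebra)
  have c: "x \<in> carrier A" if "x \<in> S" for x using that star_subalgebraD(1)[OF S] by auto
  show ?thesis
    using assms(2) f
  proof (induction I rule: finite_induct)
    case (insert i I)
    then have "f \<in> I \<rightarrow> carrier A" "f i \<in> carrier A" "f \<in> I \<rightarrow> carrier (A\<lparr>carrier := S\<rparr>)"
      "f i \<in> carrier (A\<lparr>carrier := S\<rparr>)" using c by auto
    then show ?case using insert by (simp del: S.add.finprod_insert add: S.finsum_insert)
  qed simp
qed

end

locale kgraph_algebra = kg: single_vertex_kgraph \<Lambda> d + unital_cstar A
  for \<Lambda> :: "('l, 'm) monoid_scheme" and d :: "'l \<Rightarrow> nat ^ 'k::finite" and A :: "'a cstar" (structure) +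
  fixes s :: "'l \<Rightarrow> 'a"
  assumes universal: "universal_cuntz_algebra \<Lambda> d A s" and simple: "simple_cstar A"
begin

abbreviation E :: "'k \<Rightarrow> 'l set" where "E \<equiv> edges \<Lambda> d"
abbreviation m :: "'k \<Rightarrow> nat" where "m i \<equiv> card (E i)"

lemma one_neq_zero: "\<one> \<noteq> \<zero>"
  using simple by (simp add: simple_cstar_def)

lemma cnrm_one_eq [simp]: "cnrm A \<one> = 1"
  using one_neq_zero by (rule cnrm_one)

lemma rep: "cuntz_rep \<Lambda> d A s"
  using universal by (simp add: universal_cuntz_algebra_def)

lemma finite_E [simp]: "finite (E i)"
  by (rule kg.finite_edges)

lemma edge_carrier: "e \<in> E i \<Longrightarrow> e \<in> carrier \<Lambda>" and edge_degree: "e \<in> E i \<Longrightarrow> d e = axis i 1"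
  by (auto simp: edges_def)

lemma edge_color_unique: "e \<in> E i \<Longrightarrow> e \<in> E j \<Longrightarrow> i = j"
  by (auto simp: edges_def axis_eq_axis)

lemma s_closed [simp, intro]: "e \<in> E i \<Longrightarrow> s e \<in> carrier A"
  using rep by (auto simp: cuntz_rep_def cuntz_tuple_def)

lemma s_orthogonal: "e \<in> E i \<Longrightarrow> f \<in> E i \<Longrightarrow> adj A (s e) \<otimes> s f = (if e = f then \<one> else \<zero>)"
  using rep by (auto simp: cuntz_rep_def cuntz_tuple_def)

lemma s_sum: "(\<Oplus>e\<in>E i. s e \<otimes> adj A (s e)) = \<one>"
  using rep by (auto simp: cuntz_rep_def cuntz_tuple_def)

lemma s_commute:
  assumes "i \<noteq> j" "e \<in> E i" "e' \<in> E i" "f \<in> E j" "f' \<in> E j" "e \<otimes>\<^bsub>\<Lambda>\<^esub> f = f' \<otimes>\<^bsub>\<Lambda>\<^esub> e'"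
  shows "s e \<otimes> s f = s f' \<otimes> s e'"
  using rep assms unfolding cuntz_rep_def by blast

lemma m_pos: "m i > 0"
proof (rule ccontr)
  assume "\<not> m i > 0"
  then have "E i = {}" by simp
  then show False using s_sum[of i] one_neq_zero by simp
qed

lemma cnrm_s_le: "e \<in> E i \<Longrightarrow> cnrm A (s e) \<le> 1"
  using s_orthogonal[of e i e] by (intro cnrm_isometry_le) auto

text \<open>This is \<open>\<theta>\<^sub>i\<^sub>j\<close> in relational form: the degree
  \<open>\<epsilon>\<^sub>i + \<epsilon>\<^sub>j\<close> of the product can also be split with color
  \<open>j\<close> in front. For \<open>i = j\<close> it returns the given pair.\<close>

lemma edge_swap:
  assumes "e \<in> E i" "f \<in> E j"
  obtains f' e' where "f' \<in> E j" "e' \<in> E i" "e \<otimes>\<^bsub>\<Lambda>\<^esub> f = f' \<otimes>\<^bsub>\<Lambda>\<^esub> e'"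
proof -
  have c: "e \<in> carrier \<Lambda>" "f \<in> carrier \<Lambda>" using assms by (auto simp: edges_def)
  have "d (e \<otimes>\<^bsub>\<Lambda>\<^esub> f) = axis j 1 + axis i 1"
    using kg.d_mult[OF c] assms by (simp add: edges_def add.commute)
  from kg.factorization[OF kg.m_closed[OF c] this] obtain \<mu> \<nu> where
    "\<mu> \<in> carrier \<Lambda>" "\<nu> \<in> carrier \<Lambda>" "e \<otimes>\<^bsub>\<Lambda>\<^esub> f = \<mu> \<otimes>\<^bsub>\<Lambda>\<^esub> \<nu>" "d \<mu> = axis j 1" "d \<nu> = axis i 1"
    by auto
  then show ?thesis by (intro that[of \<mu> \<nu>]) (auto simp: edges_def)
qed

lemma edge_factor_unique:
  assumes "f \<in> E j" "f' \<in> E j" "e \<in> E i" "e' \<in> E i" "f \<otimes>\<^bsub>\<Lambda>\<^esub> e = f' \<otimes>\<^bsub>\<Lambda>\<^esub> e'"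
  shows "f = f' \<and> e = e'"
proof -
  have "d (f \<otimes>\<^bsub>\<Lambda>\<^esub> e) = axis j 1 + axis i 1"
    using assms by (simp add: kg.d_mult edges_def)
  from kg.factorization[OF _ this] have
    "\<exists>!p. fst p \<in> carrier \<Lambda> \<and> snd p \<in> carrier \<Lambda> \<and> f \<otimes>\<^bsub>\<Lambda>\<^esub> e = fst p \<otimes>\<^bsub>\<Lambda>\<^esub> snd p \<and>
       d (fst p) = axis j 1 \<and> d (snd p) = axis i 1"
    using assms by (simp add: edges_def case_prod_beta')
  moreover have "fst (f, e) \<in> carrier \<Lambda> \<and> snd (f, e) \<in> carrier \<Lambda> \<and> f \<otimes>\<^bsub>\<Lambda>\<^esub> e = fst (f, e) \<otimes>\<^bsub>\<Lambda>\<^esub> snd (f, e) \<and>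
       d (fst (f, e)) = axis j 1 \<and> d (snd (f, e)) = axis i 1"
    and "fst (f', e') \<in> carrier \<Lambda> \<and> snd (f', e') \<in> carrier \<Lambda> \<and> f \<otimes>\<^bsub>\<Lambda>\<^esub> e = fst (f', e') \<otimes>\<^bsub>\<Lambda>\<^esub> snd (f', e') \<and>
       d (fst (f', e')) = axis j 1 \<and> d (snd (f', e')) = axis i 1"
    using assms by (auto simp: edges_def)
  ultimately have "(f, e) = (f', e')" by blast
  then show ?thesis by simp
qed

section \<open>Words of edges, their degrees and monomials\<close>

definition W :: "'l list set" where "W = edge_words \<Lambda> d"

lemma W_Nil [simp]: "[] \<in> W"
  and W_Cons: "e # u \<in> W \<longleftrightarrow> (\<exists>i. e \<in> E i) \<and> u \<in> W"
  by (auto simp: W_def edge_words_def)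

lemma W_append: "u \<in> W \<Longrightarrow> v \<in> W \<Longrightarrow> u @ v \<in> W"
  by (auto simp: W_def edge_words_def)

lemma W_induct [consumes 1, case_names Nil Cons]:
  assumes "u \<in> W" "P []" "\<And>e i u. e \<in> E i \<Longrightarrow> u \<in> W \<Longrightarrow> P u \<Longrightarrow> P (e # u)"
  shows "P u"
  using assms(1) by (induction u) (auto simp: W_Cons assms)

definition deg :: "'l list \<Rightarrow> nat ^ 'k" where "deg u = sum_list (map d u)"

lemma deg_simps [simp]: "deg [] = 0" "deg (e # u) = d e + deg u" "deg (u @ v) = deg u + deg v"
  by (simp_all add: deg_def)

lemma word_prod_degree: "u \<in> W \<Longrightarrow> word_prod \<Lambda> u \<in> carrier \<Lambda> \<and> d (word_prod \<Lambda> u) = deg u"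
proof (induction u rule: W_induct)
  case (Cons e i u)
  then show ?case by (simp add: word_prod_def kg.d_mult edge_carrier)
qed (simp add: word_prod_def kg.d_one)

lemma deg_eq_0_iff: "u \<in> W \<Longrightarrow> deg u = 0 \<longleftrightarrow> u = []"
  by (cases u) (auto simp: W_Cons edge_degree vec_eq_iff axis_def)

definition mon :: "'l list \<Rightarrow> 'a" where "mon u = word_prod A (map s u)"

lemma mon_Nil [simp]: "mon [] = \<one>" and mon_Cons [simp]: "mon (e # u) = s e \<otimes> mon u"
  by (simp_all add: mon_def word_prod_def)

lemma mon_closed [simp, intro]: "u \<in> W \<Longrightarrow> mon u \<in> carrier A"
  by (induction u rule: W_induct) auto

lemma mon_append: "u \<in> W \<Longrightarrow> v \<in> W \<Longrightarrow> mon (u @ v) = mon u \<otimes> mon v"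
  by (induction u rule: W_induct) (auto simp: m_assoc)

lemma mon_isometry: "u \<in> W \<Longrightarrow> adj A (mon u) \<otimes> mon u = \<one>"
proof (induction u rule: W_induct)
  case (Cons e i u)
  have "adj A (mon (e # u)) \<otimes> mon (e # u) = adj A (mon u) \<otimes> (adj A (s e) \<otimes> s e) \<otimes> mon u"
    using Cons(1,2) s_closed[OF Cons(1)] by (simp add: adj_mult m_assoc)
  then show ?case using Cons s_orthogonal[OF Cons(1) Cons(1)] by simp
qed simp

lemma cnrm_mon_le: "u \<in> W \<Longrightarrow> cnrm A (mon u) \<le> 1"
  by (intro cnrm_isometry_le mon_isometry mon_closed)

text \<open>The relations \<open>s f \<otimes> s e = s e' \<otimes> s f'\<close> let an edge of
  color \<open>i\<close> move to the front one letter at a time. The word changes while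
  \<open>mon u\<close> stays; the length is recorded for the induction in
  \<open>has_mean_monomial\<close>.\<close>

lemma mon_pull_front:
  assumes "u \<in> W" "deg u $ i > 0"
  obtains e u' where "e \<in> E i" "u' \<in> W" "mon u = s e \<otimes> mon u'" "deg u = axis i 1 + deg u'"
    "length u = Suc (length u')"
proof -
  have "\<exists>e u'. e \<in> E i \<and> u' \<in> W \<and> mon u = s e \<otimes> mon u' \<and> deg u = axis i 1 + deg u' \<and>
      length u = Suc (length u')"
    using assms
  proof (induction u rule: W_induct)
    case (Cons f j u)
    show ?case
    proof (cases "j = i")
      case True
      then show ?thesis using Cons edge_degree[OF Cons(1)] by auto
    next
      case False
      then have "deg u $ i > 0" using Cons edge_degree[OF Cons(1)] by (simp add: axis_def)
      then obtain e u' where IH: "e \<in> E i" "u' \<in> W" "mon u = s e \<otimes> mon u'" "deg u = axis i 1 + deg u'"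
          "length u = Suc (length u')"
        using Cons by auto
      obtain e' f' where sw: "e' \<in> E i" "f' \<in> E j" "f \<otimes>\<^bsub>\<Lambda>\<^esub> e = e' \<otimes>\<^bsub>\<Lambda>\<^esub> f'"
        using edge_swap[OF Cons(1) IH(1)] by auto
      have "s f \<otimes> s e = s e' \<otimes> s f'"
        using s_commute[of j i f f' e e'] False sw IH(1) Cons(1) by auto
      moreover have "s f \<otimes> (s e \<otimes> mon u') = (s f \<otimes> s e) \<otimes> mon u'"
        using s_closed[OF Cons(1)] s_closed[OF IH(1)] IH(2) by (simp add: m_assoc)
      ultimately have "mon (f # u) = s e' \<otimes> mon (f' # u')"
        using s_closed[OF sw(1)] s_closed[OF sw(2)] IH by (simp add: m_assoc)
      moreover have "deg (f # u) = axis i 1 + deg (f' # u')"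
        using IH(4) edge_degree[OF Cons(1)] edge_degree[OF sw(2)] by (simp add: ac_simps)
      moreover have "f' # u' \<in> W" using sw IH by (auto simp: W_Cons)
      ultimately show ?thesis using sw(1) IH(5) by fastforce
    qed
  qed simp
  then show ?thesis using that by blast
qed

definition mons :: "'a set" where "mons = {mon u \<otimes> adj A (mon v) | u v. u \<in> W \<and> v \<in> W}"

lemma mons_carrier: "mons \<subseteq> carrier A"
  by (auto simp: mons_def)

lemma monsI: "u \<in> W \<Longrightarrow> v \<in> W \<Longrightarrow> mon u \<otimes> adj A (mon v) \<in> mons"
  by (auto simp: mons_def)

lemma span_mons_carrier: "x \<in> linear_span mons \<Longrightarrow> x \<in> carrier A"
  using linear_span_carrier[OF mons_carrier] by auto

lemma span_mons_left_s:
  assumes "e \<in> E i" "x \<in> linear_span mons"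
  shows "s e \<otimes> x \<in> linear_span mons"
proof (rule linear_span_image[OF mons_carrier mons_carrier _ _ _ assms(2), where g = "\<lambda>c. c"])
  note se = s_closed[OF assms(1)]
  show "s e \<otimes> \<zero> = \<zero>" using se by simp
  show "s e \<otimes> (c \<odot> x \<oplus> y) = c \<odot> (s e \<otimes> x) \<oplus> s e \<otimes> y" if "x \<in> carrier A" "y \<in> carrier A" for x y c
    using that se by (simp add: r_distr smult_mult_right)
  fix x assume "x \<in> mons"
  then obtain u v where uv: "u \<in> W" "v \<in> W" "x = mon u \<otimes> adj A (mon v)" by (auto simp: mons_def)
  then have "s e \<otimes> x = mon (e # u) \<otimes> adj A (mon v)" using se by (simp add: m_assoc)
  moreover have "e # u \<in> W" using assms uv by (auto simp: W_Cons)
  ultimately show "s e \<otimes> x \<in> linear_span mons"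
    using linear_span_superset[OF mons_carrier] monsI[of "e # u" v] uv by auto
qed

text \<open>A commutation relation rewrites \<open>s e \<otimes> s \<eta>\<close>, and orthogonality
  selects \<open>f' = f\<close>. Together with \<open>adj_s_mult_s_expand\<close>, which inserts the
  Cuntz sum of color \<open>j\<close>, this computes \<open>s_f^* s_e\<close> as the sum of
  \<open>s_\<xi> s_\<eta>^*\<close> over all pairs with \<open>e \<eta> = f \<xi>\<close>.\<close>

lemma adj_s_mult_s_term:
  assumes "i \<noteq> j" "e \<in> E i" "f \<in> E j" "\<eta> \<in> E j" "f' \<in> E j" "\<xi> \<in> E i"
    and "e \<otimes>\<^bsub>\<Lambda>\<^esub> \<eta> = f' \<otimes>\<^bsub>\<Lambda>\<^esub> \<xi>" and x: "x \<in> carrier A"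
  shows "adj A (s f) \<otimes> s e \<otimes> (s \<eta> \<otimes> adj A (s \<eta>)) \<otimes> x
      = (if f' = f then s \<xi> \<otimes> (adj A (s \<eta>) \<otimes> x) else \<zero>)"
proof -
  have c: "s e \<in> carrier A" "s f \<in> carrier A" "s \<eta> \<in> carrier A" "s f' \<in> carrier A" "s \<xi> \<in> carrier A"
    using assms by auto
  have "adj A (s f) \<otimes> s e \<otimes> (s \<eta> \<otimes> adj A (s \<eta>)) \<otimes> x
      = adj A (s f) \<otimes> (s e \<otimes> s \<eta>) \<otimes> (adj A (s \<eta>) \<otimes> x)"
    using c x by (simp add: m_assoc)
  also have "s e \<otimes> s \<eta> = s f' \<otimes> s \<xi>" using s_commute assms by blast
  also have "adj A (s f) \<otimes> (s f' \<otimes> s \<xi>) \<otimes> (adj A (s \<eta>) \<otimes> x)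
      = (adj A (s f) \<otimes> s f') \<otimes> (s \<xi> \<otimes> (adj A (s \<eta>) \<otimes> x))"
    using c x by (simp add: m_assoc)
  finally show ?thesis
    using s_orthogonal[OF assms(3,5)] c x by simp
qed

lemma adj_s_mult_s_expand:
  assumes "e \<in> E i" "f \<in> E j" and x: "x \<in> carrier A"
  shows "adj A (s f) \<otimes> s e \<otimes> x = (\<Oplus>\<eta>\<in>E j. adj A (s f) \<otimes> s e \<otimes> (s \<eta> \<otimes> adj A (s \<eta>)) \<otimes> x)"
proof -
  have c: "s e \<in> carrier A" "s f \<in> carrier A" using assms by auto
  have 1: "(\<lambda>\<eta>. s \<eta> \<otimes> adj A (s \<eta>)) \<in> E j \<rightarrow> carrier A" by auto
  then have "(\<lambda>\<eta>. adj A (s f) \<otimes> s e \<otimes> (s \<eta> \<otimes> adj A (s \<eta>))) \<in> E j \<rightarrow> carrier A" using c by auto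
  with 1 have "(\<Oplus>\<eta>\<in>E j. adj A (s f) \<otimes> s e \<otimes> (s \<eta> \<otimes> adj A (s \<eta>)) \<otimes> x)
      = adj A (s f) \<otimes> s e \<otimes> (\<Oplus>\<eta>\<in>E j. s \<eta> \<otimes> adj A (s \<eta>)) \<otimes> x"
    using c x by (simp add: finsum_rdistr finsum_ldistr)
  then show ?thesis using c x by (simp add: s_sum)
qed

text \<open>The adjoint of \<open>s f\<close> is pushed through \<open>u\<close> letter by letter. A
  letter of its own color cancels it or gives zero; a letter of another color replaces
  \<open>f\<close> by edges \<eta> of the color of \<open>f\<close>, hence the induction over all
  \<open>f\<close>. At the empty word it is absorbed into \<open>v\<close>.\<close>

lemma span_mons_left_adj_s_mon:
  assumes "u \<in> W" "v \<in> W" "f \<in> E j"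
  shows "adj A (s f) \<otimes> (mon u \<otimes> adj A (mon v)) \<in> linear_span mons"
  using assms(1,3)
proof (induction u arbitrary: f j rule: W_induct)
  case Nil
  have f: "[f] \<in> W" using Nil by (auto simp: W_Cons)
  then have "adj A (s f) \<otimes> adj A (mon v) = mon [] \<otimes> adj A (mon (v @ [f]))"
    using s_closed[OF Nil(1)] assms(2) by (simp add: mon_append adj_mult)
  moreover have "v @ [f] \<in> W" using assms(2) f by (rule W_append)
  ultimately show ?case
    using linear_span_superset[OF mons_carrier] monsI[of "[]" "v @ [f]"] assms by auto
next
  case (Cons e i u)
  note c = s_closed[OF Cons(1)] s_closed[OF Cons(4)] mon_closed[OF Cons(2)] mon_closed[OF assms(2)]
  define x where "x = mon u \<otimes> adj A (mon v)"
  have x: "x \<in> linear_span mons" "x \<in> carrier A"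
    using linear_span_superset[OF mons_carrier] monsI[OF Cons(2) assms(2)] mons_carrier by (auto simp: x_def)
  have eq: "adj A (s f) \<otimes> (mon (e # u) \<otimes> adj A (mon v)) = adj A (s f) \<otimes> s e \<otimes> x"
    using c by (simp add: x_def m_assoc)
  show ?case
  proof (cases "i = j")
    case True
    then show ?thesis
      using s_orthogonal[of f i e] Cons(1,4) x unfolding eq by (auto simp: linear_span.zero)
  next
    case False
    have "adj A (s f) \<otimes> s e \<otimes> (s \<eta> \<otimes> adj A (s \<eta>)) \<otimes> x \<in> linear_span mons" if \<eta>: "\<eta> \<in> E j" for \<eta>
    proof -
      obtain f' \<xi> where sw: "f' \<in> E j" "\<xi> \<in> E i" "e \<otimes>\<^bsub>\<Lambda>\<^esub> \<eta> = f' \<otimes>\<^bsub>\<Lambda>\<^esub> \<xi>"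
        using edge_swap[OF Cons(1) \<eta>] .
      show ?thesis
        using adj_s_mult_s_term[OF False Cons(1,4) \<eta> sw x(2)] span_mons_left_s[OF sw(2) Cons(3)[OF \<eta>]]
        by (simp add: x_def linear_span.zero)
    qed
    then show ?thesis
      unfolding eq adj_s_mult_s_expand[OF Cons(1,4) x(2)] by (intro linear_span_finsum mons_carrier) auto
  qed
qed

lemma span_mons_left_adj_s:
  assumes "e \<in> E i" "x \<in> linear_span mons"
  shows "adj A (s e) \<otimes> x \<in> linear_span mons"
proof (rule linear_span_image[OF mons_carrier mons_carrier _ _ _ assms(2), where g = "\<lambda>c. c"])
  note se = s_closed[OF assms(1)]
  show "adj A (s e) \<otimes> \<zero> = \<zero>" using se by simp
  show "adj A (s e) \<otimes> (c \<odot> x \<oplus> y) = c \<odot> (adj A (s e) \<otimes> x) \<oplus> adj A (s e) \<otimes> y"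
    if "x \<in> carrier A" "y \<in> carrier A" for x y c
    using that se by (simp add: r_distr smult_mult_right)
  show "adj A (s e) \<otimes> x \<in> linear_span mons" if "x \<in> mons" for x
    using that span_mons_left_adj_s_mon[OF _ _ assms(1)] by (auto simp: mons_def)
qed

lemma span_mons_left_mons:
  assumes "a \<in> mons" "x \<in> linear_span mons"
  shows "a \<otimes> x \<in> linear_span mons"
proof -
  obtain u v where uv: "u \<in> W" "v \<in> W" "a = mon u \<otimes> adj A (mon v)"
    using assms by (auto simp: mons_def)
  have "adj A (mon v) \<otimes> y \<in> linear_span mons" if "y \<in> linear_span mons" for y
    using uv(2) that
  proof (induction v arbitrary: y rule: W_induct)
    case (Cons e i v)
    then show ?case
      using span_mons_left_adj_s[of e i y] span_mons_carrier[of y] s_closed[OF Cons(1)]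
      by (simp add: adj_mult m_assoc)
  qed (simp add: span_mons_carrier)
  moreover have "mon u \<otimes> y \<in> linear_span mons" if "y \<in> linear_span mons" for y
    using uv(1) that
  proof (induction u arbitrary: y rule: W_induct)
    case (Cons e i u)
    then show ?case
      using span_mons_left_s[of e i "mon u \<otimes> y"] span_mons_carrier[of y] s_closed[OF Cons(1)]
      by (simp add: m_assoc)
  qed (simp add: span_mons_carrier)
  ultimately show ?thesis
    using uv assms span_mons_carrier[of x] by (simp add: m_assoc)
qed

lemma star_subalgebra_span_mons: "star_subalgebra (linear_span mons)"
  unfolding star_subalgebra_def
proof (intro conjI ballI allI)
  show "linear_span mons \<subseteq> carrier A" by (rule linear_span_carrier[OF mons_carrier])
  show "\<one> \<in> linear_span mons"
    using linear_span_superset[OF mons_carrier] monsI[of "[]" "[]"] by auto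
  fix x assume x: "x \<in> linear_span mons"
  show "c \<odot> x \<in> linear_span mons" for c using x by (rule linear_span_scalar[OF mons_carrier])
  show "adj A x \<in> linear_span mons"
  proof (rule linear_span_image[OF mons_carrier mons_carrier _ _ _ x, where g = cnj])
    show "adj A a \<in> linear_span mons" if a: "a \<in> mons" for a
    proof -
      obtain u v where "u \<in> W" "v \<in> W" "a = mon u \<otimes> adj A (mon v)" using a by (auto simp: mons_def)
      then show ?thesis
        using linear_span_superset[OF mons_carrier] monsI[of v u] by (auto simp: adj_mult)
    qed
  qed (auto simp: adj_add adj_smult)
  fix y assume y: "y \<in> linear_span mons"
  show "x \<oplus> y \<in> linear_span mons" using x y by (rule linear_span_add[OF mons_carrier])
  show "x \<otimes> y \<in> linear_span mons"
  proof (rule linear_span_image[OF mons_carrier mons_carrier _ _ _ x, where g = "\<lambda>c. c"])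
    show "a \<otimes> y \<in> linear_span mons" if "a \<in> mons" for a
      using that y by (rule span_mons_left_mons)
  qed (use span_mons_carrier[OF y] in \<open>auto simp: l_distr smult_mult_left\<close>)
qed

section \<open>Rotated representations and the universal property\<close>

definition color :: "'l \<Rightarrow> 'k" where "color e = (THE i. e \<in> E i)"

lemma color_eq: "e \<in> E i \<Longrightarrow> color e = i"
  unfolding color_def using edge_color_unique by blast

text \<open>The Cuntz relations pair generators with adjoints of generators of the same color, and
  both sides of a commutation relation contain one edge of each of its two colors, so the unimodular
  factors cancel or agree.\<close>

lemma rotated_rep:
  assumes z: "\<And>i. cmod (z i) = 1"
  shows "cuntz_rep \<Lambda> d A (\<lambda>e. z (color e) \<odot> s e)"
  unfolding cuntz_rep_def
proof (intro conjI allI impI ballI)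
  have zz: "cnj (z i) * z i = 1" "z i * cnj (z i) = 1" for i
    using z[of i] complex_norm_square[of "z i"] by (simp_all add: mult.commute)
  fix i
  have rot: "z (color e) \<odot> s e = z i \<odot> s e" if "e \<in> E i" for e using that by (simp add: color_eq)
  have orth: "adj A (z i \<odot> s e) \<otimes> (z i \<odot> s f) = adj A (s e) \<otimes> s f" if "e \<in> E i" "f \<in> E i" for e f
    using s_closed[OF that(1)] s_closed[OF that(2)]
    by (simp add: adj_smult smult_mult_left smult_mult_right scalar_mult zz)
  have "(\<Oplus>e\<in>E i. z (color e) \<odot> s e \<otimes> adj A (z (color e) \<odot> s e)) = (\<Oplus>e\<in>E i. s e \<otimes> adj A (s e))"
  proof (rule finsum_cong')
    fix e assume e: "e \<in> E i"
    show "z (color e) \<odot> s e \<otimes> adj A (z (color e) \<odot> s e) = s e \<otimes> adj A (s e)"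
      using s_closed[OF e] by (simp add: rot[OF e] adj_smult smult_mult_left smult_mult_right scalar_mult zz)
  qed auto
  then show "cuntz_tuple A (E i) (\<lambda>e. z (color e) \<odot> s e)"
    by (auto simp: cuntz_tuple_def rot orth s_orthogonal s_sum)
  fix j e e' f f'
  assume "i \<noteq> j" and e: "e \<in> E i" "e' \<in> E i" and f: "f \<in> E j" "f' \<in> E j" and eq: "e \<otimes>\<^bsub>\<Lambda>\<^esub> f = f' \<otimes>\<^bsub>\<Lambda>\<^esub> e'"
  have "s e \<otimes> s f = s f' \<otimes> s e'" using s_commute[OF \<open>i \<noteq> j\<close> e f eq] .
  then show "(z (color e) \<odot> s e) \<otimes> (z (color f) \<odot> s f) = (z (color f') \<odot> s f') \<otimes> (z (color e') \<odot> s e')"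
    using s_closed[OF e(1)] s_closed[OF e(2)] s_closed[OF f(1)] s_closed[OF f(2)]
    by (simp add: color_eq[OF e(1)] color_eq[OF e(2)] color_eq[OF f(1)] color_eq[OF f(2)]
        smult_mult_left smult_mult_right scalar_mult mult.commute)
qed

lemma rotation_ex1:
  assumes "\<And>i. cmod (z i) = 1"
  shows "\<exists>!h. h \<in> extensional (carrier A) \<and> star_hom A A h \<and> (\<forall>i. \<forall>e\<in>E i. h (s e) = z i \<odot> s e)"
proof -
  have "\<exists>!h. h \<in> extensional (carrier A) \<and> star_hom A A h \<and> (\<forall>i. \<forall>e\<in>E i. h (s e) = z (color e) \<odot> s e)"
    using universal rotated_rep[of z] assms unfolding universal_cuntz_algebra_def by blast
  moreover have "(\<forall>i. \<forall>e\<in>E i. h (s e) = z (color e) \<odot> s e) \<longleftrightarrow> (\<forall>i. \<forall>e\<in>E i. h (s e) = z i \<odot> s e)" for h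
    by (simp add: color_eq)
  ultimately show ?thesis by simp
qed

lemma star_hom_restrict: "star_hom A A h \<Longrightarrow> star_hom A A (restrict h (carrier A))"
  by (auto simp: star_hom_def ring_hom_def)

text \<open>Restricting both maps to the carrier makes them extensional without changing them there,
  so the uniqueness part of the universal property applies.\<close>

lemma rotation_unique:
  assumes "\<And>i. cmod (z i) = 1" "star_hom A A h" "star_hom A A h'"
    and "\<And>i e. e \<in> E i \<Longrightarrow> h (s e) = z i \<odot> s e" "\<And>i e. e \<in> E i \<Longrightarrow> h' (s e) = z i \<odot> s e"
    and x: "x \<in> carrier A"
  shows "h x = h' x"
proof -
  let ?P = "\<lambda>h. h \<in> extensional (carrier A) \<and> star_hom A A h \<and> (\<forall>i. \<forall>e\<in>E i. h (s e) = z i \<odot> s e)"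
  have "?P (restrict h (carrier A))" "?P (restrict h' (carrier A))"
    using assms by (auto simp: star_hom_restrict)
  moreover have "\<exists>!h. ?P h" using rotation_ex1[of z] assms(1) by blast
  ultimately have "restrict h (carrier A) = restrict h' (carrier A)" by blast
  then show ?thesis using x by (metis restrict_apply')
qed

lemma star_hom_id: "star_hom A A (\<lambda>x. x)"
  by (auto simp: star_hom_def ring_hom_def)

text \<open>The competitor is the identity. In this form the universal property says that the
  generators generate \<open>A\<close>.\<close>

lemma star_hom_fixing_generators:
  assumes "star_hom A A h" "\<And>i e. e \<in> E i \<Longrightarrow> h (s e) = s e" "x \<in> carrier A"
  shows "h x = x"
  using rotation_unique[of "\<lambda>_. 1" h "\<lambda>x. x" x] assms star_hom_id s_closed by auto

end

section \<open>Rotations and the central unitary\<close>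

text \<open>Two of the iterates agree on \<open>T\<close> by finiteness, and injectivity cancels the
  smaller number of iterations. One exponent serves all points of \<open>T\<close>.\<close>

lemma finite_inj_funpow_id:
  assumes fin: "finite T" and f: "f ` T \<subseteq> T" and inj: "inj_on f T"
  obtains n where "n > 0" "\<And>x. x \<in> T \<Longrightarrow> (f ^^ n) x = x"
proof -
  have maps: "(f ^^ n) x \<in> T" if "x \<in> T" for n x
    using that f by (induction n) auto
  have injn: "inj_on (f ^^ n) T" for n
  proof (induction n)
    case (Suc n)
    then show ?case
      using maps inj by (auto simp: inj_on_def)
  qed simp
  have "range (\<lambda>n. restrict (f ^^ n) T) \<subseteq> T \<rightarrow>\<^sub>E T"
    using maps by auto
  then have "finite (range (\<lambda>n. restrict (f ^^ n) T))"
    using finite_subset finite_PiE[OF fin, of "\<lambda>_. T"] fin by blast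
  then have "\<not> inj (\<lambda>n. restrict (f ^^ n) T)"
    using finite_imageD infinite_UNIV_nat by blast
  then obtain a b where ab: "a < b" "restrict (f ^^ a) T = restrict (f ^^ b) T"
    unfolding inj_def by (metis linorder_neqE_nat)
  show ?thesis
  proof
    show "b - a > 0" using ab by simp
    fix x assume x: "x \<in> T"
    have "(f ^^ a) ((f ^^ (b - a)) x) = (f ^^ b) x"
      using ab(1) by (metis add_diff_inverse_nat comp_apply funpow_add not_less_iff_gr_or_eq)
    also have "\<dots> = (f ^^ a) x" using ab(2) x by (metis restrict_apply')
    finally show "(f ^^ (b - a)) x = x"
      using injn[of a] maps[OF x] x by (auto dest: inj_onD)
  qed
qed

context kgraph_algebra
begin

text \<open>The closed span of the monomials is a C*-algebra on the same type and contains the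
  generators, so the universal property maps \<open>A\<close> into it. As an endomorphism of
  \<open>A\<close> this map fixes the generators, hence is the identity.\<close>

lemma mons_dense:
  assumes "x \<in> carrier A"
  shows "x \<in> norm_closure (linear_span mons)"
proof -
  let ?S = "norm_closure (linear_span mons)"
  let ?B = "A\<lparr>carrier := ?S\<rparr>"
  have sub: "star_subalgebra ?S" by (intro star_subalgebra_norm_closure star_subalgebra_span_mons)
  have B: "cstar_algebra ?B"
    using sub by (intro cstar_algebra_star_subalgebra seq_closed_norm_closure linear_span_carrier mons_carrier)
  have sS: "s e \<in> ?S" if "e \<in> E i" for e i
  proof -
    have "[e] \<in> W" using that by (auto simp: W_Cons)
    then have "s e \<in> mons" using monsI[of "[e]" "[]"] s_closed[OF that] by simp
    then show ?thesis
      using linear_span_superset[OF mons_carrier] norm_closure_superset[OF linear_span_carrier[OF mons_carrier]]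
      by auto
  qed
  have "cuntz_rep \<Lambda> d ?B s"
    unfolding cuntz_rep_def
  proof (intro conjI allI impI ballI)
    fix i
    have "(\<Oplus>\<^bsub>?B\<^esub>e\<in>E i. s e \<otimes> adj A (s e)) = \<one>"
      using sS star_subalgebraD[OF sub] by (subst finsum_restrict_carrier[OF sub]) (auto simp: s_sum)
    then show "cuntz_tuple ?B (E i) s"
      using sS by (auto simp: cuntz_tuple_def s_orthogonal)
  qed (use s_commute in simp)
  then obtain h where h: "star_hom A ?B h" "\<And>i e. e \<in> E i \<Longrightarrow> h (s e) = s e"
    using universal B unfolding universal_cuntz_algebra_def by blast
  have hS: "h y \<in> ?S" if "y \<in> carrier A" for y
    using h(1) that by (auto simp: star_hom_def ring_hom_def)
  then have "star_hom A A h"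
    using h(1) norm_closure_subset by (auto simp: star_hom_def ring_hom_def)
  then have "h x = x" using h(2) assms by (rule star_hom_fixing_generators)
  then show ?thesis using hS[OF assms] by simp
qed

text \<open>The gauge action of the k-torus: \<open>z\<close> carries one unimodular number for each
  color.\<close>

definition rotation :: "('k \<Rightarrow> complex) \<Rightarrow> 'a \<Rightarrow> 'a" where
  "rotation z = (THE h. h \<in> extensional (carrier A) \<and> star_hom A A h \<and> (\<forall>i. \<forall>e\<in>E i. h (s e) = z i \<odot> s e))"

lemma rotation_props:
  assumes "\<And>i. cmod (z i) = 1"
  shows "rotation z \<in> extensional (carrier A)" "star_hom A A (rotation z)"
    "\<And>i e. e \<in> E i \<Longrightarrow> rotation z (s e) = z i \<odot> s e"
proof -
  have "\<exists>!h. h \<in> extensional (carrier A) \<and> star_hom A A h \<and> (\<forall>i. \<forall>e\<in>E i. h (s e) = z i \<odot> s e)"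
    using rotation_ex1[of z] assms by blast
  from theI'[OF this] show "rotation z \<in> extensional (carrier A)" "star_hom A A (rotation z)"
    "\<And>i e. e \<in> E i \<Longrightarrow> rotation z (s e) = z i \<odot> s e"
    unfolding rotation_def by blast+
qed

lemma star_homD:
  assumes "star_hom A A h"
  shows "\<And>x. x \<in> carrier A \<Longrightarrow> h x \<in> carrier A"
    "\<And>x y. x \<in> carrier A \<Longrightarrow> y \<in> carrier A \<Longrightarrow> h (x \<oplus> y) = h x \<oplus> h y"
    "\<And>x y. x \<in> carrier A \<Longrightarrow> y \<in> carrier A \<Longrightarrow> h (x \<otimes> y) = h x \<otimes> h y"
    "\<And>c x. x \<in> carrier A \<Longrightarrow> h (c \<odot> x) = c \<odot> h x"
    "\<And>x. x \<in> carrier A \<Longrightarrow> h (adj A x) = adj A (h x)"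
    "h \<one> = \<one>"
  using assms by (auto simp: star_hom_def ring_hom_def)

definition phase :: "('k \<Rightarrow> complex) \<Rightarrow> nat ^ 'k \<Rightarrow> complex" where
  "phase z p = (\<Prod>i\<in>UNIV. z i ^ (p $ i))"

lemma phase_0 [simp]: "phase z 0 = 1"
  by (simp add: phase_def)

lemma phase_add: "phase z (p + q) = phase z p * phase z q"
  by (simp add: phase_def power_add prod.distrib)

lemma phase_axis [simp]: "phase z (axis i (Suc 0)) = z i"
proof -
  have "phase z (axis i (Suc 0)) = (\<Prod>j\<in>UNIV. if j = i then z i else 1)"
    unfolding phase_def by (intro prod.cong) (auto simp: axis_def)
  then show ?thesis by simp
qed

lemma rotation_mon:
  assumes z: "\<And>i. cmod (z i) = 1" and u: "u \<in> W"
  shows "rotation z (mon u) = phase z (deg u) \<odot> mon u"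
  using u
proof (induction u rule: W_induct)
  case Nil
  then show ?case using star_homD(6)[OF rotation_props(2)[of z, OF z]] by simp
next
  case (Cons e i u)
  then show ?case
    using star_homD(3)[OF rotation_props(2)[of z, OF z], of "s e" "mon u"] s_closed[OF Cons(1)]
      rotation_props(3)[of z, OF z Cons(1)] edge_degree[OF Cons(1)]
    by (simp add: phase_add smult_mult_left smult_mult_right scalar_mult mult.commute)
qed

lemma rotation_monomial:
  assumes z: "\<And>i. cmod (z i) = 1" and u: "u \<in> W" and v: "v \<in> W"
  shows "rotation z (mon u \<otimes> adj A (mon v))
      = (phase z (deg u) * cnj (phase z (deg v))) \<odot> (mon u \<otimes> adj A (mon v))"
  using u v star_homD[OF rotation_props(2)[of z, OF z]]
  by (simp add: rotation_mon[of z, OF z] adj_smult smult_mult_left smult_mult_right scalar_mult mult.commute)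

lemma rotation_inverse:
  assumes z: "\<And>i. cmod (z i) = 1" and x: "x \<in> carrier A"
  shows "rotation z (rotation (\<lambda>i. cnj (z i)) x) = x"
proof (rule star_hom_fixing_generators[OF _ _ x])
  have w: "\<And>i. cmod (cnj (z i)) = 1" using z by simp
  note H = star_homD[OF rotation_props(2)[of z, OF z]] and H' = star_homD[OF rotation_props(2)[of "\<lambda>i. cnj (z i)", OF w]]
  show "star_hom A A (\<lambda>x. rotation z (rotation (\<lambda>i. cnj (z i)) x))"
    using H H' by (auto simp: star_hom_def ring_hom_def)
  fix i e assume e: "e \<in> E i"
  have "cnj (z i) * z i = 1"
    using z[of i] complex_norm_square[of "z i"] by (simp add: mult.commute)
  then show "rotation z (rotation (\<lambda>i. cnj (z i)) (s e)) = s e"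
    using rotation_props(3)[of z, OF z e] rotation_props(3)[of "\<lambda>i. cnj (z i)", OF w e] H(4)[of "s e"] s_closed[OF e]
    by (simp add: scalar_mult)
qed

lemma rotation_automorphism:
  assumes z: "\<And>i. cmod (z i) = 1"
  shows "star_automorphism A (rotation z)"
  unfolding star_automorphism_def
proof
  have w: "\<And>i. cmod (cnj (z i)) = 1" using z by simp
  show "star_hom A A (rotation z)" by (rule rotation_props(2)[of z, OF z])
  show "bij_betw (rotation z) (carrier A) (carrier A)"
    by (rule bij_betw_byWitness[where f' = "rotation (\<lambda>i. cnj (z i))"])
      (use rotation_inverse[of z, OF z] rotation_inverse[of "\<lambda>i. cnj (z i)", OF w] star_homD(1)[OF rotation_props(2)[of z, OF z]]
        star_homD(1)[OF rotation_props(2)[of "\<lambda>i. cnj (z i)", OF w]] in auto)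
qed

text \<open>If \<open>m i = 1\<close>, the single edge acts on the others by a permutation, so some power of its generator
  is a central unitary \<open>V\<close>. By simplicity \<open>V + V\<^sup>*\<close> is scalar, hence fixed by every rotation, which
  multiplies \<open>V\<close> by an arbitrary phase.\<close>

lemma unitary_commuting_with_generators_center:
  assumes V: "V \<in> carrier A" "adj A V \<otimes> V = \<one>" "V \<otimes> adj A V = \<one>"
    and comm: "\<And>i e. e \<in> E i \<Longrightarrow> V \<otimes> s e = s e \<otimes> V"
  shows "V \<in> center"
proof -
  have commW: "V \<otimes> mon u = mon u \<otimes> V" if "u \<in> W" for u
    using that
  proof (induction u rule: W_induct)
    case (Cons e i u)
    have "V \<otimes> (s e \<otimes> mon u) = s e \<otimes> (V \<otimes> mon u)"
      using s_closed[OF Cons(1)] Cons(2) V(1) comm[OF Cons(1)] by (simp flip: m_assoc)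
    then show ?case using Cons s_closed[OF Cons(1)] V(1) by (simp add: m_assoc)
  qed (use V in simp)
  have commadj: "V \<otimes> adj A (mon u) = adj A (mon u) \<otimes> V" if u: "u \<in> W" for u
  proof -
    have "adj A (mon u) \<otimes> adj A V = adj A V \<otimes> adj A (mon u)"
      using commW[OF u] u V(1) by (simp flip: adj_mult)
    then have "V \<otimes> (adj A (mon u) \<otimes> adj A V) \<otimes> V = V \<otimes> (adj A V \<otimes> adj A (mon u)) \<otimes> V" by simp
    moreover have "V \<otimes> (adj A (mon u) \<otimes> adj A V) \<otimes> V = V \<otimes> adj A (mon u) \<otimes> (adj A V \<otimes> V)"
      using u V(1) by (simp add: m_assoc)
    moreover have "V \<otimes> (adj A V \<otimes> adj A (mon u)) \<otimes> V = (V \<otimes> adj A V) \<otimes> (adj A (mon u) \<otimes> V)"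
      using u V(1) by (simp add: m_assoc)
    ultimately show ?thesis using u V by simp
  qed
  have span: "V \<otimes> x = x \<otimes> V" if "x \<in> linear_span mons" for x
    using that
  proof induction
    case (step x y c)
    obtain u v where uv: "u \<in> W" "v \<in> W" "x = mon u \<otimes> adj A (mon v)"
      using step by (auto simp: mons_def)
    have "V \<otimes> x = mon u \<otimes> (V \<otimes> adj A (mon v))"
      using uv V(1) commW[OF uv(1)] by (simp flip: m_assoc)
    also have "\<dots> = x \<otimes> V" using uv V(1) by (simp add: commadj m_assoc)
    finally show ?case
      using step V(1) span_mons_carrier[of y] uv
      by (simp add: l_distr r_distr smult_mult_left smult_mult_right)
  qed (use V in simp)
  have "V \<otimes> x = x \<otimes> V" if x: "x \<in> carrier A" for x
  proof -
    obtain f where f: "\<And>n. f n \<in> linear_span mons" "converges f x"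
      using norm_closure_seq[OF linear_span_carrier[OF mons_carrier] mons_dense[OF x]] by metis
    show ?thesis
      using converges_unique[OF converges_mult[OF converges_const[OF V(1)] f(2)]]
        converges_mult[OF f(2) converges_const[OF V(1)]] span[OF f(1)] by simp
  qed
  then show ?thesis using V by (simp add: center_def)
qed

text \<open>Both c^2 and (1 + c)^2 are scalar by \<open>simple_center_square_scalar\<close>, and
  they differ by 1 + 2 c.\<close>

lemma center_scalar:
  assumes c: "c \<in> center" "adj A c = c"
  obtains r where "c = r \<odot> \<one>"
proof -
  note D = star_subalgebraD[OF star_subalgebra_center]
  have cc: "c \<in> carrier A" using c D(1) by auto
  have 1: "c \<otimes> c = complex_of_real ((cnrm A c)\<^sup>2) \<odot> \<one>"
    using simple c by (rule simple_center_square_scalar)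
  have 2: "(\<one> \<oplus> c) \<otimes> (\<one> \<oplus> c) = complex_of_real ((cnrm A (\<one> \<oplus> c))\<^sup>2) \<odot> \<one>"
    using simple D c cc by (intro simple_center_square_scalar) (auto simp: adj_add)
  define b where "b = complex_of_real ((cnrm A (\<one> \<oplus> c))\<^sup>2)"
  define a where "a = complex_of_real ((cnrm A c)\<^sup>2)"
  have sq: "(\<one> \<oplus> c) \<otimes> (\<one> \<oplus> c) = (1 \<odot> \<one> \<oplus> a \<odot> \<one>) \<oplus> (c \<oplus> c)"
    using cc 1 by (simp add: l_distr r_distr a_ac a_def)
  have "(c \<oplus> c) = b \<odot> \<one> \<ominus> (1 + a) \<odot> \<one>"
  proof -
    have "Y \<oplus> X \<ominus> Y = X" if "X \<in> carrier A" "Y \<in> carrier A" for X Y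
      using that by (simp add: minus_eq a_comm[of Y X] a_assoc r_neg)
    from this[of "c \<oplus> c" "(1 + a) \<odot> \<one>"] show ?thesis
      using cc 2 sq by (simp add: b_def scalar_add)
  qed
  then have "(1 / 2) \<odot> (c \<oplus> c) = ((b - (1 + a)) / 2) \<odot> \<one>"
    by (simp add: scalar_left_diff[symmetric] scalar_mult)
  moreover have "(1 / 2) \<odot> (c \<oplus> c) = c"
    using cc by (simp add: scalar_distrib flip: scalar_add)
  ultimately show ?thesis using that by metis
qed

lemma m_ge_2: "m i \<ge> 2"
proof (rule ccontr)
  assume "\<not> m i \<ge> 2"
  then have "m i = 1" using m_pos[of i] by linarith
  then obtain e where Ei: "E i = {e}" by (auto simp: card_1_singleton_iff)
  then have e: "e \<in> E i" by simp
  note se = s_closed[OF e]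
  have unit: "adj A (s e) \<otimes> s e = \<one>" "s e \<otimes> adj A (s e) = \<one>"
    using s_orthogonal[OF e e] s_sum[of i] se by (simp_all add: Ei)
  define T where "T = s ` (\<Union>j. E j)"
  have Tc: "T \<subseteq> carrier A" by (auto simp: T_def)
  \<comment> \<open>By the commutation relations, conjugation by the unitary \<open>s e\<close> maps
    generators to generators. Being injective on this finite set, it has a power that is the
    identity there.\<close>
  define conj where "conj x = s e \<otimes> x \<otimes> adj A (s e)" for x
  have conj_T: "conj ` T \<subseteq> T"
  proof safe
    fix x assume "x \<in> T"
    then obtain f j where f: "f \<in> E j" "x = s f" by (auto simp: T_def)
    show "conj x \<in> T"
    proof (cases "j = i")
      case True
      then show ?thesis using f Ei unit se by (auto simp: conj_def T_def m_assoc)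
    next
      case False
      obtain f' e' where sw: "f' \<in> E j" "e' \<in> E i" "e \<otimes>\<^bsub>\<Lambda>\<^esub> f = f' \<otimes>\<^bsub>\<Lambda>\<^esub> e'"
        using edge_swap[OF e f(1)] .
      then have "s e \<otimes> s f = s f' \<otimes> s e'" using s_commute[of i j] e f False by auto
      then have "conj x = s f'"
        using sw(2) s_closed[OF sw(1)] se unit by (simp add: Ei conj_def f(2) m_assoc)
      then show ?thesis using sw(1) by (auto simp: T_def)
    qed
  qed
  have "inj_on conj T"
  proof (rule inj_onI)
    fix x y assume "x \<in> T" "y \<in> T" and eq: "conj x = conj y"
    then have c: "x \<in> carrier A" "y \<in> carrier A" using Tc by auto
    have "adj A (s e) \<otimes> conj z \<otimes> s e = z" if "z \<in> carrier A" for z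
    proof -
      have "adj A (s e) \<otimes> conj z \<otimes> s e = (adj A (s e) \<otimes> s e) \<otimes> z \<otimes> (adj A (s e) \<otimes> s e)"
        using se that by (simp add: conj_def m_assoc)
      then show ?thesis using unit that by simp
    qed
    then show "x = y" using eq c by metis
  qed
  moreover have "finite T" by (simp add: T_def)
  ultimately obtain n where n: "n > 0" "\<And>x. x \<in> T \<Longrightarrow> (conj ^^ n) x = x"
    using finite_inj_funpow_id[OF _ conj_T] by metis
  define V where "V = mon (replicate n e)"
  have rW: "replicate k e \<in> W" for k by (induction k) (use e in \<open>auto simp: W_Cons\<close>)
  have V: "V \<in> carrier A" "adj A V \<otimes> V = \<one>" using rW mon_isometry[OF rW] by (auto simp: V_def)
  have unitk: "mon (replicate k e) \<otimes> adj A (mon (replicate k e)) = \<one>" for k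
  proof (induction k)
    case (Suc k)
    have "mon (replicate (Suc k) e) \<otimes> adj A (mon (replicate (Suc k) e))
        = s e \<otimes> (mon (replicate k e) \<otimes> adj A (mon (replicate k e))) \<otimes> adj A (s e)"
      using se rW[of k] by (simp add: adj_mult m_assoc)
    then show ?case using Suc unit se by simp
  qed simp
  have conjk: "(conj ^^ k) x = mon (replicate k e) \<otimes> x \<otimes> adj A (mon (replicate k e))" if "x \<in> carrier A" for k x
  proof (induction k)
    case (Suc k)
    then show ?case using se rW[of k] that by (simp add: conj_def adj_mult m_assoc)
  qed (use that in simp)
  have "V \<otimes> s f = s f \<otimes> V" if f: "f \<in> E j" for f j
  proof -
    have "V \<otimes> s f \<otimes> adj A V = s f" using n(2)[of "s f"] conjk[of "s f" n] f by (auto simp: V_def T_def)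
    then have "V \<otimes> s f \<otimes> (adj A V \<otimes> V) = s f \<otimes> V"
      using V(1) s_closed[OF f] by (simp flip: m_assoc)
    then show ?thesis using V s_closed[OF f] by simp
  qed
  then have Vz: "V \<in> center"
    using V unitk[of n] by (intro unitary_commuting_with_generators_center) (auto simp: V_def)
  have "V \<oplus> adj A V \<in> center" "adj A (V \<oplus> adj A V) = V \<oplus> adj A V"
    using star_subalgebraD[OF star_subalgebra_center] Vz V by (auto simp: adj_add a_comm)
  then obtain r where r: "V \<oplus> adj A V = r \<odot> \<one>" using center_scalar by metis
  have phase_rep: "phase z (deg (replicate k e)) = z i ^ k" for z k
    by (induction k) (simp_all add: phase_add edge_degree[OF e])
  \<comment> \<open>\<open>V\<close> is the \<open>n\<close>-th power of \<open>s e\<close>, so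
    rotating all generators by the angle \<theta> / n multiplies \<open>V\<close> by
    \<open>cis \<theta>\<close>, while the scalar \<open>r \<odot> \<one>\<close> does not
    move.\<close>
  have rot: "c \<odot> V \<oplus> cnj c \<odot> adj A V = r \<odot> \<one>" if "c = cis (\<theta> / real n) ^ n" for c \<theta>
  proof -
    let ?z = "\<lambda>_ :: 'k. cis (\<theta> / real n)"
    note H = star_homD[OF rotation_props(2)[of ?z]]
    have "rotation ?z V = c \<odot> V" using rotation_mon[of ?z "replicate n e"] rW that by (simp add: V_def phase_rep)
    moreover have "rotation ?z (V \<oplus> adj A V) = r \<odot> \<one>" unfolding r using H by simp
    ultimately show ?thesis using H V by (simp add: adj_smult)
  qed
  have cis: "cis (\<theta> / real n) ^ n = cis \<theta>" for \<theta> using n(1) Complex.DeMoivre[of "\<theta> / real n" n] by simp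
  \<comment> \<open>The phase -1 changes the sign of \<open>V \<oplus> adj A V\<close>, which is
    therefore zero.\<close>
  have "\<ominus> (V \<oplus> adj A V) = (- 1) \<odot> V \<oplus> cnj (- 1) \<odot> adj A V"
    using V by (simp add: scalar_minus minus_add)
  also have "\<dots> = V \<oplus> adj A V"
    unfolding r using cis[of pi] by (intro rot[of "- 1" pi]) simp
  finally have "V \<oplus> adj A V \<oplus> (V \<oplus> adj A V) = \<zero>" using V by (metis adj_closed a_closed r_neg)
  then have "2 \<odot> (r \<odot> \<one>) = \<zero>" using scalar_add[of "r \<odot> \<one>" 1 1] r by simp
  then have "r = 0" using cnrm_smult[of \<one> "2 * r"] by (simp add: scalar_mult norm_mult)
  then have 1: "V \<oplus> adj A V = \<zero>" using r by simp
  \<comment> \<open>The phase i gives \<open>V = adj A V\<close>; together with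
    \<open>V \<oplus> adj A V = \<zero>\<close> this forces \<open>V = \<zero>\<close>.\<close>
  have "\<i> \<odot> V \<oplus> (- \<i>) \<odot> adj A V = \<zero>"
    using rot[of \<i> "pi / 2"] cis[of "pi / 2"] \<open>r = 0\<close> by simp
  then have "(- \<i>) \<odot> (\<i> \<odot> V \<oplus> (- \<i>) \<odot> adj A V) = \<zero>" by simp
  then have "V \<oplus> (- 1) \<odot> adj A V = \<zero>" using V by (simp add: scalar_distrib scalar_mult)
  then have "(V \<oplus> adj A V) \<oplus> (V \<oplus> (- 1) \<odot> adj A V) = \<zero>" using 1 by simp
  then have "2 \<odot> V = \<zero>"
    using V scalar_add[of V 1 1] by (simp add: scalar_minus a_ac r_neg r_neg1 r_neg2)
  then have "(1 / 2) \<odot> (2 \<odot> V) = \<zero>" by simp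
  then have "V = \<zero>" using V by (simp add: scalar_mult)
  then show False using V one_neq_zero by simp
qed

section \<open>The fixed point algebra\<close>

lemma orthogonal_isometries:
  obtains v w where "v \<in> carrier A" "adj A v \<otimes> v = \<one>" "w \<in> carrier A" "adj A w \<otimes> w = \<one>"
    "adj A v \<otimes> w = \<zero>"
proof -
  \<comment> \<open>Types are nonempty, so there is at least one color; two of its edges give the
    isometries.\<close>
  fix i :: 'k
  have "\<not> m i \<le> Suc 0" using m_ge_2[of i] by linarith
  then obtain e f where "e \<in> E i" "f \<in> E i" "e \<noteq> f"
    unfolding card_le_Suc0_iff_eq[OF finite_E] by blast
  then show ?thesis
    using that[of "s e" "s f"] s_orthogonal[of _ i] s_closed[of _ i] by auto
qed

lemma rotation_contractive:
  assumes "\<And>i. cmod (z i) = 1" "x \<in> carrier A"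
  shows "cnrm A (rotation z x) \<le> cnrm A x"
proof -
  obtain v w where "v \<in> carrier A" "adj A v \<otimes> v = \<one>" "w \<in> carrier A" "adj A w \<otimes> w = \<one>"
    "adj A v \<otimes> w = \<zero>" using orthogonal_isometries .
  then show ?thesis
    using star_hom_contractive[OF cstar_algebra_axioms cstar_algebra_axioms rotation_props(2)[of z]] assms
    by blast
qed

section \<open>The action \<open>sigma\<close> as a family of rotations\<close>

definition flow :: "real \<Rightarrow> 'k \<Rightarrow> complex" where
  "flow t i = cis (- t * ln (real (m i)))"

text \<open>The logarithm of m^p, while \<open>flow t i\<close> is m_i to the power -it. Thus
  \<open>s_u\<close> acquires the phase m^(-it d(u)), and \<open>log_deg\<close> agrees on two
  degrees p and q exactly if m^p = m^q.\<close>

definition log_deg :: "nat ^ 'k \<Rightarrow> real" where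
  "log_deg p = (\<Sum>i\<in>UNIV. real (p $ i) * ln (real (m i)))"

lemma cmod_flow [simp]: "cmod (flow t i) = 1"
  by (simp add: flow_def)

lemma phase_flow: "phase (flow t) p = cis (- t * log_deg p)"
proof -
  have "phase (flow t) p = (\<Prod>i\<in>UNIV. exp (\<i> * complex_of_real (real (p $ i) * (- t * ln (real (m i))))))"
    unfolding phase_def flow_def Complex.DeMoivre by (simp only: cis_conv_exp)
  also have "\<dots> = exp (\<Sum>i\<in>UNIV. \<i> * complex_of_real (real (p $ i) * (- t * ln (real (m i)))))"
    by (simp only: exp_sum finite)
  also have "(\<Sum>i\<in>UNIV. \<i> * complex_of_real (real (p $ i) * (- t * ln (real (m i)))))
      = \<i> * complex_of_real (- t * log_deg p)"
    by (simp add: log_deg_def sum_distrib_left sum_negf mult_ac)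
  finally show ?thesis by (simp add: cis_conv_exp)
qed

lemma edge_pow_exp: "edge_pow \<Lambda> d g = exp (\<Sum>i\<in>UNIV. real_of_int (g $ i) * ln (real (m i)))"
  unfolding edge_pow_def exp_sum[OF finite]
proof (rule prod.cong)
  fix i
  have pos: "real (m i) > 0" using m_pos[of i] by linarith
  then have "real (m i) powi (g $ i) = real (m i) powr real_of_int (g $ i)"
    by (intro powr_real_of_int'[symmetric]) linarith+
  also have "\<dots> = exp (real_of_int (g $ i) * ln (real (m i)))"
    unfolding powr_def using pos by (metis less_irrefl)
  finally show "real (m i) powi (g $ i) = exp (real_of_int (g $ i) * ln (real (m i)))" .
qed simp

lemma edge_pow_word_degree:
  assumes "u \<in> W" "v \<in> W"
  shows "edge_pow \<Lambda> d (word_degree \<Lambda> d v - word_degree \<Lambda> d u) = exp (log_deg (deg v) - log_deg (deg u))"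
proof -
  have "word_degree \<Lambda> d w $ i = int (deg w $ i)" if "w \<in> W" for w i
    using word_prod_degree[OF that] by (simp add: word_degree_def)
  then show ?thesis
    using assms by (simp add: edge_pow_exp log_deg_def left_diff_distrib sum_subtractf)
qed

text \<open>The base of the complex power is exp S with S real, so the principal logarithm returns S
  and the power is \<open>cis (t * S)\<close>.\<close>

lemma flow_coefficient:
  assumes "u \<in> W" "v \<in> W"
  shows "complex_of_real (edge_pow \<Lambda> d (word_degree \<Lambda> d v - word_degree \<Lambda> d u)) powr (\<i> * complex_of_real t)
    = phase (flow t) (deg u) * cnj (phase (flow t) (deg v))"
proof -
  define S where "S = log_deg (deg v) - log_deg (deg u)"
  have "complex_of_real (exp S) powr (\<i> * complex_of_real t) = exp (\<i> * complex_of_real (t * S))"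
    by (simp add: powr_def Ln_of_real mult_ac del: of_real_exp)
  also have "\<dots> = cis (t * S)" by (simp add: cis_conv_exp)
  also have "\<dots> = phase (flow t) (deg u) * cnj (phase (flow t) (deg v))"
    by (simp add: phase_flow cis_cnj cis_mult S_def algebra_simps)
  finally show ?thesis using edge_pow_word_degree[OF assms] by (simp add: S_def)
qed

text \<open>The values prescribed on monomials include those on generators, namely for
  \<open>u = [e]\<close> and \<open>v = []\<close>, and a homomorphism is determined by them. So the
  definite description picks this rotation.\<close>

lemma sigma_eq: "sigma \<Lambda> d A s t = rotation (flow t)"
  unfolding sigma_def
proof (rule the_equality)
  show "rotation (flow t) \<in> extensional (carrier A) \<and> star_automorphism A (rotation (flow t)) \<and>
     (\<forall>u\<in>edge_words \<Lambda> d. \<forall>v\<in>edge_words \<Lambda> d.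
        let x = word_prod A (map s u) \<otimes> adj A (word_prod A (map s v))
        in rotation (flow t) x = (complex_of_real (edge_pow \<Lambda> d (word_degree \<Lambda> d v - word_degree \<Lambda> d u))
                    powr (\<i> * complex_of_real t)) \<odot> x)"
  proof (intro conjI ballI)
    show "rotation (flow t) \<in> extensional (carrier A)" by (rule rotation_props) simp
    show "star_automorphism A (rotation (flow t))" by (rule rotation_automorphism) simp
    fix u v assume "u \<in> edge_words \<Lambda> d" "v \<in> edge_words \<Lambda> d"
    then have uv: "u \<in> W" "v \<in> W" by (simp_all add: W_def)
    show "let x = word_prod A (map s u) \<otimes> adj A (word_prod A (map s v))
        in rotation (flow t) x = (complex_of_real (edge_pow \<Lambda> d (word_degree \<Lambda> d v - word_degree \<Lambda> d u))
                    powr (\<i> * complex_of_real t)) \<odot> x"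
      unfolding Let_def mon_def[symmetric] flow_coefficient[OF uv] by (rule rotation_monomial[OF _ uv]) simp
  qed
  fix \<phi>
  assume \<phi>: "\<phi> \<in> extensional (carrier A) \<and> star_automorphism A \<phi> \<and>
     (\<forall>u\<in>edge_words \<Lambda> d. \<forall>v\<in>edge_words \<Lambda> d.
        let x = word_prod A (map s u) \<otimes> adj A (word_prod A (map s v))
        in \<phi> x = (complex_of_real (edge_pow \<Lambda> d (word_degree \<Lambda> d v - word_degree \<Lambda> d u))
                    powr (\<i> * complex_of_real t)) \<odot> x)"
  have mon: "\<phi> (mon u \<otimes> adj A (mon v))
      = (phase (flow t) (deg u) * cnj (phase (flow t) (deg v))) \<odot> (mon u \<otimes> adj A (mon v))"
    if "u \<in> W" "v \<in> W" for u v
    using \<phi> that flow_coefficient[OF that, of t] unfolding Let_def W_def[symmetric] mon_def[symmetric]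
    by metis
  have gen: "\<phi> (s e) = flow t i \<odot> s e" if e: "e \<in> E i" for e i
  proof -
    have "[e] \<in> W" using e by (auto simp: W_Cons)
    then show ?thesis using mon[of "[e]" "[]"] s_closed[OF e] edge_degree[OF e] by simp
  qed
  show "\<phi> = rotation (flow t)"
  proof (rule extensionalityI)
    show "\<phi> \<in> extensional (carrier A)" using \<phi> by simp
    show "rotation (flow t) \<in> extensional (carrier A)" by (rule rotation_props) simp
    have hom: "star_hom A A \<phi>" using \<phi> by (simp add: star_automorphism_def)
    show "\<phi> x = rotation (flow t) x" if "x \<in> carrier A" for x
      by (rule rotation_unique[of "flow t", OF cmod_flow hom rotation_props(2)[of "flow t", OF cmod_flow] gen
            rotation_props(3)[of "flow t", OF cmod_flow] that])
  qed
qed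

definition M :: "'a set" where "M = {a \<in> carrier A. \<forall>t. rotation (flow t) a = a}"

lemma fixed_point_algebra_eq: "fixed_point_algebra \<Lambda> d A s = A\<lparr>carrier := M\<rparr>"
  by (simp add: fixed_point_algebra_def M_def sigma_eq)

lemmas flow_hom = star_homD[OF rotation_props(2)[of "flow t" for t, OF cmod_flow]]

lemma star_subalgebra_M: "star_subalgebra M"
  by (auto simp: star_subalgebra_def M_def flow_hom)

lemma M_carrier: "x \<in> M \<Longrightarrow> x \<in> carrier A"
  by (simp add: M_def)

text \<open>Limits of fixed points are fixed because rotations are contractive, which in turn rests
  on the two orthogonal isometries.\<close>

lemma seq_closed_M: "seq_closed M"
  unfolding seq_closed_def
proof (intro allI impI, elim conjE)
  fix f x assume f: "range f \<subseteq> M" and x: "converges f x"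
  note c = converges_carrier[OF x]
  have fM: "rotation (flow t) (f n) = f n" for t n using f by (auto simp: M_def)
  have "rotation (flow t) x = x" for t
  proof -
    have "converges f (rotation (flow t) x)"
    proof (rule convergesI)
      fix n
      have "f n \<ominus> rotation (flow t) x = rotation (flow t) (f n \<ominus> x)"
        using fM[of t n] c by (simp add: minus_eq minus_eq_scalar flow_hom)
      then show "cnrm A (f n \<ominus> rotation (flow t) x) \<le> cnrm A (f n \<ominus> x)"
        using rotation_contractive[of "flow t" "f n \<ominus> x"] c by simp
    qed (use c x flow_hom in \<open>auto simp: converges_def\<close>)
    then show ?thesis using converges_unique x by blast
  qed
  then show "x \<in> M" using c by (simp add: M_def)
qed

lemma cstar_algebra_M: "cstar_algebra (A\<lparr>carrier := M\<rparr>)"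
  using star_subalgebra_M seq_closed_M by (rule cstar_algebra_star_subalgebra)

section \<open>Density of the fixed monomials in \<open>M\<close>\<close>

definition fixed_mons :: "'a set" where
  "fixed_mons = {mon u \<otimes> adj A (mon v) | u v. u \<in> W \<and> v \<in> W \<and> log_deg (deg u) = log_deg (deg v)}"

lemma fixed_mons_carrier: "fixed_mons \<subseteq> carrier A"
  by (auto simp: fixed_mons_def)

lemma flow_monomial:
  assumes "u \<in> W" "v \<in> W"
  shows "rotation (flow t) (mon u \<otimes> adj A (mon v))
      = cis (t * (log_deg (deg v) - log_deg (deg u))) \<odot> (mon u \<otimes> adj A (mon v))"
  using assms by (simp add: rotation_monomial phase_flow cis_cnj cis_mult algebra_simps)

lemma fixed_mons_M: "fixed_mons \<subseteq> M"
  by (auto simp: fixed_mons_def M_def flow_monomial)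

lemma linear_span_fixed_mons_M: "x \<in> linear_span fixed_mons \<Longrightarrow> x \<in> M"
proof (induction rule: linear_span.induct)
  case (step x y c)
  then show ?case using fixed_mons_M star_subalgebraD[OF star_subalgebra_M] by auto
qed (use star_subalgebraD[OF star_subalgebra_M] in auto)

text \<open>The mean of the identity and a suitable \<open>\<sigma>\<^sub>t\<close> kills a given monomial outside \<open>M\<close>, fixes \<open>M\<close>
  pointwise and is contractive. This replaces averaging over the whole flow.\<close>

definition flow_mean :: "real \<Rightarrow> 'a \<Rightarrow> 'a" where
  "flow_mean t x = (1 / 2) \<odot> (x \<oplus> rotation (flow t) x)"

definition flow_means :: "real list \<Rightarrow> 'a \<Rightarrow> 'a" where "flow_means ts = foldr flow_mean ts"

lemma flow_mean_closed: "x \<in> carrier A \<Longrightarrow> flow_mean t x \<in> carrier A"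
  by (simp add: flow_mean_def flow_hom)

lemma flow_mean_linear:
  assumes "x \<in> carrier A" "y \<in> carrier A"
  shows "flow_mean t (c \<odot> x \<oplus> y) = c \<odot> flow_mean t x \<oplus> flow_mean t y"
proof -
  note xy = assms flow_hom(1)[OF assms(1), of t] flow_hom(1)[OF assms(2), of t]
  have "flow_mean t (c \<odot> x \<oplus> y) = (1 / 2) \<odot> ((c \<odot> x \<oplus> y) \<oplus> (c \<odot> rotation (flow t) x \<oplus> rotation (flow t) y))"
    using assms by (simp add: flow_mean_def flow_hom)
  also have "(c \<odot> x \<oplus> y) \<oplus> (c \<odot> rotation (flow t) x \<oplus> rotation (flow t) y)
     = (c \<odot> x \<oplus> c \<odot> rotation (flow t) x) \<oplus> (y \<oplus> rotation (flow t) y)"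
    using xy by (simp add: a_ac)
  also have "(1 / 2) \<odot> \<dots> = c \<odot> flow_mean t x \<oplus> flow_mean t y"
    using xy by (simp add: flow_mean_def scalar_distrib scalar_mult mult.commute)
  finally show ?thesis .
qed

lemma flow_mean_contractive:
  assumes "x \<in> carrier A"
  shows "cnrm A (flow_mean t x) \<le> cnrm A x"
  using cnrm_triangle[of x "rotation (flow t) x"] rotation_contractive[of "flow t" x] assms
  by (simp add: flow_mean_def cnrm_smult flow_hom)

lemma flow_mean_M: "x \<in> M \<Longrightarrow> flow_mean t x = x"
  by (simp add: flow_mean_def M_def scalar_distrib flip: scalar_add)

lemma flow_means_closed: "x \<in> carrier A \<Longrightarrow> flow_means ts x \<in> carrier A"
  by (induction ts) (auto simp: flow_means_def flow_mean_closed)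

lemma flow_means_linear:
  "x \<in> carrier A \<Longrightarrow> y \<in> carrier A \<Longrightarrow> flow_means ts (c \<odot> x \<oplus> y) = c \<odot> flow_means ts x \<oplus> flow_means ts y"
  by (induction ts) (use flow_means_closed in \<open>auto simp: flow_means_def flow_mean_linear\<close>)

lemma flow_means_contractive: "x \<in> carrier A \<Longrightarrow> cnrm A (flow_means ts x) \<le> cnrm A x"
proof (induction ts)
  case (Cons t ts)
  then show ?case
    using flow_mean_contractive[OF flow_means_closed[OF Cons(2), of ts], of t] by (simp add: flow_means_def)
qed (simp add: flow_means_def)

lemma flow_means_M: "x \<in> M \<Longrightarrow> flow_means ts x = x"
  by (induction ts) (auto simp: flow_means_def flow_mean_M)

lemma flow_means_monomial:
  assumes "u \<in> W" "v \<in> W"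
  shows "\<exists>c. flow_means ts (mon u \<otimes> adj A (mon v)) = c \<odot> (mon u \<otimes> adj A (mon v))"
proof (induction ts)
  case Nil
  then show ?case using assms by (intro exI[of _ 1]) (simp add: flow_means_def)
next
  case (Cons t ts)
  define x where "x = mon u \<otimes> adj A (mon v)"
  have x: "x \<in> carrier A" using assms by (simp add: x_def)
  obtain c where c: "flow_means ts x = c \<odot> x" using Cons by (auto simp: x_def)
  obtain k where "rotation (flow t) x = k \<odot> x" using flow_monomial[OF assms] x_def by blast
  then have "flow_means (t # ts) x = (1 / 2) \<odot> (c \<odot> x \<oplus> (c * k) \<odot> x)"
    using c x by (simp add: flow_means_def flow_mean_def flow_hom scalar_mult)
  also have "\<dots> = (1 / 2 * (c + c * k)) \<odot> x"
    using x by (simp only: scalar_add[symmetric] scalar_mult)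
  finally have "flow_means (t # ts) x = (1 / 2 * (c + c * k)) \<odot> x" .
  then show ?case by (auto simp: x_def)
qed

text \<open>The times found for the shorter combination only scale the new monomial. If it is not
  fixed, one further time kills it and leaves the rest alone, since the rest already lies in
  \<open>M\<close>.\<close>

lemma flow_means_into_span_fixed_mons:
  assumes "a \<in> linear_span mons"
  shows "\<exists>ts. flow_means ts a \<in> linear_span fixed_mons"
  using assms
proof induction
  case zero
  then show ?case by (intro exI[of _ "[]"]) (simp add: flow_means_def linear_span.zero)
next
  case (step x y c)
  then obtain ts where ts: "flow_means ts y \<in> linear_span fixed_mons" by auto
  obtain u v where uv: "u \<in> W" "v \<in> W" "x = mon u \<otimes> adj A (mon v)"
    using step(1) by (auto simp: mons_def)
  have xy: "x \<in> carrier A" "y \<in> carrier A" using uv step(2) span_mons_carrier by auto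
  obtain k where k: "flow_means ts x = k \<odot> x" using flow_means_monomial[OF uv(1,2)] uv(3) by blast
  have eq: "flow_means ts (c \<odot> x \<oplus> y) = (c * k) \<odot> x \<oplus> flow_means ts y"
    using xy k by (simp add: flow_means_linear scalar_mult)
  show ?case
  proof (cases "log_deg (deg u) = log_deg (deg v)")
    case True
    then have "x \<in> fixed_mons" using uv by (auto simp: fixed_mons_def)
    then show ?thesis using eq ts linear_span.step by metis
  next
    case False
    \<comment> \<open>At this time the phase of \<open>x\<close> is exp(i pi) = -1.\<close>
    define t where "t = pi / (log_deg (deg v) - log_deg (deg u))"
    have "rotation (flow t) x = \<ominus> x"
      using False uv xy by (simp add: flow_monomial t_def scalar_minus)
    then have "flow_mean t x = \<zero>" using xy by (simp add: flow_mean_def r_neg)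
    then have "flow_means (t # ts) (c \<odot> x \<oplus> y) = flow_means ts y"
      using eq xy flow_means_closed[of y ts] flow_mean_linear[of x "flow_means ts y" t "c * k"]
        flow_mean_M[OF linear_span_fixed_mons_M[OF ts]]
      by (simp add: flow_means_def)
    then show ?thesis using ts by metis
  qed
qed

text \<open>Flow means leave \<open>x\<close> alone, contract the error of an approximation by
  monomials and, suitably chosen, carry the approximant into the span of the fixed
  monomials.\<close>

lemma M_subset_closure: "M \<subseteq> norm_closure (linear_span fixed_mons)"
proof
  fix x assume x: "x \<in> M"
  note xc = M_carrier[OF x]
  have "\<exists>b\<in>linear_span fixed_mons. cnrm A (x \<ominus> b) < e" if "e > 0" for e
  proof -
    obtain a where a: "a \<in> linear_span mons" "cnrm A (x \<ominus> a) < e"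
      using mons_dense[OF xc] \<open>e > 0\<close> by (auto simp: norm_closure_def)
    note ac = span_mons_carrier[OF a(1)]
    obtain ts where ts: "flow_means ts a \<in> linear_span fixed_mons"
      using flow_means_into_span_fixed_mons[OF a(1)] by blast
    have "flow_means ts ((- 1) \<odot> a \<oplus> x) = (- 1) \<odot> flow_means ts a \<oplus> flow_means ts x"
      using ac xc by (rule flow_means_linear)
    then have "flow_means ts (x \<ominus> a) = x \<ominus> flow_means ts a"
      using ac xc flow_means_closed[OF ac, of ts] flow_means_M[OF x] by (simp add: scalar_minus minus_eq a_comm)
    then have "cnrm A (x \<ominus> flow_means ts a) \<le> cnrm A (x \<ominus> a)"
      using flow_means_contractive[of "x \<ominus> a" ts] ac xc by simp
    then show ?thesis using ts a(2) by (meson le_less_trans)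
  qed
  then show "x \<in> norm_closure (linear_span fixed_mons)" using xc by (simp add: norm_closure_def)
qed

section \<open>The averaging maps and the mean\<close>

definition Psi :: "'k \<Rightarrow> 'a \<Rightarrow> 'a" where
  "Psi i a = (1 / of_nat (m i)) \<odot> (\<Oplus>e\<in>E i. adj A (s e) \<otimes> a \<otimes> s e)"

lemma Psi_terms: "a \<in> carrier A \<Longrightarrow> (\<lambda>e. adj A (s e) \<otimes> a \<otimes> s e) \<in> E i \<rightarrow> carrier A"
  by auto

lemma Psi_closed [simp]: "a \<in> carrier A \<Longrightarrow> Psi i a \<in> carrier A"
  using Psi_terms by (simp add: Psi_def finsum_closed)

lemma Psi_add:
  assumes "a \<in> carrier A" "b \<in> carrier A"
  shows "Psi i (a \<oplus> b) = Psi i a \<oplus> Psi i b"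
proof -
  have "(\<Oplus>e\<in>E i. adj A (s e) \<otimes> (a \<oplus> b) \<otimes> s e)
      = (\<Oplus>e\<in>E i. adj A (s e) \<otimes> a \<otimes> s e \<oplus> adj A (s e) \<otimes> b \<otimes> s e)"
    using assms by (intro finsum_cong') (auto simp: l_distr r_distr s_closed)
  then show ?thesis
    using assms Psi_terms by (simp add: Psi_def finsum_addf scalar_distrib finsum_closed)
qed

lemma Psi_scalar:
  assumes "a \<in> carrier A"
  shows "Psi i (c \<odot> a) = c \<odot> Psi i a"
proof -
  have "(\<Oplus>e\<in>E i. adj A (s e) \<otimes> (c \<odot> a) \<otimes> s e) = (\<Oplus>e\<in>E i. c \<odot> (adj A (s e) \<otimes> a \<otimes> s e))"
    using assms by (intro finsum_cong') (auto simp: smult_mult_left smult_mult_right s_closed)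
  then show ?thesis
    using assms Psi_terms by (simp add: Psi_def scalar_mult finsum_closed mult.commute flip: scalar_finsum)
qed

lemma Psi_adj:
  assumes "a \<in> carrier A"
  shows "Psi i (adj A a) = adj A (Psi i a)"
proof -
  have "(\<Oplus>e\<in>E i. adj A (s e) \<otimes> adj A a \<otimes> s e) = (\<Oplus>e\<in>E i. adj A (adj A (s e) \<otimes> a \<otimes> s e))"
    using assms by (intro finsum_cong') (auto simp: adj_mult m_assoc s_closed)
  then show ?thesis
    using assms Psi_terms by (simp add: Psi_def adj_smult finsum_closed adj_finsum)
qed

lemma Psi_one: "Psi i \<one> = \<one>"
proof -
  have "(\<Oplus>e\<in>E i. adj A (s e) \<otimes> \<one> \<otimes> s e) = (\<Oplus>e\<in>E i. \<one>)"
    by (intro finsum_cong') (auto simp: s_orthogonal s_closed)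
  moreover have "E i \<noteq> {}" using m_pos[of i] by auto
  ultimately show ?thesis
    by (simp add: Psi_def finsum_constant scalar_mult)
qed

lemma Psi_contractive:
  assumes "a \<in> carrier A"
  shows "cnrm A (Psi i a) \<le> cnrm A a"
proof -
  have "cnrm A (adj A (s e) \<otimes> a \<otimes> s e) \<le> cnrm A a" if e: "e \<in> E i" for e
  proof -
    note se = s_closed[OF e] cnrm_s_le[OF e]
    have "cnrm A (adj A (s e) \<otimes> a \<otimes> s e) \<le> cnrm A (adj A (s e) \<otimes> a) * cnrm A (s e)"
      using se assms by (simp add: cnrm_mult)
    also have "\<dots> \<le> (cnrm A (s e) * cnrm A a) * cnrm A (s e)"
      using se assms cnrm_mult[of "adj A (s e)" a] by (intro mult_right_mono) (auto simp: cnrm_nonneg)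
    also have "\<dots> \<le> (1 * cnrm A a) * 1"
      using se assms by (intro mult_mono) (auto simp: cnrm_nonneg)
    finally show ?thesis by simp
  qed
  then have "(\<Sum>e\<in>E i. cnrm A (adj A (s e) \<otimes> a \<otimes> s e)) \<le> (\<Sum>e\<in>E i. cnrm A a)"
    by (intro sum_mono)
  then have "cnrm A (\<Oplus>e\<in>E i. adj A (s e) \<otimes> a \<otimes> s e) \<le> real (m i) * cnrm A a"
    using cnrm_finsum[OF finite_E Psi_terms[OF assms], of i] by simp
  then show ?thesis
    using m_pos[of i] Psi_terms[OF assms, of i]
    by (simp add: Psi_def cnrm_smult norm_divide finsum_closed divide_le_eq mult.commute)
qed

text \<open>Orthogonality leaves only the term of \<open>e\<close>: a front letter goes to the end
  of the product at the price of a factor 1/m_i. The decay of monomials, their cancellation and the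
  trace property all start from this.\<close>

lemma Psi_s_mult:
  assumes e: "e \<in> E i" and z: "z \<in> carrier A"
  shows "Psi i (s e \<otimes> z) = (1 / of_nat (m i)) \<odot> (z \<otimes> s e)"
proof -
  note se = s_closed[OF e]
  have "(\<Oplus>f\<in>E i. adj A (s f) \<otimes> (s e \<otimes> z) \<otimes> s f) = (\<Oplus>f\<in>E i. if e = f then z \<otimes> s f else \<zero>)"
  proof (rule finsum_cong')
    fix f assume f: "f \<in> E i"
    have "adj A (s f) \<otimes> (s e \<otimes> z) \<otimes> s f = (adj A (s f) \<otimes> s e) \<otimes> z \<otimes> s f"
      using se s_closed[OF f] z by (simp add: m_assoc)
    then show "adj A (s f) \<otimes> (s e \<otimes> z) \<otimes> s f = (if e = f then z \<otimes> s f else \<zero>)"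
      using s_orthogonal[OF f e] s_closed[OF f] z by auto
  qed (use z in auto)
  also have "\<dots> = z \<otimes> s e"
    using e z by (intro finsum_singleton) auto
  finally show ?thesis by (simp add: Psi_def)
qed

lemma Psi_Psi:
  assumes a: "a \<in> carrier A"
  shows "Psi i (Psi j a) = (1 / of_nat (m i * m j)) \<odot>
      (\<Oplus>e\<in>E i. \<Oplus>f\<in>E j. adj A (s f \<otimes> s e) \<otimes> a \<otimes> (s f \<otimes> s e))"
proof -
  have 1: "adj A (s e) \<otimes> Psi j a \<otimes> s e = (1 / of_nat (m j)) \<odot>
      (\<Oplus>f\<in>E j. adj A (s f \<otimes> s e) \<otimes> a \<otimes> (s f \<otimes> s e))" if e: "e \<in> E i" for e
  proof -
    note se = s_closed[OF e] and T = Psi_terms[OF a, of j]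
    have T': "(\<lambda>f. adj A (s e) \<otimes> (adj A (s f) \<otimes> a \<otimes> s f)) \<in> E j \<rightarrow> carrier A" using T se by auto
    have "adj A (s e) \<otimes> Psi j a \<otimes> s e
        = (1 / of_nat (m j)) \<odot> (\<Oplus>f\<in>E j. adj A (s e) \<otimes> (adj A (s f) \<otimes> a \<otimes> s f) \<otimes> s e)"
      using se T T'
      by (simp add: Psi_def smult_mult_left smult_mult_right finsum_closed finsum_rdistr finsum_ldistr)
    also have "(\<Oplus>f\<in>E j. adj A (s e) \<otimes> (adj A (s f) \<otimes> a \<otimes> s f) \<otimes> s e)
        = (\<Oplus>f\<in>E j. adj A (s f \<otimes> s e) \<otimes> a \<otimes> (s f \<otimes> s e))"
      using se a by (intro finsum_cong') (auto simp: adj_mult m_assoc s_closed)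
    finally show ?thesis .
  qed
  have c: "(\<lambda>e. \<Oplus>f\<in>E j. adj A (s f \<otimes> s e) \<otimes> a \<otimes> (s f \<otimes> s e)) \<in> E i \<rightarrow> carrier A"
    using a by (auto intro!: finsum_closed s_closed)
  have "(\<Oplus>e\<in>E i. adj A (s e) \<otimes> Psi j a \<otimes> s e) = (\<Oplus>e\<in>E i. (1 / of_nat (m j)) \<odot>
      (\<Oplus>f\<in>E j. adj A (s f \<otimes> s e) \<otimes> a \<otimes> (s f \<otimes> s e)))"
    using 1 c by (intro finsum_cong') auto
  then show ?thesis
    using c by (simp add: Psi_def[of i] scalar_mult finsum_closed flip: scalar_finsum)
qed

text \<open>Both compositions average \<open>adj A w \<otimes> a \<otimes> w\<close> over products
  \<open>w\<close> of two generators, one of each color. By unique factorization every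
  \<open>f e\<close> is exactly one \<open>e' f'\<close>, so the same \<open>w\<close> occur on both
  sides.\<close>

lemma Psi_commute:
  assumes a: "a \<in> carrier A"
  shows "Psi i (Psi j a) = Psi j (Psi i a)"
proof (cases "i = j")
  case False
  have "\<exists>p. fst p \<in> E j \<and> snd p \<in> E i \<and> snd q \<otimes>\<^bsub>\<Lambda>\<^esub> fst q = snd p \<otimes>\<^bsub>\<Lambda>\<^esub> fst p" if q: "q \<in> E i \<times> E j" for q
  proof -
    obtain e' f' where "e' \<in> E i" "f' \<in> E j" "snd q \<otimes>\<^bsub>\<Lambda>\<^esub> fst q = e' \<otimes>\<^bsub>\<Lambda>\<^esub> f'"
      using edge_swap[of "snd q" j "fst q" i] q by (auto simp: mem_Times_iff)
    then show ?thesis by (intro exI[of _ "(f', e')"]) simp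
  qed
  then obtain g where g: "\<And>q. q \<in> E i \<times> E j \<Longrightarrow> fst (g q) \<in> E j \<and> snd (g q) \<in> E i \<and>
      snd q \<otimes>\<^bsub>\<Lambda>\<^esub> fst q = snd (g q) \<otimes>\<^bsub>\<Lambda>\<^esub> fst (g q)"
    by metis
  have "inj_on g (E i \<times> E j)"
  proof (rule inj_onI)
    fix q r assume q: "q \<in> E i \<times> E j" and r: "r \<in> E i \<times> E j" and eq: "g q = g r"
    then have "snd q \<otimes>\<^bsub>\<Lambda>\<^esub> fst q = snd r \<otimes>\<^bsub>\<Lambda>\<^esub> fst r" using g[OF q] g[OF r] by simp
    then show "q = r"
      using edge_factor_unique[of "snd q" j "snd r" "fst q" i "fst r"] q r by (auto simp: prod_eq_iff)
  qed
  moreover have "g ` (E i \<times> E j) \<subseteq> E j \<times> E i"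
  proof
    fix p assume "p \<in> g ` (E i \<times> E j)"
    then show "p \<in> E j \<times> E i" using g by (auto simp: mem_Times_iff)
  qed
  ultimately have "bij_betw g (E i \<times> E j) (E j \<times> E i)"
    by (simp add: bij_betw_def card_subset_eq card_image card_cartesian_product mult.commute)
  then have "(\<Oplus>e\<in>E i. \<Oplus>f\<in>E j. adj A (s f \<otimes> s e) \<otimes> a \<otimes> (s f \<otimes> s e))
      = (\<Oplus>f\<in>E j. \<Oplus>e\<in>E i. adj A (s e \<otimes> s f) \<otimes> a \<otimes> (s e \<otimes> s f))"
  proof (rule finsum_swap_bij[OF finite_E finite_E])
    fix e f assume e: "e \<in> E i" and f: "f \<in> E j"
    show "adj A (s f \<otimes> s e) \<otimes> a \<otimes> (s f \<otimes> s e) \<in> carrier A"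
      "adj A (s e \<otimes> s f) \<otimes> a \<otimes> (s e \<otimes> s f) \<in> carrier A"
      using s_closed[OF e] s_closed[OF f] a by auto
    have "s f \<otimes> s e = s (snd (g (e, f))) \<otimes> s (fst (g (e, f)))"
      using g[of "(e, f)"] e f False by (intro s_commute[of j i]) auto
    then show "adj A (s f \<otimes> s e) \<otimes> a \<otimes> (s f \<otimes> s e) =
        adj A (s (snd (g (e, f))) \<otimes> s (fst (g (e, f)))) \<otimes> a \<otimes> (s (snd (g (e, f))) \<otimes> s (fst (g (e, f))))"
      by simp
  qed
  then show ?thesis using a by (simp add: Psi_Psi mult.commute)
qed simp

section \<open>Compositions of averages and the mean\<close>

definition Psis :: "'k list \<Rightarrow> 'a \<Rightarrow> 'a" where "Psis is = foldr Psi is"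

lemma Psis_simps [simp]: "Psis [] x = x" "Psis (i # is) x = Psi i (Psis is x)"
    "Psis (is @ js) x = Psis is (Psis js x)"
  by (simp_all add: Psis_def)

lemma Psis_closed [simp]: "x \<in> carrier A \<Longrightarrow> Psis is x \<in> carrier A"
  by (induction "is") auto

lemma Psis_add: "x \<in> carrier A \<Longrightarrow> y \<in> carrier A \<Longrightarrow> Psis is (x \<oplus> y) = Psis is x \<oplus> Psis is y"
  by (induction "is") (auto simp: Psi_add)

lemma Psis_scalar: "x \<in> carrier A \<Longrightarrow> Psis is (c \<odot> x) = c \<odot> Psis is x"
  by (induction "is") (auto simp: Psi_scalar)

lemma Psis_diff: "x \<in> carrier A \<Longrightarrow> y \<in> carrier A \<Longrightarrow> Psis is (x \<ominus> y) = Psis is x \<ominus> Psis is y"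
  by (simp add: minus_eq minus_eq_scalar[of y] minus_eq_scalar[of "Psis is y"] Psis_add Psis_scalar)

lemma Psis_adj: "x \<in> carrier A \<Longrightarrow> Psis is (adj A x) = adj A (Psis is x)"
  by (induction "is") (auto simp: Psi_adj)

lemma Psis_one: "Psis is \<one> = \<one>"
  by (induction "is") (auto simp: Psi_one)

lemma Psis_contractive: "x \<in> carrier A \<Longrightarrow> cnrm A (Psis is x) \<le> cnrm A x"
proof (induction "is")
  case (Cons i "is")
  then show ?case using Psi_contractive[of "Psis is x" i] by simp
qed simp

lemma Psi_Psis_commute: "x \<in> carrier A \<Longrightarrow> Psi i (Psis is x) = Psis is (Psi i x)"
  by (induction "is") (auto simp: Psi_commute)

lemma Psis_commute: "x \<in> carrier A \<Longrightarrow> Psis is (Psis js x) = Psis js (Psis is x)"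
  by (induction "is") (auto simp: Psi_Psis_commute)

text \<open>Averages fix scalars and contract, so closeness to a scalar survives all further
  averages.\<close>

lemma Psis_approx:
  assumes "x \<in> carrier A"
  shows "cnrm A (Psis is (Psis js x) \<ominus> c \<odot> \<one>) \<le> cnrm A (Psis js x \<ominus> c \<odot> \<one>)"
proof -
  have "Psis is (Psis js x) \<ominus> c \<odot> \<one> = Psis is (Psis js x \<ominus> c \<odot> \<one>)"
    using assms by (simp add: Psis_diff Psis_scalar Psis_one)
  then show ?thesis using assms by (simp add: Psis_contractive)
qed

text \<open>A relation, because existence is a separate matter for each element. No sequence of
  averages is prescribed; since they commute and contract, the number is unique when it
  exists.\<close>

definition has_mean :: "'a \<Rightarrow> complex \<Rightarrow> bool" where
  "has_mean x c \<longleftrightarrow> x \<in> carrier A \<and> (\<forall>\<epsilon>>0. \<exists>is. cnrm A (Psis is x \<ominus> c \<odot> \<one>) < \<epsilon>)"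

lemma has_mean_carrier: "has_mean x c \<Longrightarrow> x \<in> carrier A"
  by (simp add: has_mean_def)

lemma has_mean_one: "has_mean \<one> 1"
  unfolding has_mean_def by (auto intro!: exI[of _ "[]"] simp: minus_eq r_neg)

lemma has_mean_zero: "has_mean \<zero> 0"
  unfolding has_mean_def by (auto intro!: exI[of _ "[]"] simp: minus_eq r_neg)

text \<open>The averages suited to \<open>x\<close> and to \<open>y\<close> differ; as they commute,
  their composition suits both.\<close>

lemma has_mean_add:
  assumes x: "has_mean x a" and y: "has_mean y b"
  shows "has_mean (x \<oplus> y) (a + b)"
  unfolding has_mean_def
proof (intro conjI allI impI)
  note c = has_mean_carrier[OF x] has_mean_carrier[OF y]
  show "x \<oplus> y \<in> carrier A" using c by simp
  fix \<epsilon> :: real assume "\<epsilon> > 0"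
  then obtain "is" js where i: "cnrm A (Psis is x \<ominus> a \<odot> \<one>) < \<epsilon> / 2" and j: "cnrm A (Psis js y \<ominus> b \<odot> \<one>) < \<epsilon> / 2"
    using x y unfolding has_mean_def by (meson half_gt_zero)
  have "Psis (is @ js) (x \<oplus> y) \<ominus> (a + b) \<odot> \<one>
      = (Psis js (Psis is x) \<ominus> a \<odot> \<one>) \<oplus> (Psis is (Psis js y) \<ominus> b \<odot> \<one>)"
    using c by (simp add: Psis_add Psis_commute[of x "is" js] scalar_add minus_eq minus_add a_ac)
  then have "cnrm A (Psis (is @ js) (x \<oplus> y) \<ominus> (a + b) \<odot> \<one>)
      \<le> cnrm A (Psis js (Psis is x) \<ominus> a \<odot> \<one>) + cnrm A (Psis is (Psis js y) \<ominus> b \<odot> \<one>)"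
    using c by (simp add: cnrm_triangle del: Psis_simps)
  also have "\<dots> < \<epsilon>"
    using i j Psis_approx[OF c(1), of js "is" a] Psis_approx[OF c(2), of "is" js b] by linarith
  finally show "\<exists>ks. cnrm A (Psis ks (x \<oplus> y) \<ominus> (a + b) \<odot> \<one>) < \<epsilon>" by blast
qed

lemma has_mean_scalar:
  assumes x: "has_mean x a"
  shows "has_mean (c \<odot> x) (c * a)"
  unfolding has_mean_def
proof (intro conjI allI impI)
  note xc = has_mean_carrier[OF x]
  show "c \<odot> x \<in> carrier A" using xc by simp
  fix \<epsilon> :: real assume "\<epsilon> > 0"
  then have "\<epsilon> / (cmod c + 1) > 0" by (simp add: add_nonneg_pos)
  then obtain "is" where i: "cnrm A (Psis is x \<ominus> a \<odot> \<one>) < \<epsilon> / (cmod c + 1)"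
    using x unfolding has_mean_def by blast
  have "Psis is (c \<odot> x) \<ominus> (c * a) \<odot> \<one> = c \<odot> (Psis is x \<ominus> a \<odot> \<one>)"
    using xc by (simp add: Psis_scalar scalar_diff scalar_mult)
  then have "cnrm A (Psis is (c \<odot> x) \<ominus> (c * a) \<odot> \<one>) = cmod c * cnrm A (Psis is x \<ominus> a \<odot> \<one>)"
    using xc by (simp add: cnrm_smult)
  also have "\<dots> \<le> (cmod c + 1) * cnrm A (Psis is x \<ominus> a \<odot> \<one>)"
    using xc by (intro mult_right_mono) (auto simp: cnrm_nonneg)
  also have "\<dots> < \<epsilon>"
    using i by (simp add: less_divide_eq add_nonneg_pos mult.commute)
  finally show "\<exists>is. cnrm A (Psis is (c \<odot> x) \<ominus> (c * a) \<odot> \<one>) < \<epsilon>" by blast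
qed

lemma has_mean_diff: "has_mean x a \<Longrightarrow> has_mean y b \<Longrightarrow> has_mean (x \<ominus> y) (a - b)"
  using has_mean_add[of x a "(- 1) \<odot> y" "- b"] has_mean_scalar[of y b "- 1"] has_mean_carrier[of y b]
  by (simp add: minus_eq minus_eq_scalar)

lemma has_mean_adj:
  assumes x: "has_mean x a"
  shows "has_mean (adj A x) (cnj a)"
  unfolding has_mean_def
proof (intro conjI allI impI)
  note xc = has_mean_carrier[OF x]
  show "adj A x \<in> carrier A" using xc by simp
  fix \<epsilon> :: real assume "\<epsilon> > 0"
  then obtain "is" where i: "cnrm A (Psis is x \<ominus> a \<odot> \<one>) < \<epsilon>"
    using x unfolding has_mean_def by blast
  have "Psis is (adj A x) \<ominus> cnj a \<odot> \<one> = adj A (Psis is x \<ominus> a \<odot> \<one>)"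
    using xc by (simp add: Psis_adj adj_diff adj_smult)
  then have "cnrm A (Psis is (adj A x) \<ominus> cnj a \<odot> \<one>) < \<epsilon>" using i xc by simp
  then show "\<exists>is. cnrm A (Psis is (adj A x) \<ominus> cnj a \<odot> \<one>) < \<epsilon>" by blast
qed

text \<open>The modulus of \<open>a\<close> is the norm of \<open>a \<odot> \<one>\<close>, which is
  approximated by contracted images of \<open>x\<close>. This gives uniqueness, continuity and
  positivity of the mean.\<close>

lemma has_mean_bound:
  assumes x: "has_mean x a"
  shows "cmod a \<le> cnrm A x"
proof (rule field_le_epsilon)
  note xc = has_mean_carrier[OF x]
  fix \<epsilon> :: real assume "\<epsilon> > 0"
  then obtain "is" where i: "cnrm A (Psis is x \<ominus> a \<odot> \<one>) < \<epsilon>"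
    using x unfolding has_mean_def by blast
  have "cmod a = cnrm A (a \<odot> \<one>)" by (simp add: cnrm_smult)
  also have "\<dots> \<le> cnrm A (Psis is x) + cnrm A (a \<odot> \<one> \<ominus> Psis is x)"
    using xc by (intro cnrm_le_add_diff) auto
  also have "cnrm A (a \<odot> \<one> \<ominus> Psis is x) = cnrm A (Psis is x \<ominus> a \<odot> \<one>)"
    using xc by (intro cnrm_diff_commute) auto
  finally show "cmod a \<le> cnrm A x + \<epsilon>" using i Psis_contractive[OF xc, of "is"] by linarith
qed

lemma has_mean_unique:
  assumes "has_mean x a" "has_mean x b"
  shows "a = b"
  using has_mean_bound[OF has_mean_diff[OF assms]] has_mean_carrier[OF assms(1)]
  by (simp add: minus_eq r_neg)

text \<open>From left to right, \<open>js\<close> becomes part of the averages for \<open>x\<close>.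
  Conversely, averages good for \<open>x\<close> stay good after \<open>js\<close> by
  \<open>Psis_approx\<close>, and commutation puts \<open>js\<close> inside.\<close>

lemma has_mean_Psis_iff:
  assumes x: "x \<in> carrier A"
  shows "has_mean (Psis js x) c \<longleftrightarrow> has_mean x c"
proof
  assume "has_mean (Psis js x) c"
  then show "has_mean x c"
    using x unfolding has_mean_def by (metis Psis_simps(3))
next
  assume h: "has_mean x c"
  show "has_mean (Psis js x) c"
    unfolding has_mean_def
  proof (intro conjI allI impI)
    fix \<epsilon> :: real assume "\<epsilon> > 0"
    then obtain "is" where "cnrm A (Psis is x \<ominus> c \<odot> \<one>) < \<epsilon>" using h unfolding has_mean_def by blast
    then have "cnrm A (Psis is (Psis js x) \<ominus> c \<odot> \<one>) < \<epsilon>"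
      using Psis_approx[OF x, of js "is" c] Psis_commute[OF x, of "is" js] by simp
    then show "\<exists>is. cnrm A (Psis is (Psis js x) \<ominus> c \<odot> \<one>) < \<epsilon>" by blast
  qed (use x in simp)
qed

text \<open>By \<open>has_mean_bound\<close> the means of approximants form a Cauchy sequence, and
  its limit is a mean by an estimate with three errors: approximant, its averages, its mean.\<close>

lemma has_mean_norm_closure:
  assumes S: "S \<subseteq> carrier A" "\<And>y. y \<in> S \<Longrightarrow> \<exists>c. has_mean y c" and x: "x \<in> norm_closure S"
  shows "\<exists>c. has_mean x c"
proof -
  obtain f where f: "\<And>n. f n \<in> S" "converges f x" using norm_closure_seq[OF S(1) x] by metis
  note c = converges_carrier[OF f(2)]
  obtain a where a: "\<And>n. has_mean (f n) (a n)" using S(2)[OF f(1)] by metis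
  have lim0: "(\<lambda>n. cnrm A (f n \<ominus> x)) \<longlonglongrightarrow> 0" using f(2) by (simp add: converges_def)
  have bound: "cmod (a k - a n) \<le> cnrm A (f k \<ominus> x) + cnrm A (f n \<ominus> x)" for k n
  proof -
    have "cmod (a k - a n) \<le> cnrm A (f k \<ominus> f n)" by (intro has_mean_bound has_mean_diff a)
    also have "\<dots> \<le> cnrm A (f k \<ominus> x) + cnrm A (x \<ominus> f n)" using c by (intro cnrm_diff_triangle)
    finally show ?thesis using c cnrm_diff_commute[of x "f n"] by simp
  qed
  have "Cauchy a"
  proof (rule metric_CauchyI)
    fix e :: real assume "e > 0"
    then obtain N where N: "\<And>n. n \<ge> N \<Longrightarrow> cnrm A (f n \<ominus> x) < e / 2"
      using order_tendstoD(2)[OF lim0, of "e / 2"] by (auto simp: eventually_sequentially)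
    have "dist (a k) (a n) < e" if "k \<ge> N" "n \<ge> N" for k n
      using bound[of k n] N[OF that(1)] N[OF that(2)] by (simp add: dist_norm)
    then show "\<exists>N. \<forall>k\<ge>N. \<forall>n\<ge>N. dist (a k) (a n) < e" by blast
  qed
  then obtain b where b: "a \<longlonglongrightarrow> b" using Cauchy_convergent convergent_def by blast
  have "has_mean x b"
    unfolding has_mean_def
  proof (intro conjI allI impI)
    fix e :: real assume "e > 0"
    have "\<forall>\<^sub>F n in sequentially. cnrm A (f n \<ominus> x) < e / 3 \<and> dist (a n) b < e / 3"
      using order_tendstoD(2)[OF lim0, of "e / 3"] tendstoD[OF b, of "e / 3"] \<open>e > 0\<close>
      by (intro eventually_conj) auto
    then obtain n where n: "cnrm A (f n \<ominus> x) < e / 3" "cmod (a n - b) < e / 3"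
      by (auto simp: dist_norm dest!: eventually_happens)
    obtain "is" where i: "cnrm A (Psis is (f n) \<ominus> a n \<odot> \<one>) < e / 3"
      using a[of n] \<open>e > 0\<close> unfolding has_mean_def by (metis divide_pos_pos zero_less_numeral)
    have "cnrm A (Psis is x \<ominus> b \<odot> \<one>)
        \<le> cnrm A (Psis is x \<ominus> Psis is (f n)) + cnrm A (Psis is (f n) \<ominus> b \<odot> \<one>)"
      using c by (intro cnrm_diff_triangle) auto
    also have "cnrm A (Psis is (f n) \<ominus> b \<odot> \<one>)
        \<le> cnrm A (Psis is (f n) \<ominus> a n \<odot> \<one>) + cnrm A (a n \<odot> \<one> \<ominus> b \<odot> \<one>)"
      using c by (intro cnrm_diff_triangle) auto
    also have "cnrm A (a n \<odot> \<one> \<ominus> b \<odot> \<one>) = cmod (a n - b)"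
      by (simp add: cnrm_smult flip: scalar_left_diff)
    also have "cnrm A (Psis is x \<ominus> Psis is (f n)) \<le> cnrm A (f n \<ominus> x)"
      using c Psis_contractive[of "x \<ominus> f n" "is"] cnrm_diff_commute[of x "f n"] by (simp add: Psis_diff)
    finally have "cnrm A (Psis is x \<ominus> b \<odot> \<one>) < e" using n i by simp
    then show "\<exists>is. cnrm A (Psis is x \<ominus> b \<odot> \<one>) < e" by blast
  qed (rule c)
  then show ?thesis by blast
qed

end

section \<open>Little pull-back and rank zero\<close>

lemma common_denominator:
  fixes r :: "'b \<Rightarrow> rat"
  assumes "finite S"
  shows "\<exists>N a. N \<noteq> (0 :: int) \<and> (\<forall>v\<in>S. of_int N * r v = of_int (a v))"
  using assms
proof (induction S rule: finite_induct)
  case (insert x S)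
  then obtain N a where N: "N \<noteq> 0" "\<And>v. v \<in> S \<Longrightarrow> of_int N * r v = of_int (a v)" by blast
  obtain p q where pq: "quotient_of (r x) = (p, q)" by (cases "quotient_of (r x)")
  have q: "q > 0" "of_int q * r x = of_int p"
    using quotient_of_denom_pos[OF pq] quotient_of_div[OF pq] by auto
  define b where "b v = (if v = x then N * p else q * a v)" for v
  have "of_int (N * q) * r v = of_int (b v)" if "v \<in> insert x S" for v
    using that N(2)[of v] q(2) by (auto simp: b_def mult_ac)
  then show ?case using N(1) q(1) by (intro exI[of _ "N * q"] exI[of _ b]) simp
qed (auto intro: exI[of _ 1])

interpretation int_vec: Modules.module "(*s) :: int \<Rightarrow> int ^ 'k \<Rightarrow> int ^ 'k::finite"
  by unfold_locales (simp_all add: vec_eq_iff algebra_simps)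

text \<open>Clearing denominators turns a rational relation into an integral one, so independence
  survives in Q^k, whose dimension bounds the size. An infinite set has \<open>card\<close> 0. The
  bound makes the \<open>Max\<close> in \<open>int_rank\<close> range over a finite set.\<close>

lemma card_independent_int_vectors:
  fixes S :: "(int ^ 'k::finite) set"
  assumes "int_vec.independent S"
  shows "card S \<le> CARD('k)"
proof (cases "finite S")
  case True
  define q :: "int ^ 'k \<Rightarrow> rat ^ 'k" where "q v = (\<chi> i. of_int (v $ i))" for v
  have inj: "inj q" by (auto simp: inj_def q_def vec_eq_iff)
  have "vec.independent (q ` S)"
    unfolding vec.independent_explicit_finite_subsets
  proof (intro allI impI ballI)
    fix T r v assume T: "T \<subseteq> q ` S" "finite T" and sum: "(\<Sum>w\<in>T. r w *s w) = 0" and v: "v \<in> T"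
    obtain T' where T': "T' \<subseteq> S" "T = q ` T'" using T(1) by (meson subset_image_iff)
    have fin: "finite T'" using T' True finite_subset by blast
    obtain N a where N: "N \<noteq> 0" "\<And>w. w \<in> T' \<Longrightarrow> of_int N * r (q w) = of_int (a w)"
      using common_denominator[OF fin, of "r \<circ> q"] by auto
    have sum': "(\<Sum>w\<in>T'. r (q w) *s q w) = 0"
      using sum T'(2) inj by (simp add: sum.reindex inj_on_subset)
    have "(\<Sum>w\<in>T'. a w *s w) = 0"
      unfolding vec_eq_iff
    proof
      fix i
      have "of_int ((\<Sum>w\<in>T'. a w *s w) $ i) = (\<Sum>w\<in>T'. of_int (a w) * of_int (w $ i) :: rat)"
        by simp
      also have "\<dots> = (\<Sum>w\<in>T'. of_int N * (r (q w) * of_int (w $ i)))"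
        by (intro sum.cong) (simp_all add: N(2)[symmetric])
      also have "\<dots> = of_int N * (\<Sum>w\<in>T'. r (q w) *s q w) $ i"
        by (simp add: q_def sum_distrib_left)
      finally have "of_int ((\<Sum>w\<in>T'. a w *s w) $ i) = (0 :: rat)" unfolding sum' by simp
      then show "(\<Sum>w\<in>T'. a w *s w) $ i = 0 $ i" unfolding of_int_eq_0_iff zero_index .
    qed
    then have "a w = 0" if "w \<in> T'" for w
      using assms that fin T'(1) unfolding int_vec.independent_explicit_module by blast
    then show "r v = 0" using v T'(2) N by force
  qed
  then have "card (q ` S) \<le> vec.dim (UNIV :: (rat ^ 'k) set)"
    by (intro vec.independent_card_le_dim) auto
  then show ?thesis unfolding vec_dim_card using inj by (simp add: card_image inj_on_subset)
qed simp

text \<open>A nonzero integer vector is independent by itself and would give rank at least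
  1.\<close>

lemma int_rank_0:
  assumes "int_rank G = 0" "g \<in> G"
  shows "g = 0"
proof (rule ccontr)
  assume "g \<noteq> 0"
  let ?C = "{card S | S. S \<subseteq> G \<and> \<not> int_vec.dependent S}"
  have "?C \<subseteq> {..CARD('a)}" using card_independent_int_vectors by auto
  then have fin: "finite ?C" using finite_subset by blast
  have "int_vec.independent {g}"
    unfolding int_vec.independent_explicit_module
  proof (intro allI impI)
    fix t u v assume "finite t" "t \<subseteq> {g}" "(\<Sum>v\<in>t. u v *s v) = 0" "v \<in> t"
    then have "t = {g}" "v = g" by auto
    with \<open>(\<Sum>v\<in>t. u v *s v) = 0\<close> have "u g *s g = 0" by simp
    then have "u g = 0" using \<open>g \<noteq> 0\<close> by (auto simp: vec_eq_iff)
    then show "u v = 0" using \<open>v = g\<close> by simp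
  qed
  then have "1 \<in> ?C" using assms(2) by (auto intro!: exI[of _ "{g}"])
  then have "1 \<le> int_rank G" unfolding int_rank_def using fin by (rule Max_ge[rotated])
  then show False using assms(1) by simp
qed

section \<open>Cancellation and decay of monomials\<close>

context kgraph_algebra
begin

text \<open>Writing e \<eta> = f' \<xi>, the map from \<eta> to f' is injective on the edges of
  color \<open>j\<close> by little pull-back, hence onto by finiteness. So exactly one \<eta>
  belongs to the given \<open>f\<close>, and the sum that computes \<open>s_f^* s_e\<close> has a
  single term.\<close>

lemma adj_s_mult_s_little_pullback:
  assumes lp: "little_pullback \<Lambda> d" and ij: "i \<noteq> j" and e: "e \<in> E i" and f: "f \<in> E j"
  shows "\<exists>\<xi>\<in>E i. \<exists>\<eta>\<in>E j. adj A (s f) \<otimes> s e = s \<xi> \<otimes> adj A (s \<eta>)"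
proof -
  have "\<exists>p. fst p \<in> E j \<and> snd p \<in> E i \<and> e \<otimes>\<^bsub>\<Lambda>\<^esub> \<eta> = fst p \<otimes>\<^bsub>\<Lambda>\<^esub> snd p" if \<eta>: "\<eta> \<in> E j" for \<eta>
    using edge_swap[OF e \<eta>] by (metis fst_conv snd_conv)
  then obtain g where g: "\<And>\<eta>. \<eta> \<in> E j \<Longrightarrow> fst (g \<eta>) \<in> E j \<and> snd (g \<eta>) \<in> E i \<and>
      e \<otimes>\<^bsub>\<Lambda>\<^esub> \<eta> = fst (g \<eta>) \<otimes>\<^bsub>\<Lambda>\<^esub> snd (g \<eta>)"
    by metis
  have "inj_on (\<lambda>\<eta>. fst (g \<eta>)) (E j)"
  proof (rule inj_onI)
    fix \<eta> \<eta>' assume h: "\<eta> \<in> E j" "\<eta>' \<in> E j" and eq: "fst (g \<eta>) = fst (g \<eta>')"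
    define f' where "f' = fst (g \<eta>)"
    have f': "f' \<in> E j" using g[OF h(1)] by (simp add: f'_def)
    have mem: "(\<zeta>, snd (g \<zeta>)) \<in> minimal_extensions \<Lambda> d e f'" if \<zeta>: "\<zeta> \<in> E j" "fst (g \<zeta>) = f'" for \<zeta>
    proof -
      have "(\<chi> k. max (d e $ k) (d f' $ k)) = d e + d \<zeta>"
        using e f' \<zeta> ij by (auto simp: edge_degree vec_eq_iff axis_def)
      moreover have "d (e \<otimes>\<^bsub>\<Lambda>\<^esub> \<zeta>) = d e + d \<zeta>"
        using edge_carrier[OF e] edge_carrier[OF \<zeta>(1)] by (rule kg.d_mult)
      ultimately have "d (e \<otimes>\<^bsub>\<Lambda>\<^esub> \<zeta>) = (\<chi> k. max (d e $ k) (d f' $ k))" by (rule trans[rotated, OF sym])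
      moreover have "e \<otimes>\<^bsub>\<Lambda>\<^esub> \<zeta> = f' \<otimes>\<^bsub>\<Lambda>\<^esub> snd (g \<zeta>)" using g[OF \<zeta>(1)] \<zeta>(2) by blast
      moreover have "\<zeta> \<in> carrier \<Lambda>" "snd (g \<zeta>) \<in> carrier \<Lambda>" using g[OF \<zeta>(1)] \<zeta>(1) edge_carrier by blast+
      ultimately show ?thesis unfolding minimal_extensions_def by blast
    qed
    have "finite (minimal_extensions \<Lambda> d e f')" "card (minimal_extensions \<Lambda> d e f') \<le> 1"
      using lp e f' ij unfolding little_pullback_def by blast+
    then show "\<eta> = \<eta>'"
      using mem[OF h(1)] mem[OF h(2)] eq card_le_Suc0_iff_eq by (fastforce simp: f'_def)
  qed
  moreover have sub: "(\<lambda>\<eta>. fst (g \<eta>)) ` E j \<subseteq> E j" using g by auto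
  ultimately have surj: "(\<lambda>\<eta>. fst (g \<eta>)) ` E j = E j"
    by (intro card_subset_eq) (auto simp: card_image)
  then obtain \<eta> where \<eta>: "\<eta> \<in> E j" "fst (g \<eta>) = f" using f by (metis imageE)
  have gc: "s (snd (g \<zeta>)) \<otimes> adj A (s \<zeta>) \<in> carrier A" if "\<zeta> \<in> E j" for \<zeta>
    using g[OF that] s_closed[OF that] s_closed[of "snd (g \<zeta>)" i] by simp
  have "adj A (s f) \<otimes> s e = (\<Oplus>\<zeta>\<in>E j. adj A (s f) \<otimes> s e \<otimes> (s \<zeta> \<otimes> adj A (s \<zeta>)) \<otimes> \<one>)"
    using adj_s_mult_s_expand[OF e f one_closed] s_closed[OF e] s_closed[OF f] by simp
  also have "\<dots> = (\<Oplus>\<zeta>\<in>E j. if \<eta> = \<zeta> then s (snd (g \<zeta>)) \<otimes> adj A (s \<zeta>) else \<zero>)"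
  proof (rule finsum_cong')
    fix \<zeta> assume \<zeta>: "\<zeta> \<in> E j"
    have "fst (g \<zeta>) = f \<longleftrightarrow> \<eta> = \<zeta>"
      using \<open>inj_on (\<lambda>\<eta>. fst (g \<eta>)) (E j)\<close> \<eta> \<zeta> by (auto dest: inj_onD)
    then show "adj A (s f) \<otimes> s e \<otimes> (s \<zeta> \<otimes> adj A (s \<zeta>)) \<otimes> \<one>
        = (if \<eta> = \<zeta> then s (snd (g \<zeta>)) \<otimes> adj A (s \<zeta>) else \<zero>)"
      using adj_s_mult_s_term[OF ij e f \<zeta>, of "fst (g \<zeta>)" "snd (g \<zeta>)" \<one>] g[OF \<zeta>] s_closed[OF \<zeta>] by simp
  qed (use gc in auto)
  also have "\<dots> = s (snd (g \<eta>)) \<otimes> adj A (s \<eta>)"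
    using gc \<eta>(1) by (intro finsum_singleton) auto
  finally show ?thesis using g[OF \<eta>(1)] \<eta>(1) by blast
qed

text \<open>No letter of \<open>v\<close> has color \<open>i\<close>, so
  \<open>adj_s_mult_s_little_pullback\<close> applies at each of them. It replaces every letter by
  one of the same color, which keeps the degree.\<close>

lemma adj_mon_mult_s_little_pullback:
  assumes lp: "little_pullback \<Lambda> d" and v: "v \<in> W" and e: "e \<in> E i" and "deg v $ i = 0"
  shows "\<exists>e'\<in>E i. \<exists>v'\<in>W. deg v' = deg v \<and> adj A (mon v) \<otimes> s e = s e' \<otimes> adj A (mon v')"
  using v e assms(4)
proof (induction v arbitrary: e rule: W_induct)
  case Nil
  then show ?case using s_closed[OF Nil(1)] by (intro bexI[of _ e] bexI[of _ "[]"]) auto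
next
  case (Cons f j v)
  have "i \<noteq> j" "deg v $ i = 0" using Cons(5) edge_degree[OF Cons(1)] by (auto simp: axis_def)
  obtain \<xi> \<eta> where \<xi>: "\<xi> \<in> E i" and \<eta>: "\<eta> \<in> E j" and eq: "adj A (s f) \<otimes> s e = s \<xi> \<otimes> adj A (s \<eta>)"
    using adj_s_mult_s_little_pullback[OF lp \<open>i \<noteq> j\<close> Cons(4,1)] by blast
  obtain e' v' where IH: "e' \<in> E i" "v' \<in> W" "deg v' = deg v" "adj A (mon v) \<otimes> s \<xi> = s e' \<otimes> adj A (mon v')"
    using Cons(3)[OF \<xi> \<open>deg v $ i = 0\<close>] by blast
  note c = s_closed[OF Cons(1)] s_closed[OF Cons(4)] s_closed[OF \<xi>] s_closed[OF \<eta>] s_closed[OF IH(1)]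
    mon_closed[OF Cons(2)] mon_closed[OF IH(2)]
  have "adj A (mon (f # v)) \<otimes> s e = adj A (mon v) \<otimes> (adj A (s f) \<otimes> s e)"
    using c by (simp add: adj_mult m_assoc)
  also have "\<dots> = (adj A (mon v) \<otimes> s \<xi>) \<otimes> adj A (s \<eta>)" unfolding eq using c by (simp add: m_assoc)
  also have "\<dots> = s e' \<otimes> adj A (mon (\<eta> # v'))" unfolding IH(4) using c by (simp add: adj_mult m_assoc)
  finally show ?case
    using IH(1,2,3) \<eta> edge_degree[OF Cons(1)] edge_degree[OF \<eta>]
    by (intro bexI[of _ e'] bexI[of _ "\<eta> # v'"]) (auto simp: W_Cons)
qed

text \<open>\<open>Psi i\<close> carries the front letter of \<open>u\<close> to the far right,
  where it has to pass \<open>adj A (mon v)\<close> to rejoin \<open>u\<close>; little pull-back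
  permits this. The words change but not their degrees, hence the induction over all
  \<open>u\<close> and \<open>v\<close>.\<close>

lemma Psis_replicate_decay:
  assumes lp: "little_pullback \<Lambda> d"
    and "u \<in> W" "v \<in> W" "deg u $ i > 0" "deg v $ i = 0"
  shows "cnrm A (Psis (replicate n i) (mon u \<otimes> adj A (mon v))) \<le> (1 / real (m i)) ^ n"
  using assms(2-5)
proof (induction n arbitrary: u v)
  case 0
  have "cnrm A (mon u \<otimes> adj A (mon v)) \<le> cnrm A (mon u) * cnrm A (adj A (mon v))"
    using 0 by (intro cnrm_mult) auto
  also have "\<dots> \<le> 1 * 1"
    using 0 cnrm_mon_le[of u] cnrm_mon_le[of v] by (intro mult_mono) (auto simp: cnrm_nonneg)
  finally show ?case by simp
next
  case (Suc n)
  obtain e u' where u': "e \<in> E i" "u' \<in> W" "mon u = s e \<otimes> mon u'" "deg u = axis i 1 + deg u'"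
    using mon_pull_front[OF Suc(2,4)] by metis
  obtain e' v' where v': "e' \<in> E i" "v' \<in> W" "deg v' = deg v" "adj A (mon v) \<otimes> s e = s e' \<otimes> adj A (mon v')"
    using adj_mon_mult_s_little_pullback[OF lp Suc(3) u'(1) Suc(5)] by blast
  note c = s_closed[OF u'(1)] s_closed[OF v'(1)] mon_closed[OF u'(2)] mon_closed[OF v'(2)] mon_closed[OF Suc(3)]
  have e'W: "[e'] \<in> W" using v'(1) by (auto simp: W_Cons)
  define u1 where "u1 = u' @ [e']"
  have u1: "u1 \<in> W" "deg u1 = deg u" "mon u1 = mon u' \<otimes> s e'"
    using u' v'(1) e'W c by (auto simp: u1_def W_append mon_append edge_degree add.commute)
  define x where "x = mon u1 \<otimes> adj A (mon v')"
  have xc: "x \<in> carrier A" using u1(1) v'(2) by (simp add: x_def mon_closed)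
  have "Psi i (mon u \<otimes> adj A (mon v)) = Psi i (s e \<otimes> (mon u' \<otimes> adj A (mon v)))"
    using c u'(3) by (simp add: m_assoc)
  also have "\<dots> = (1 / of_nat (m i)) \<odot> (mon u' \<otimes> (adj A (mon v) \<otimes> s e))"
    using c u'(1) by (simp add: Psi_s_mult m_assoc)
  also have "\<dots> = (1 / of_nat (m i)) \<odot> x"
    unfolding v'(4) using c u1(3) by (simp add: x_def m_assoc)
  finally have "Psis (replicate (Suc n) i) (mon u \<otimes> adj A (mon v)) = (1 / of_nat (m i)) \<odot> Psis (replicate n i) x"
    using c Suc(2) xc by (simp add: Psi_Psis_commute Psis_scalar)
  then have "cnrm A (Psis (replicate (Suc n) i) (mon u \<otimes> adj A (mon v)))
      = 1 / real (m i) * cnrm A (Psis (replicate n i) x)"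
    using xc by (simp add: cnrm_smult norm_divide)
  also have "\<dots> \<le> 1 / real (m i) * (1 / real (m i)) ^ n"
    unfolding x_def using Suc(1)[OF u1(1) v'(2)] Suc(4,5) u1(2) v'(3) by (intro mult_left_mono) auto
  finally show ?case by simp
qed

lemma has_mean_monomial_decay:
  assumes "little_pullback \<Lambda> d" "u \<in> W" "v \<in> W" "deg u $ i > 0" "deg v $ i = 0"
  shows "has_mean (mon u \<otimes> adj A (mon v)) 0"
  unfolding has_mean_def
proof (intro conjI allI impI)
  show c: "mon u \<otimes> adj A (mon v) \<in> carrier A" using assms by auto
  fix \<epsilon> :: real assume "\<epsilon> > 0"
  moreover have "1 / real (m i) < 1" using m_ge_2[of i] by simp
  ultimately obtain n where "(1 / real (m i)) ^ n < \<epsilon>" using real_arch_pow_inv by blast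
  then have "cnrm A (Psis (replicate n i) (mon u \<otimes> adj A (mon v)) \<ominus> 0 \<odot> \<one>) < \<epsilon>"
    using Psis_replicate_decay[OF assms, of n] c by (simp add: minus_eq)
  then show "\<exists>is. cnrm A (Psis is (mon u \<otimes> adj A (mon v)) \<ominus> 0 \<odot> \<one>) < \<epsilon>" by blast
qed

text \<open>A color common to both words is cancelled by one average, in which their front letters
  meet as \<open>s_f^* s_e\<close>, that is 0 or 1; the remaining words still satisfy the hypothesis
  and \<open>u\<close> is shorter. A color that occurs in \<open>u\<close> only gives mean 0 by
  decay.\<close>

lemma has_mean_monomial:
  assumes "little_pullback \<Lambda> d \<or> deg u = deg v" "u \<in> W" "v \<in> W"
  shows "\<exists>c. has_mean (mon u \<otimes> adj A (mon v)) c"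
  using assms
proof (induction "length u" arbitrary: u v)
  case 0
  then have u: "u = []" by simp
  show ?case
  proof (cases "v = []")
    case True
    then show ?thesis using u has_mean_one by auto
  next
    case False
    then have "deg v \<noteq> 0" using 0 deg_eq_0_iff by blast
    then obtain i where "deg v $ i > 0" by (auto simp: vec_eq_iff)
    moreover have "little_pullback \<Lambda> d" using 0 u \<open>deg v \<noteq> 0\<close> by auto
    \<comment> \<open>With \<open>u\<close> empty the surplus color sits in \<open>v\<close>, so
      decay is applied to the adjoint.\<close>
    ultimately have "has_mean (mon v \<otimes> adj A (mon u)) 0"
      using 0 u by (intro has_mean_monomial_decay[of v u i]) auto
    then show ?thesis using has_mean_adj[of "mon v \<otimes> adj A (mon u)" 0] 0 by (auto simp: adj_mult)
  qed
next
  case (Suc n)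
  then have "deg u \<noteq> 0" using deg_eq_0_iff by auto
  then obtain i where i: "deg u $ i > 0" by (auto simp: vec_eq_iff)
  show ?case
  proof (cases "deg v $ i = 0")
    case True
    then have "little_pullback \<Lambda> d" using Suc(3) i by auto
    then show ?thesis using has_mean_monomial_decay Suc i True by blast
  next
    case False
    then have vi: "deg v $ i > 0" by simp
    obtain e u' where u': "e \<in> E i" "u' \<in> W" "mon u = s e \<otimes> mon u'" "deg u = axis i 1 + deg u'"
        "length u = Suc (length u')"
      using mon_pull_front[OF Suc(4) i] .
    obtain f v' where v': "f \<in> E i" "v' \<in> W" "mon v = s f \<otimes> mon v'" "deg v = axis i 1 + deg v'"
        "length v = Suc (length v')"
      using mon_pull_front[OF Suc(5) vi] .
    note c = s_closed[OF u'(1)] s_closed[OF v'(1)] mon_closed[OF u'(2)] mon_closed[OF v'(2)]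
    obtain a where a: "has_mean (mon u' \<otimes> adj A (mon v')) a"
      using Suc(1)[of u' v'] Suc(2,3) u' v' by auto
    have "Psi i (mon u \<otimes> adj A (mon v)) = Psi i (s e \<otimes> (mon u' \<otimes> adj A (mon v') \<otimes> adj A (s f)))"
      unfolding u'(3) v'(3) using c by (simp add: adj_mult m_assoc)
    also have "\<dots> = (1 / of_nat (m i)) \<odot> (mon u' \<otimes> adj A (mon v') \<otimes> (adj A (s f) \<otimes> s e))"
      using c u'(1) by (simp add: Psi_s_mult m_assoc)
    finally have "\<exists>b. has_mean (Psi i (mon u \<otimes> adj A (mon v))) b"
      using s_orthogonal[OF v'(1) u'(1)] has_mean_scalar[OF a] has_mean_zero c by (cases "e = f") auto
    then show ?thesis
      using has_mean_Psis_iff[of "mon u \<otimes> adj A (mon v)" "[i]"] Suc(4,5) by auto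
  qed
qed

section \<open>The trace on the fixed point algebra\<close>

text \<open>The difference of two degrees with equal \<open>log_deg\<close> lies in the intrinsic
  group, which is trivial when its rank is 0.\<close>

lemma log_deg_inject:
  assumes "int_rank (intrinsic_group \<Lambda> d) = 0" "log_deg p = log_deg q"
  shows "p = q"
proof -
  define g :: "int ^ 'k" where "g = (\<chi> i. int (p $ i) - int (q $ i))"
  have "(\<Sum>i\<in>UNIV. real_of_int (g $ i) * ln (real (m i))) = log_deg p - log_deg q"
    by (simp add: g_def log_deg_def left_diff_distrib sum_subtractf)
  then have "g \<in> intrinsic_group \<Lambda> d"
    using assms(2) by (simp add: intrinsic_group_def edge_pow_exp)
  then have "g = 0" using assms(1) by (intro int_rank_0)
  then show ?thesis by (simp add: g_def vec_eq_iff)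
qed

lemma M_has_mean:
  assumes hyp: "little_pullback \<Lambda> d \<or> int_rank (intrinsic_group \<Lambda> d) = 0" and x: "x \<in> M"
  shows "\<exists>c. has_mean x c"
proof (rule has_mean_norm_closure)
  show "x \<in> norm_closure (linear_span fixed_mons)" using x M_subset_closure by auto
  show "linear_span fixed_mons \<subseteq> carrier A" by (rule linear_span_carrier[OF fixed_mons_carrier])
  fix y assume "y \<in> linear_span fixed_mons"
  then show "\<exists>c. has_mean y c"
  proof induction
    case (step x y c)
    obtain u v where "u \<in> W" "v \<in> W" "x = mon u \<otimes> adj A (mon v)" "log_deg (deg u) = log_deg (deg v)"
      using step(1) by (auto simp: fixed_mons_def)
    then have "\<exists>a. has_mean x a"
      using hyp has_mean_monomial[of u v] log_deg_inject[of "deg u" "deg v"] by auto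
    then show ?case using step(3) has_mean_scalar has_mean_add by meson
  qed (use has_mean_zero in blast)
qed

lemma log_deg_axis_add: "log_deg (axis i 1 + p) = ln (real (m i)) + log_deg p"
proof -
  have "log_deg (axis i 1 + p) = (\<Sum>j\<in>UNIV. (if j = i then ln (real (m i)) else 0) + real (p $ j) * ln (real (m j)))"
    unfolding log_deg_def by (intro sum.cong) (auto simp: axis_def distrib_right)
  then show ?thesis by (simp add: sum.distrib log_deg_def)
qed

text \<open>Together with its adjoint version, this is the KMS condition: moving \<open>s\<^sub>u\<close> across multiplies the
  mean by \<open>m\<close> to the power \<open>- deg u\<close>.\<close>

lemma Psis_mon_mult:
  assumes "u \<in> W" "z \<in> carrier A"
  shows "\<exists>is. Psis is (mon u \<otimes> z) = complex_of_real (exp (- log_deg (deg u))) \<odot> (z \<otimes> mon u)"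
  using assms
proof (induction u arbitrary: z rule: W_induct)
  case Nil
  then show ?case by (intro exI[of _ "[]"]) (simp add: log_deg_def)
next
  case (Cons e i u)
  note c = s_closed[OF Cons(1)] mon_closed[OF Cons(2)] Cons(4)
  obtain "is" where i: "Psis is (mon u \<otimes> (z \<otimes> s e))
      = complex_of_real (exp (- log_deg (deg u))) \<odot> (z \<otimes> s e \<otimes> mon u)"
    using Cons(3)[of "z \<otimes> s e"] c by auto
  have "exp (- log_deg (deg (e # u))) = 1 / real (m i) * exp (- log_deg (deg u))"
    using m_pos[of i] edge_degree[OF Cons(1)] log_deg_axis_add[of i "deg u"]
    by (simp add: exp_diff exp_minus field_simps exp_add)
  moreover have "Psis (is @ [i]) (mon (e # u) \<otimes> z)
      = (1 / of_nat (m i)) \<odot> (complex_of_real (exp (- log_deg (deg u))) \<odot> (z \<otimes> s e \<otimes> mon u))"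
    using c Psi_s_mult[OF Cons(1), of "mon u \<otimes> z"] i by (simp add: m_assoc Psis_scalar)
  ultimately have "Psis (is @ [i]) (mon (e # u) \<otimes> z)
      = complex_of_real (exp (- log_deg (deg (e # u)))) \<odot> (z \<otimes> mon (e # u))"
    using c by (simp add: scalar_mult m_assoc)
  then show ?case by blast
qed

text \<open>Averages do not change the mean, so the factor in \<open>Psis_mon_mult\<close> can be
  taken to the other side.\<close>

lemma has_mean_mon_left:
  fixes a :: complex
  assumes u: "u \<in> W" and z: "z \<in> carrier A" and a: "has_mean (mon u \<otimes> z) a"
  shows "has_mean (z \<otimes> mon u) (exp (log_deg (deg u)) * a)"
proof -
  obtain "is" where i: "Psis is (mon u \<otimes> z) = complex_of_real (exp (- log_deg (deg u))) \<odot> (z \<otimes> mon u)"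
    using Psis_mon_mult[OF u z] by blast
  have "has_mean (complex_of_real (exp (- log_deg (deg u))) \<odot> (z \<otimes> mon u)) a"
    using a has_mean_Psis_iff[of "mon u \<otimes> z" "is"] u z i by simp
  then have "has_mean (complex_of_real (exp (log_deg (deg u))) \<odot>
      (complex_of_real (exp (- log_deg (deg u))) \<odot> (z \<otimes> mon u))) (complex_of_real (exp (log_deg (deg u))) * a)"
    by (rule has_mean_scalar)
  then show ?thesis
    using u z by (simp add: scalar_mult exp_minus flip: of_real_mult)
qed

lemma has_mean_mon_right:
  fixes a :: complex
  assumes v: "v \<in> W" and z: "z \<in> carrier A" and a: "has_mean (z \<otimes> adj A (mon v)) a"
  shows "has_mean (adj A (mon v) \<otimes> z) (exp (log_deg (deg v)) * a)"
proof -
  have "has_mean (mon v \<otimes> adj A z) (cnj a)"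
    using has_mean_adj[OF a] v z by (simp add: adj_mult)
  then have "has_mean (adj A z \<otimes> mon v) (exp (log_deg (deg v)) * cnj a)"
    using v z by (intro has_mean_mon_left) auto
  from has_mean_adj[OF this] show ?thesis using v z by (simp add: adj_mult)
qed

text \<open>Both products lead to \<open>adj A (mon v) \<otimes> y \<otimes> mon u\<close>: from
  \<open>x \<otimes> y\<close> by moving \<open>mon u\<close>, from \<open>y \<otimes> x\<close> by
  moving \<open>adj A (mon v)\<close>. The factors are m^d(u) and m^d(v), which agree for a fixed
  monomial.\<close>

lemma has_mean_trace_fixed_mons:
  assumes x: "x \<in> fixed_mons" and y: "y \<in> carrier A"
    and a: "has_mean (x \<otimes> y) a" and b: "has_mean (y \<otimes> x) b"
  shows "a = b"
proof -
  obtain u v where uv: "u \<in> W" "v \<in> W" "x = mon u \<otimes> adj A (mon v)" "log_deg (deg u) = log_deg (deg v)"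
    using x by (auto simp: fixed_mons_def)
  have "has_mean (mon u \<otimes> (adj A (mon v) \<otimes> y)) a" using a uv y by (simp add: m_assoc)
  then have 1: "has_mean (adj A (mon v) \<otimes> y \<otimes> mon u) (exp (log_deg (deg u)) * a)"
    using uv y by (intro has_mean_mon_left) auto
  have "has_mean (y \<otimes> mon u \<otimes> adj A (mon v)) b" using b uv y by (simp add: m_assoc)
  then have "has_mean (adj A (mon v) \<otimes> (y \<otimes> mon u)) (exp (log_deg (deg v)) * b)"
    using uv y by (intro has_mean_mon_right) auto
  then have "has_mean (adj A (mon v) \<otimes> y \<otimes> mon u) (exp (log_deg (deg u)) * b)"
    using uv y by (simp add: m_assoc)
  from has_mean_unique[OF 1 this] show ?thesis by simp
qed

text \<open>The identity for single monomials extends to their span by linearity and to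
  \<open>M\<close> by \<open>has_mean_bound\<close>. Only \<open>x\<close> is approximated.\<close>

lemma has_mean_trace:
  assumes hyp: "little_pullback \<Lambda> d \<or> int_rank (intrinsic_group \<Lambda> d) = 0"
    and x: "x \<in> M" and y: "y \<in> M"
    and a: "has_mean (x \<otimes> y) a" and b: "has_mean (y \<otimes> x) b"
  shows "a = b"
proof -
  note D = star_subalgebraD[OF star_subalgebra_M] and yc = M_carrier[OF y] and xc = M_carrier[OF x]
  have span: "a = b" if "w \<in> linear_span fixed_mons" "has_mean (w \<otimes> y) a" "has_mean (y \<otimes> w) b" for w a b
    using that
  proof (induction arbitrary: a b)
    case zero
    then show ?case
      using yc has_mean_unique[OF has_mean_zero, of a] has_mean_unique[OF has_mean_zero, of b] by simp
  next
    case (step w z c)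
    have wM: "w \<in> M" "z \<in> M" using step fixed_mons_M linear_span_fixed_mons_M by auto
    note wc = wM[THEN M_carrier]
    obtain a1 where a1: "has_mean (w \<otimes> y) a1" using M_has_mean[OF hyp] D(5) wM y by blast
    obtain b1 where b1: "has_mean (y \<otimes> w) b1" using M_has_mean[OF hyp] D(5) wM y by blast
    obtain a2 where a2: "has_mean (z \<otimes> y) a2" using M_has_mean[OF hyp] D(5) wM y by blast
    obtain b2 where b2: "has_mean (y \<otimes> z) b2" using M_has_mean[OF hyp] D(5) wM y by blast
    have "a1 = b1" using has_mean_trace_fixed_mons[OF step(1) yc a1 b1] .
    moreover have "a2 = b2" using step(3)[OF a2 b2] .
    moreover have "a = c * a1 + a2"
      using has_mean_add[OF has_mean_scalar[OF a1, of c] a2] step(4) wc yc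
      by (simp add: l_distr smult_mult_left has_mean_unique)
    moreover have "b = c * b1 + b2"
      using has_mean_add[OF has_mean_scalar[OF b1, of c] b2] step(5) wc yc
      by (simp add: r_distr smult_mult_right has_mean_unique)
    ultimately show ?case by simp
  qed
  have "cmod (a - b) \<le> 0 + \<epsilon>" if "\<epsilon> > 0" for \<epsilon>
  proof -
    \<comment> \<open>The 1 added to the norm of \<open>y\<close> avoids division by zero; the 2
      shares \<epsilon> between the two products.\<close>
    have pos: "\<epsilon> / (2 * (cnrm A y + 1)) > 0" using \<open>\<epsilon> > 0\<close> cnrm_nonneg[OF yc] by simp
    with x obtain w where w: "w \<in> linear_span fixed_mons" "cnrm A (x \<ominus> w) < \<epsilon> / (2 * (cnrm A y + 1))"
      using M_subset_closure unfolding norm_closure_def by blast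
    have wM: "w \<in> M" and wc: "w \<in> carrier A"
      using linear_span_fixed_mons_M[OF w(1)] M_carrier by auto
    obtain a' where a': "has_mean (w \<otimes> y) a'" using M_has_mean[OF hyp] D(5) wM y by blast
    obtain b' where b': "has_mean (y \<otimes> w) b'" using M_has_mean[OF hyp] D(5) wM y by blast
    have small: "cnrm A (x \<ominus> w) * cnrm A y \<le> \<epsilon> / 2"
    proof -
      have "cnrm A (x \<ominus> w) * cnrm A y \<le> \<epsilon> / (2 * (cnrm A y + 1)) * (cnrm A y + 1)"
        using w(2) xc wc yc pos by (intro mult_mono less_imp_le[OF pos]) (auto simp: cnrm_nonneg)
      also have "\<dots> = \<epsilon> / 2" using cnrm_nonneg[OF yc] by (simp add: field_simps)
      finally show ?thesis .
    qed
    have "cmod (a - a') \<le> cnrm A (x \<otimes> y \<ominus> w \<otimes> y)" by (rule has_mean_bound[OF has_mean_diff[OF a a']])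
    also have "x \<otimes> y \<ominus> w \<otimes> y = (x \<ominus> w) \<otimes> y" using xc wc yc by (simp add: minus_eq l_distr l_minus)
    also have "cnrm A \<dots> \<le> \<epsilon> / 2" using cnrm_mult[of "x \<ominus> w" y] small xc wc yc by simp
    finally have 1: "cmod (a - a') \<le> \<epsilon> / 2" .
    have "cmod (b - b') \<le> cnrm A (y \<otimes> x \<ominus> y \<otimes> w)" by (rule has_mean_bound[OF has_mean_diff[OF b b']])
    also have "y \<otimes> x \<ominus> y \<otimes> w = y \<otimes> (x \<ominus> w)" using xc wc yc by (simp add: minus_eq r_distr r_minus)
    also have "cnrm A \<dots> \<le> \<epsilon> / 2" using cnrm_mult[of y "x \<ominus> w"] small xc wc yc by (simp add: mult.commute)
    finally have 2: "cmod (b - b') \<le> \<epsilon> / 2" .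
    have "a' = b'" using span[OF w(1) a' b'] .
    then show ?thesis
      using 1 2 norm_triangle_ineq4[of "a - a'" "b - b'"] by simp
  qed
  then have "cmod (a - b) \<le> 0" by (rule field_le_epsilon)
  then show ?thesis by simp
qed

text \<open>Scaled to norm below 1, \<open>x\<close> satisfies the estimate of
  \<open>cnrm_one_minus_adj_mult_le\<close>, so the mean of one minus the scaled product has real
  part at most 1. The mean is real because the product is self-adjoint.\<close>

lemma has_mean_positive:
  assumes x: "x \<in> carrier A" and c: "has_mean (adj A x \<otimes> x) c"
  shows "c \<in> \<real>\<^sub>\<ge>\<^sub>0"
proof -
  define t where "t = 1 / (cnrm A x + 1)"
  have t: "t > 0" using cnrm_nonneg[OF x] by (simp add: t_def)
  define y where "y = complex_of_real t \<odot> x"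
  have "cnrm A y = t * cnrm A x" using x t by (simp add: y_def cnrm_smult)
  also have "\<dots> < 1" using cnrm_nonneg[OF x] by (simp add: t_def)
  finally have y: "y \<in> carrier A" "cnrm A y < 1" using x by (simp_all add: y_def)
  have yy: "adj A y \<otimes> y = complex_of_real (t\<^sup>2) \<odot> (adj A x \<otimes> x)"
    using x by (simp add: y_def adj_smult smult_mult_left smult_mult_right scalar_mult power2_eq_square)
  obtain v w where "v \<in> carrier A" "adj A v \<otimes> v = \<one>" "w \<in> carrier A" "adj A w \<otimes> w = \<one>"
    "adj A v \<otimes> w = \<zero>" using orthogonal_isometries .
  then have le: "cnrm A (\<one> \<ominus> adj A y \<otimes> y) \<le> 1" using y by (intro cnrm_one_minus_adj_mult_le)
  have "has_mean (\<one> \<ominus> adj A y \<otimes> y) (1 - complex_of_real (t\<^sup>2) * c)"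
    unfolding yy by (intro has_mean_diff has_mean_one has_mean_scalar c)
  then have "cmod (1 - complex_of_real (t\<^sup>2) * c) \<le> 1" using has_mean_bound le by (meson order_trans)
  then have "1 - t\<^sup>2 * Re c \<le> 1"
    using complex_Re_le_cmod[of "1 - complex_of_real (t\<^sup>2) * c"] by simp
  then have "Re c \<ge> 0" using t by (simp add: zero_le_mult_iff)
  moreover have "has_mean (adj A x \<otimes> x) (cnj c)"
    using has_mean_adj[OF c] x by (simp add: adj_mult)
  from has_mean_unique[OF this c] have "cnj c = c" .
  ultimately show ?thesis
    by (simp add: complex_nonneg_Reals_iff complex_eq_iff)
qed

section \<open>Tracial states on the fixed point algebra\<close>

lemma M_conj:
  assumes "y \<in> M" "e \<in> E i" "f \<in> E i"
  shows "s e \<otimes> y \<otimes> adj A (s f) \<in> M" "adj A (s e) \<otimes> y \<otimes> s f \<in> M"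
proof -
  note c = s_closed[OF assms(2)] s_closed[OF assms(3)] M_carrier[OF assms(1)]
  \<comment> \<open>The two edges have the same color, so their phases cancel, although neither
    generator lies in \<open>M\<close>.\<close>
  have fl: "cnj (flow t i) * flow t i = 1" "flow t i * cnj (flow t i) = 1" for t
    by (simp_all add: flow_def cis_cnj cis_mult)
  have rs: "rotation (flow t) (s e) = flow t i \<odot> s e" "rotation (flow t) (s f) = flow t i \<odot> s f" for t
    using rotation_props(3)[of "flow t", OF cmod_flow] assms by auto
  have ry: "rotation (flow t) y = y" for t using assms(1) by (simp add: M_def)
  show "s e \<otimes> y \<otimes> adj A (s f) \<in> M" "adj A (s e) \<otimes> y \<otimes> s f \<in> M"
    using c by (simp_all add: M_def flow_hom rs ry adj_smult smult_mult_left smult_mult_right scalar_mult fl)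
qed

lemma M_s_adj_s: "e \<in> E i \<Longrightarrow> f \<in> E i \<Longrightarrow> s e \<otimes> adj A (s f) \<in> M"
  using M_conj(1)[of \<one> e i f] star_subalgebraD(2)[OF star_subalgebra_M] s_closed[of e i] by simp

lemma M_finsum: "finite I \<Longrightarrow> (\<And>i. i \<in> I \<Longrightarrow> f i \<in> M) \<Longrightarrow> finsum A f I \<in> M"
proof (induction I rule: finite_induct)
  case (insert i I)
  have "f \<in> I \<rightarrow> carrier A" "f i \<in> carrier A" using insert M_carrier by auto
  then show ?case using insert star_subalgebraD(4)[OF star_subalgebra_M] by simp
qed (simp add: star_subalgebraD(3)[OF star_subalgebra_M])

lemma Psi_M: "x \<in> M \<Longrightarrow> Psi i x \<in> M"
  unfolding Psi_def by (intro star_subalgebraD(6)[OF star_subalgebra_M] M_finsum M_conj finite_E)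

lemma Psis_M: "x \<in> M \<Longrightarrow> Psis is x \<in> M"
  by (induction "is") (auto simp: Psi_M)

lemma tracial_state_M_iff:
  "tracial_state (A\<lparr>carrier := M\<rparr>) \<tau> \<longleftrightarrow>
     (\<forall>x\<in>M. \<forall>y\<in>M. \<tau> (x \<oplus> y) = \<tau> x + \<tau> y) \<and> (\<forall>c. \<forall>x\<in>M. \<tau> (c \<odot> x) = c * \<tau> x) \<and>
     (\<forall>x\<in>M. \<tau> (adj A x \<otimes> x) \<in> \<real>\<^sub>\<ge>\<^sub>0) \<and> \<tau> \<one> = 1 \<and> (\<forall>x\<in>M. \<forall>y\<in>M. \<tau> (x \<otimes> y) = \<tau> (y \<otimes> x))"
  by (simp add: tracial_state_def)

lemma trace_finsum:
  assumes \<tau>: "tracial_state (A\<lparr>carrier := M\<rparr>) \<tau>" and "finite I" and f: "\<And>i. i \<in> I \<Longrightarrow> f i \<in> M"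
  shows "\<tau> (finsum A f I) = (\<Sum>i\<in>I. \<tau> (f i))"
  using assms(2) f
proof (induction I rule: finite_induct)
  case empty
  have "\<tau> (0 \<odot> \<one>) = 0" using \<tau> star_subalgebraD(2)[OF star_subalgebra_M] by (simp add: tracial_state_M_iff del: scalar_zero)
  then show ?case by simp
next
  case (insert i I)
  have "f \<in> I \<rightarrow> carrier A" "f i \<in> carrier A" using insert M_carrier by auto
  moreover have "finsum A f I \<in> M" using insert by (intro M_finsum) auto
  ultimately show ?case using insert \<tau> by (simp add: tracial_state_M_iff)
qed

text \<open>Compressing a trace to the corner \<open>s\<^sub>e s\<^sub>e\<^sup>*\<close>, which is isomorphic to the whole algebra, gives
  another trace that absorbs \<open>Psi i\<close>. So every trace of \<open>x\<close> equals a trace of \<open>Psis is x\<close>, which is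
  nearly scalar.\<close>

lemma trace_compress:
  assumes \<tau>: "tracial_state (A\<lparr>carrier := M\<rparr>) \<tau>"
  shows "\<exists>\<tau>'. tracial_state (A\<lparr>carrier := M\<rparr>) \<tau>' \<and> (\<forall>x\<in>M. \<tau> x = \<tau>' (Psi i x))"
proof -
  note D = star_subalgebraD[OF star_subalgebra_M]
  have add: "\<And>x y. x \<in> M \<Longrightarrow> y \<in> M \<Longrightarrow> \<tau> (x \<oplus> y) = \<tau> x + \<tau> y"
    and sc: "\<And>c x. x \<in> M \<Longrightarrow> \<tau> (c \<odot> x) = c * \<tau> x" and pos: "\<And>x. x \<in> M \<Longrightarrow> \<tau> (adj A x \<otimes> x) \<in> \<real>\<^sub>\<ge>\<^sub>0"
    and one: "\<tau> \<one> = 1" and tr: "\<And>x y. x \<in> M \<Longrightarrow> y \<in> M \<Longrightarrow> \<tau> (x \<otimes> y) = \<tau> (y \<otimes> x)"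
    using \<tau> by (auto simp: tracial_state_M_iff)
  obtain e0 where e0: "e0 \<in> E i" using m_pos[of i] by (metis card_gt_0_iff ex_in_conv)
  note s0 = s_closed[OF e0] and iso = s_orthogonal[OF e0 e0]
  \<comment> \<open>The factor \<open>m i\<close> normalizes the compressed trace: the range
    projection of \<open>s e0\<close> turns out to have trace 1/m_i.\<close>
  define \<tau>' where "\<tau>' y = of_nat (m i) * \<tau> (s e0 \<otimes> y \<otimes> adj A (s e0))" for y
  have eq: "\<tau> x = \<tau>' (Psi i x)" if x: "x \<in> M" for x
  proof -
    note xc = M_carrier[OF x]
    have s2: "(\<lambda>e. s e \<otimes> adj A (s e)) \<in> E i \<rightarrow> carrier A" by auto
    have "\<tau> x = \<tau> (\<Oplus>e\<in>E i. x \<otimes> (s e \<otimes> adj A (s e)))"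
      using xc s2 by (simp add: s_sum flip: finsum_rdistr)
    also have "\<dots> = (\<Sum>e\<in>E i. \<tau> (x \<otimes> (s e \<otimes> adj A (s e))))"
      by (rule trace_finsum[OF \<tau> finite_E]) (rule D(5)[OF x M_s_adj_s])
    also have "\<dots> = (\<Sum>e\<in>E i. \<tau> (s e0 \<otimes> (adj A (s e) \<otimes> x \<otimes> s e) \<otimes> adj A (s e0)))"
    proof (rule sum.cong)
      fix e assume e: "e \<in> E i"
      note se = s_closed[OF e]
      \<comment> \<open>Single generators lie outside \<open>M\<close>, where the trace property
        says nothing. Inserting \<open>adj A (s e0) \<otimes> s e0 = \<one>\<close> splits the
        product into two factors from \<open>M\<close>.\<close>
      have "x \<otimes> (s e \<otimes> adj A (s e)) = (x \<otimes> (s e \<otimes> adj A (s e0))) \<otimes> (s e0 \<otimes> adj A (s e))"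
      proof -
        have "(x \<otimes> (s e \<otimes> adj A (s e0))) \<otimes> (s e0 \<otimes> adj A (s e))
            = x \<otimes> s e \<otimes> (adj A (s e0) \<otimes> s e0) \<otimes> adj A (s e)"
          using xc se s0 by (simp add: m_assoc)
        then show ?thesis using iso xc se by (simp add: m_assoc)
      qed
      also have "\<tau> \<dots> = \<tau> ((s e0 \<otimes> adj A (s e)) \<otimes> (x \<otimes> (s e \<otimes> adj A (s e0))))"
        by (rule tr[OF D(5)[OF x M_s_adj_s[OF e e0]] M_s_adj_s[OF e0 e]])
      finally show "\<tau> (x \<otimes> (s e \<otimes> adj A (s e))) = \<tau> (s e0 \<otimes> (adj A (s e) \<otimes> x \<otimes> s e) \<otimes> adj A (s e0))"
        using xc se s0 by (simp add: m_assoc)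
    qed simp
    also have "\<dots> = \<tau> (\<Oplus>e\<in>E i. s e0 \<otimes> (adj A (s e) \<otimes> x \<otimes> s e) \<otimes> adj A (s e0))"
      by (rule trace_finsum[OF \<tau> finite_E, symmetric]) (rule M_conj(1)[OF M_conj(2)[OF x] e0 e0])
    also have "(\<Oplus>e\<in>E i. s e0 \<otimes> (adj A (s e) \<otimes> x \<otimes> s e) \<otimes> adj A (s e0))
        = s e0 \<otimes> (\<Oplus>e\<in>E i. adj A (s e) \<otimes> x \<otimes> s e) \<otimes> adj A (s e0)"
    proof -
      note T = Psi_terms[OF xc, of i]
      moreover have "(\<lambda>e. s e0 \<otimes> (adj A (s e) \<otimes> x \<otimes> s e)) \<in> E i \<rightarrow> carrier A" using T s0 by auto
      ultimately show ?thesis using s0 by (simp add: finsum_rdistr finsum_ldistr)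
    qed
    also have "(\<Oplus>e\<in>E i. adj A (s e) \<otimes> x \<otimes> s e) = of_nat (m i) \<odot> Psi i x"
      using Psi_terms[OF xc, of i] m_pos[of i] by (simp add: Psi_def scalar_mult finsum_closed card_gt_0_iff)
    also have "s e0 \<otimes> (of_nat (m i) \<odot> Psi i x) \<otimes> adj A (s e0)
        = of_nat (m i) \<odot> (s e0 \<otimes> Psi i x \<otimes> adj A (s e0))"
      using s0 xc by (simp add: smult_mult_left smult_mult_right)
    also have "\<tau> \<dots> = \<tau>' (Psi i x)"
      unfolding \<tau>'_def by (rule sc[OF M_conj(1)[OF Psi_M[OF x] e0 e0]])
    finally show ?thesis .
  qed
  have conj_mult: "(s e0 \<otimes> x \<otimes> adj A (s e0)) \<otimes> (s e0 \<otimes> y \<otimes> adj A (s e0)) = s e0 \<otimes> (x \<otimes> y) \<otimes> adj A (s e0)"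
    if "x \<in> carrier A" "y \<in> carrier A" for x y
  proof -
    have "(s e0 \<otimes> x \<otimes> adj A (s e0)) \<otimes> (s e0 \<otimes> y \<otimes> adj A (s e0))
        = s e0 \<otimes> x \<otimes> (adj A (s e0) \<otimes> s e0) \<otimes> y \<otimes> adj A (s e0)"
      using that s0 by (simp add: m_assoc)
    then show ?thesis using that s0 iso by (simp add: m_assoc)
  qed
  have "tracial_state (A\<lparr>carrier := M\<rparr>) \<tau>'"
    unfolding tracial_state_M_iff
  proof (intro conjI ballI allI)
    show "\<tau>' \<one> = 1" using eq[OF D(2)] one by (simp add: Psi_one)
    fix x assume x: "x \<in> M"
    note xc = M_carrier[OF x] and xM = M_conj(1)[OF x e0 e0]
    show "\<tau>' (c \<odot> x) = c * \<tau>' x" for c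
      using xc s0 sc[OF xM] by (simp add: \<tau>'_def smult_mult_left smult_mult_right)
    have "s e0 \<otimes> (adj A x \<otimes> x) \<otimes> adj A (s e0)
        = adj A (s e0 \<otimes> x \<otimes> adj A (s e0)) \<otimes> (s e0 \<otimes> x \<otimes> adj A (s e0))"
      using conj_mult[of "adj A x" x] xc s0 by (simp add: adj_mult m_assoc)
    then show "\<tau>' (adj A x \<otimes> x) \<in> \<real>\<^sub>\<ge>\<^sub>0"
      using pos[OF xM] by (simp add: \<tau>'_def)
    fix y assume y: "y \<in> M"
    note yc = M_carrier[OF y] and yM = M_conj(1)[OF y e0 e0]
    show "\<tau>' (x \<oplus> y) = \<tau>' x + \<tau>' y"
      using xc yc s0 add[OF xM yM] by (simp add: \<tau>'_def l_distr r_distr distrib_left)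
    show "\<tau>' (x \<otimes> y) = \<tau>' (y \<otimes> x)"
      using tr[OF xM yM] conj_mult[OF xc yc] conj_mult[OF yc xc] by (simp add: \<tau>'_def)
  qed
  then show ?thesis using eq by blast
qed

lemma trace_Psis:
  assumes "tracial_state (A\<lparr>carrier := M\<rparr>) \<tau>"
  shows "\<exists>\<tau>'. tracial_state (A\<lparr>carrier := M\<rparr>) \<tau>' \<and> (\<forall>x\<in>M. \<tau> x = \<tau>' (Psis is x))"
proof (induction "is")
  case Nil
  then show ?case using assms by auto
next
  case (Cons i "is")
  then obtain \<tau>1 where 1: "tracial_state (A\<lparr>carrier := M\<rparr>) \<tau>1" "\<And>x. x \<in> M \<Longrightarrow> \<tau> x = \<tau>1 (Psis is x)"
    by blast
  obtain \<tau>2 where 2: "tracial_state (A\<lparr>carrier := M\<rparr>) \<tau>2" "\<And>x. x \<in> M \<Longrightarrow> \<tau>1 x = \<tau>2 (Psi i x)"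
    using trace_compress[OF 1(1), of i] by blast
  show ?case using 1(2) 2 Psis_M by (intro exI[of _ \<tau>2]) auto
qed

text \<open>The trace \<tau>' depends on the chosen averages, but the constant 2 in
  \<open>tracial_state_bounded\<close> does not; so averages within \<epsilon> / 2 of the scalar
  suffice.\<close>

lemma trace_eq_mean:
  assumes \<tau>: "tracial_state (A\<lparr>carrier := M\<rparr>) \<tau>" and x: "x \<in> M" and c: "has_mean x c"
  shows "\<tau> x = c"
proof -
  interpret B: unital_cstar "A\<lparr>carrier := M\<rparr>"
    using cstar_algebra_M by (rule cstar_algebra_imp_unital_cstar)
  note D = star_subalgebraD[OF star_subalgebra_M]
  have "cmod (\<tau> x - c) \<le> 0 + \<epsilon>" if "\<epsilon> > 0" for \<epsilon>
  proof -
    obtain "is" where i: "cnrm A (Psis is x \<ominus> c \<odot> \<one>) < \<epsilon> / 2"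
      using c \<open>\<epsilon> > 0\<close> unfolding has_mean_def by (meson half_gt_zero)
    obtain \<tau>' where t: "tracial_state (A\<lparr>carrier := M\<rparr>) \<tau>'" "\<tau> x = \<tau>' (Psis is x)"
      using trace_Psis[OF \<tau>, of "is"] x by blast
    have "\<tau>' (Psis is x \<oplus> (- c) \<odot> \<one>) = \<tau>' (Psis is x) + \<tau>' ((- c) \<odot> \<one>)"
      using t(1) Psis_M[OF x] D(2,6) by (simp add: tracial_state_M_iff)
    also have "\<tau>' ((- c) \<odot> \<one>) = - c" using t(1) D(2) by (simp add: tracial_state_M_iff)
    finally have "\<tau> x - c = \<tau>' (Psis is x \<ominus> c \<odot> \<one>)"
      using t(2) by (simp add: minus_eq scalar_minus)
    also have "cmod \<dots> \<le> 2 * cnrm A (Psis is x \<ominus> c \<odot> \<one>)"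
      using B.tracial_state_bounded[OF t(1), of "Psis is x \<ominus> c \<odot> \<one>"] Psis_M[OF x] D by simp
    finally show ?thesis using i by simp
  qed
  then have "cmod (\<tau> x - c) \<le> 0" by (rule field_le_epsilon)
  then show ?thesis by simp
qed

lemma unique_trace:
  assumes hyp: "little_pullback \<Lambda> d \<or> int_rank (intrinsic_group \<Lambda> d) = 0"
  shows "\<exists>!\<tau>. \<tau> \<in> extensional M \<and> tracial_state (A\<lparr>carrier := M\<rparr>) \<tau>"
proof -
  note D = star_subalgebraD[OF star_subalgebra_M]
  \<comment> \<open>The choice is harmless by \<open>has_mean_unique\<close>;
    \<open>restrict\<close> fixes the values outside \<open>M\<close>, where a trace is not
    determined.\<close>
  define \<tau> where "\<tau> = restrict (\<lambda>x. SOME c. has_mean x c) M"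
  have \<tau>: "has_mean x (\<tau> x)" if "x \<in> M" for x
    using someI_ex[OF M_has_mean[OF hyp that]] that by (simp add: \<tau>_def)
  have val: "\<tau> x = c" if "x \<in> M" "has_mean x c" for x c
    using has_mean_unique[OF \<tau>[OF that(1)] that(2)] .
  have "tracial_state (A\<lparr>carrier := M\<rparr>) \<tau>"
    unfolding tracial_state_M_iff
  proof (intro conjI ballI allI)
    show "\<tau> \<one> = 1" by (intro val D has_mean_one)
    fix x assume x: "x \<in> M"
    show "\<tau> (c \<odot> x) = c * \<tau> x" for c by (intro val D has_mean_scalar \<tau> x)
    show "\<tau> (adj A x \<otimes> x) \<in> \<real>\<^sub>\<ge>\<^sub>0"
      by (rule has_mean_positive[OF M_carrier[OF x]]) (intro \<tau> D x)
    fix y assume y: "y \<in> M"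
    show "\<tau> (x \<oplus> y) = \<tau> x + \<tau> y" by (intro val D has_mean_add \<tau> x y)
    show "\<tau> (x \<otimes> y) = \<tau> (y \<otimes> x)"
      by (rule has_mean_trace[OF hyp x y]) (intro \<tau> D x y)+
  qed
  moreover have "\<tau> \<in> extensional M" by (simp add: \<tau>_def)
  moreover have "\<tau>' = \<tau>" if "\<tau>' \<in> extensional M" "tracial_state (A\<lparr>carrier := M\<rparr>) \<tau>'" for \<tau>'
    using that \<open>\<tau> \<in> extensional M\<close> trace_eq_mean[OF that(2) _ \<tau>] by (intro extensionalityI[of _ M]) auto
  ultimately show ?thesis by blast
qed

end

theorem corollary4p8:
  fixes \<Lambda> :: "('l, 'm) monoid_scheme"
    and d :: "'l \<Rightarrow> nat ^ 'k::finite"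
    and A :: "'a cstar"
    and s :: "'l \<Rightarrow> 'a"
  assumes kgraph: "single_vertex_kgraph \<Lambda> d"
    and universal: "universal_cuntz_algebra \<Lambda> d A s"
    and aperiodic: "simple_cstar A"
    and hyp: "little_pullback \<Lambda> d \<or> int_rank (intrinsic_group \<Lambda> d) = 0"
  shows "\<exists>!\<tau>. \<tau> \<in> extensional (carrier (fixed_point_algebra \<Lambda> d A s)) \<and>
              tracial_state (fixed_point_algebra \<Lambda> d A s) \<tau>"
proof -
  have "cstar_algebra A" using universal by (simp add: universal_cuntz_algebra_def)
  then interpret kgraph_algebra \<Lambda> d A s
    using assms
    by (intro kgraph_algebra.intro kgraph_algebra_axioms.intro cstar_algebra_imp_unital_cstar)
  show ?thesis using unique_trace[OF hyp] by (simp add: fixed_point_algebra_eq)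
qed

end
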